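(* Let $k$ be an algebraically closed field of characteristic zero. Let $d\geq 2$ and $s\geq 2$ be integers with $(s,d)\notin\{(2,2),(3,2),(2,3)\}$, and put $n=s^d$. Let $a_{ij}\in k$ ($i=0,\dots,d$, $j=1,\dots,n$) be the homogeneous coordinates of $n$ generic points of $\mathbb{P}^d$ (the $j$-th point being $(a_{0j}:\dots:a_{dj})$). Let $V=k^{n}$ and let $V^*\subset V$ be the set of vectors $(b_1,\dots,b_n)$ orthogonal to the $d+1$ vectors $(a_{i1},\dots,a_{in})$, $i=0,\dots,d$, i.e. such that $\sum_{j=1}^n a_{ij}b_j=0$ for all $i=0,\dots,d$. Let $G$ be the group of linear transformations $\sigma$ of $k[x_1,\dots,x_n,t_1,\dots,t_n]$ such that $\sigma(t_i)=t_i$ and $\sigma(x_i)=x_i+b_it_i$ for all $i=1,\dots,n$, for some $(b_1,\dots,b_n)\in V^*$. Then the $k$-algebra of elements of $k[x_1,\dots,x_n,t_1,\dots,t_n]$ invariant under $G$ is not finitely generated.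
   Context: "Generic points" means that the coordinates $a_{ij}$ are algebraically independent over the prime field $\mathbb{Q}$ of $k$ (in particular $k$ is assumed to contain such elements). A linear transformation $\sigma$ as in the claim acts as a $k$-algebra automorphism of the polynomial ring. *)

theory Defs
  imports
    "HOL-Library.Poly_Mapping"
    "HOL-Library.FuncSet"
    "HOL-Computational_Algebra.Computational_Algebra"
begin

text \<open>Multivariate polynomials are finitely supported functions from monomials (finitely supported
  exponent vectors) to coefficients; the ring structure is the convolution product of
  \<^theory>\<open>HOL-Library.Poly_Mapping\<close>. The polynomial ring in the variables \<^term>\<open>V\<close> is a subset
  of the type of all polynomials with variables from the index type.\<close>

type_synonym ('v, 'k) mpoly = "('v \<Rightarrow>\<^sub>0 nat) \<Rightarrow>\<^sub>0 'k"

definition mconst :: "'k::comm_ring_1 \<Rightarrow> ('v, 'k) mpoly" where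
  "mconst c = Poly_Mapping.single 0 c"

definition mvar :: "'v \<Rightarrow> ('v, 'k::comm_ring_1) mpoly" where
  "mvar v = Poly_Mapping.single (Poly_Mapping.single v 1) 1"

definition mpoly_ring :: "'v set \<Rightarrow> ('v, 'k::comm_ring_1) mpoly set" where
  "mpoly_ring V = {p. \<forall>m \<in> Poly_Mapping.keys p. Poly_Mapping.keys m \<subseteq> V}"

definition mpoly_eval_rat :: "('v \<Rightarrow> 'k::field_char_0) \<Rightarrow> ('v, rat) mpoly \<Rightarrow> 'k" where
  "mpoly_eval_rat f p =
    (\<Sum>m \<in> Poly_Mapping.keys p. of_rat (Poly_Mapping.lookup p m) *
      (\<Prod>v \<in> Poly_Mapping.keys m. f v ^ Poly_Mapping.lookup m v))"

text \<open>Algebraic independence over the prime field of the family \<^term>\<open>f\<close> indexed by \<^term>\<open>I\<close>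
  (of the family, not merely of its set of values).\<close>

definition alg_independent_rat :: "'v set \<Rightarrow> ('v \<Rightarrow> 'k::field_char_0) \<Rightarrow> bool" where
  "alg_independent_rat I f \<longleftrightarrow> (\<forall>p \<in> mpoly_ring I. mpoly_eval_rat f p = 0 \<longrightarrow> p = 0)"


definition is_subalgebra :: "('v, 'k::comm_ring_1) mpoly set \<Rightarrow> bool" where
  "is_subalgebra A \<longleftrightarrow> range mconst \<subseteq> A \<and> (\<forall>p \<in> A. \<forall>q \<in> A. p + q \<in> A \<and> p * q \<in> A)"

definition finitely_generated_algebra :: "('v, 'k::comm_ring_1) mpoly set \<Rightarrow> bool" where
  "finitely_generated_algebra A \<longleftrightarrow> (\<exists>S. finite S \<and> is_subalgebra hull S = A)"

text \<open>Maps are required to be \<^const>\<open>extensional\<close> so that they are determined by their values on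
  the algebra \<^term>\<open>A\<close>.\<close>

definition algebra_automorphisms ::
  "('v, 'k::comm_ring_1) mpoly set \<Rightarrow> (('v, 'k) mpoly \<Rightarrow> ('v, 'k) mpoly) set" where
  "algebra_automorphisms A = {\<sigma> \<in> extensional A. bij_betw \<sigma> A A \<and>
    (\<forall>p \<in> A. \<forall>q \<in> A. \<sigma> (p + q) = \<sigma> p + \<sigma> q \<and> \<sigma> (p * q) = \<sigma> p * \<sigma> q) \<and>
    (\<forall>c. \<sigma> (mconst c) = mconst c)}"

definition invariants :: "'a set \<Rightarrow> ('a \<Rightarrow> 'a) set \<Rightarrow> 'a set" where
  "invariants A G = {p \<in> A. \<forall>\<sigma> \<in> G. \<sigma> p = p}"


datatype xt_var = X_var nat | T_var nat

definition xt_vars :: "nat \<Rightarrow> xt_var set" where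
  "xt_vars n = X_var ` {1..n} \<union> T_var ` {1..n}"

definition orthogonal_vectors ::
  "nat \<Rightarrow> nat \<Rightarrow> (nat \<Rightarrow> nat \<Rightarrow> 'k::field) \<Rightarrow> (nat \<Rightarrow> 'k) set" where
  "orthogonal_vectors d n a =
    {b \<in> {1..n} \<rightarrow>\<^sub>E UNIV. \<forall>i \<in> {0..d}. (\<Sum>j = 1..n. a i j * b j) = 0}"

definition translation_group ::
  "nat \<Rightarrow> (nat \<Rightarrow> 'k::field) set \<Rightarrow> ((xt_var, 'k) mpoly \<Rightarrow> (xt_var, 'k) mpoly) set" where
  "translation_group n B = {\<sigma> \<in> algebra_automorphisms (mpoly_ring (xt_vars n)).
    \<exists>b \<in> B. \<forall>j \<in> {1..n}.
      \<sigma> (mvar (T_var j)) = mvar (T_var j) \<and>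
      \<sigma> (mvar (X_var j)) = mvar (X_var j) + mconst (b j) * mvar (T_var j)}"

text \<open>A set that is not a subalgebra fails \<^const>\<open>finitely_generated_algebra\<close> trivially; the
  invariants of any set of automorphisms do form a subalgebra.\<close>

lemma is_subalgebra_mpoly_ring: "is_subalgebra (mpoly_ring V)"
proof -
  have "p + q \<in> mpoly_ring V" if "p \<in> mpoly_ring V" "q \<in> mpoly_ring V"
    for p q :: "('a, 'b) mpoly"
    using that Poly_Mapping.keys_add[of p q] unfolding mpoly_ring_def by blast
  moreover have "p * q \<in> mpoly_ring V" if "p \<in> mpoly_ring V" "q \<in> mpoly_ring V"
    for p q :: "('a, 'b) mpoly"
    unfolding mpoly_ring_def
  proof (intro CollectI ballI)
    fix m assume "m \<in> Poly_Mapping.keys (p * q)"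
    then obtain u v where "m = u + v" "u \<in> Poly_Mapping.keys p" "v \<in> Poly_Mapping.keys q"
      using Poly_Mapping.keys_mult[of p q] by blast
    then show "Poly_Mapping.keys m \<subseteq> V"
      using that Poly_Mapping.keys_add[of u v] unfolding mpoly_ring_def by blast
  qed
  moreover have "mconst c \<in> mpoly_ring V" for c :: 'b
    by (simp add: mconst_def mpoly_ring_def)
  ultimately show ?thesis
    by (auto simp: is_subalgebra_def)
qed

lemma is_subalgebra_invariants:
  assumes "is_subalgebra A" and "G \<subseteq> algebra_automorphisms A"
  shows "is_subalgebra (invariants A G)"
  using assms by (fastforce simp: is_subalgebra_def invariants_def algebra_automorphisms_def)

end

theory Submission
  imports Defs
begin

text \<open>Put \<open>y i = (\<Sum>j. a i j * x j / t j)\<close>. Once the \<open>t j\<close> are inverted, the invariants are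
the polynomials in the \<open>y i\<close> and the \<open>t j\<close>. The part of an invariant that has degree \<open>e\<close> in the
\<open>x\<close> and degree \<open>\<mu> j\<close> in each pair \<open>x j, t j\<close> is \<open>F(y)\<close> times the product of the \<open>t j ^ \<mu> j\<close>,
where \<open>F\<close> is a form of degree \<open>e\<close> in \<open>d + 1\<close> variables; it has no denominators exactly if \<open>F\<close>
vanishes to order at least \<open>m j = e - \<mu> j\<close> at the \<open>j\<close>-th point. So the question is how large the
sum of the \<open>m j\<close> can be compared with \<open>e\<close>, and finite generation is refuted by two facts.

\<^item> For a nonzero form of degree \<open>e > 0\<close> the strict inequality \<open>s * (\<Sum>j. m j) < n * e\<close> holds
  (\<open>no_form_at_generic_points\<close>, carried over to invariants by \<open>invariant_gives_form\<close>).
\<^item> A dimension count gives, for every \<open>M\<close>, a form of degree \<open>s * (M + d - 1)\<close> that vanishes to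
  order \<open>M\<close> at all points (\<open>exists_form_transverse\<close>, turned into an invariant by
  \<open>exists_invariant\<close>), so that the quotient of the two sides of the inequality comes arbitrarily
  close to 1.

For finitely many generators the quotient stays away from 1, and a bound on the quotient is
inherited by sums and products; this contradicts the second fact.

The strict inequality is where the work lies. A linear system whose coefficients are polynomials
in generic numbers keeps a nonzero solution under every specialization of these numbers
(\<open>generic_kernel_specializes\<close>). So a form with the given vanishing orders at the generic points
yields such forms over \<open>k[t]\<close> at points \<open>P z\<close> moving along lines that start at the points \<open>z\<close> of
the grid \<open>{0,...,s-1}^d\<close>, for every assignment of the orders to the grid points. The product of
the forms for the \<open>n\<close> cyclic shifts of one assignment is a nonzero form of degree \<open>n * e\<close> that
vanishes to the same order \<open>M = (\<Sum>j. m j)\<close> at every \<open>P z\<close>. If the inequality failed, its degree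
would be at most \<open>s * M\<close>; but a form of degree at most \<open>s * M\<close> with these zeros is zero
(\<open>no_form_at_moved_grid\<close>).

Let \<open>g(x) = x (x - 1) \<cdots> (x - s + 1)\<close>, and expand the dehomogenized form in the products of the
\<open>x_l ^ \<rho>_l * g(x_l) ^ \<gamma>_l\<close> with \<open>\<rho>_l < s\<close>. Substitute \<open>x = z + t W\<close> and take the lowest power of
\<open>t\<close> that occurs for some \<open>z\<close>. Its coefficient is \<open>H z U = (\<Sum>(\<rho>,\<gamma>). e (\<rho>,\<gamma>) * z^\<rho> * U^\<gamma>)\<close> with
\<open>U_l = g'(z_l) * W_l\<close>. Because of the bound on the degree, \<open>H z\<close> has degree at most \<open>M\<close> in \<open>U\<close>,
and its part \<open>G\<close> of degree \<open>M\<close> does not depend on \<open>z\<close>. As \<open>H z\<close> vanishes to order \<open>M\<close> at the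
point \<open>w(z)\<close> that encodes the direction in which \<open>z\<close> moves, \<open>H z U = G (U - w(z))\<close>. Compare the
parts of degree \<open>M - 1\<close> in \<open>U\<close>: on the left the coefficients are polynomials in \<open>z\<close> of degree at
most \<open>s\<close>, on the right stands \<open>- (\<Sum>l. w_l(z) * \<partial>_l G)\<close>. If the \<open>w_l(z)\<close> are distinct monomials
of degree greater than \<open>s\<close> with all exponents less than \<open>s\<close>, then all \<open>\<partial>_l G\<close> vanish, so \<open>G = 0\<close>
by Euler's formula and therefore \<open>H = 0\<close> (\<open>initial_form_vanishes\<close>). The largest monomials
available are \<open>(z_1 \<cdots> z_d) ^ (s - 1) / z_l\<close>, of degree \<open>d * (s - 1) - 1\<close>; this exceeds \<open>s\<close>
unless \<open>(s, d)\<close> is one of the excluded pairs.\<close>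

section \<open>Evaluation of polynomials\<close>

abbreviation "lookup \<equiv> Poly_Mapping.lookup"
abbreviation "keys \<equiv> Poly_Mapping.keys"
abbreviation "single \<equiv> Poly_Mapping.single"

text \<open>Polynomials are evaluated along a homomorphism \<open>h\<close> of the coefficients because the
same polynomial is needed at points over the coefficient field, over its univariate polynomials
and, for rational coefficients, at the generic numbers and at their specializations.\<close>

definition is_ring_hom :: "('a::comm_ring_1 \<Rightarrow> 'b::comm_ring_1) \<Rightarrow> bool" where
  "is_ring_hom h \<longleftrightarrow> h 1 = 1 \<and> (\<forall>x y. h (x + y) = h x + h y \<and> h (x * y) = h x * h y)"

definition meval :: "('v \<Rightarrow> 'r::comm_ring_1) \<Rightarrow> ('v \<Rightarrow>\<^sub>0 nat) \<Rightarrow> 'r" where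
  "meval x m = (\<Prod>v \<in> keys m. x v ^ lookup m v)"

definition peval :: "('k::comm_ring_1 \<Rightarrow> 'r::comm_ring_1) \<Rightarrow> ('v \<Rightarrow> 'r) \<Rightarrow> ('v, 'k) mpoly \<Rightarrow> 'r" where
  "peval h x p = (\<Sum>m \<in> keys p. h (lookup p m) * meval x m)"

lemma is_ring_hom_0: "is_ring_hom h \<Longrightarrow> h 0 = 0"
  unfolding is_ring_hom_def by (metis add_cancel_right_right)

lemma is_ring_hom_sum: "is_ring_hom h \<Longrightarrow> h (sum f A) = (\<Sum>i\<in>A. h (f i))"
  by (induction A rule: infinite_finite_induct) (auto simp: is_ring_hom_0 is_ring_hom_def)

lemma is_ring_hom_prod: "is_ring_hom h \<Longrightarrow> h (prod f A) = (\<Prod>i\<in>A. h (f i))"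
  by (induction A rule: infinite_finite_induct) (auto simp: is_ring_hom_def)

lemma is_ring_hom_power: "is_ring_hom h \<Longrightarrow> h (x ^ n) = h x ^ n"
  by (induction n) (auto simp: is_ring_hom_def)

lemma is_ring_hom_of_nat: "is_ring_hom h \<Longrightarrow> h (of_nat n) = of_nat n"
  by (induction n) (auto simp: is_ring_hom_def is_ring_hom_0)

lemma is_ring_hom_id: "is_ring_hom id"
  and is_ring_hom_const_poly: "is_ring_hom (\<lambda>c. [:c:])"
  and is_ring_hom_of_rat: "is_ring_hom (of_rat :: rat \<Rightarrow> 'k::field_char_0)"
  and is_ring_hom_const_of_rat: "is_ring_hom (\<lambda>q. [:of_rat q :: 'k:])"
  and is_ring_hom_poly: "is_ring_hom (\<lambda>p. poly p y)"
  by (auto simp: is_ring_hom_def of_rat_add of_rat_mult one_pCons)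

lemma meval_superset:
  assumes "finite V" "keys m \<subseteq> V"
  shows "meval x m = (\<Prod>v\<in>V. x v ^ lookup m v)"
  unfolding meval_def
  by (rule prod.mono_neutral_left) (use assms in \<open>auto simp: in_keys_iff\<close>)

lemma meval_0 [simp]: "meval x 0 = 1"
  by (simp add: meval_def)

lemma meval_add: "meval x (m + m') = meval x m * meval x m'"
proof -
  let ?V = "keys m \<union> keys m'"
  have "meval x (m + m') = (\<Prod>v\<in>?V. x v ^ lookup (m + m') v)"
    by (rule meval_superset) (use Poly_Mapping.keys_add[of m m'] in auto)
  also have "\<dots> = (\<Prod>v\<in>?V. x v ^ lookup m v) * (\<Prod>v\<in>?V. x v ^ lookup m' v)"
    by (simp add: lookup_add power_add prod.distrib)
  finally show ?thesis
    by (simp add: meval_superset[of ?V m] meval_superset[of ?V m'])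
qed

lemma meval_single: "meval x (single v k) = x v ^ k"
  by (simp add: meval_superset[of "{v}"])

lemma meval_cong: "(\<And>v. v \<in> keys m \<Longrightarrow> x v = y v) \<Longrightarrow> meval x m = meval y m"
  by (simp add: meval_def)

lemma peval_superset:
  assumes "is_ring_hom h" "finite M" "keys p \<subseteq> M"
  shows "peval h x p = (\<Sum>m\<in>M. h (lookup p m) * meval x m)"
  unfolding peval_def
  by (rule sum.mono_neutral_left) (use assms in \<open>auto simp: in_keys_iff is_ring_hom_0\<close>)

lemma peval_0 [simp]: "peval h x 0 = 0"
  by (simp add: peval_def)

lemma peval_add:
  assumes "is_ring_hom h"
  shows "peval h x (p + q) = peval h x p + peval h x q"
proof -
  let ?M = "keys p \<union> keys q"
  have "peval h x (p + q) = (\<Sum>m\<in>?M. h (lookup (p + q) m) * meval x m)"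
    by (rule peval_superset) (use assms Poly_Mapping.keys_add[of p q] in auto)
  also have "\<dots> = (\<Sum>m\<in>?M. h (lookup p m) * meval x m)
      + (\<Sum>m\<in>?M. h (lookup q m) * meval x m)"
    using assms by (simp add: lookup_add is_ring_hom_def algebra_simps sum.distrib)
  finally show ?thesis
    using assms by (simp add: peval_superset[of h ?M p] peval_superset[of h ?M q])
qed

lemma peval_sum:
  assumes "is_ring_hom h"
  shows "peval h x (sum f A) = (\<Sum>i\<in>A. peval h x (f i))"
  by (induction A rule: infinite_finite_induct) (auto simp: peval_add[OF assms])

lemma peval_single:
  assumes "is_ring_hom h"
  shows "peval h x (single m c) = h c * meval x m"
  by (cases "c = 0") (auto simp: peval_def is_ring_hom_0[OF assms])

lemma poly_mapping_sum_single:
  "(\<Sum>m\<in>keys p. single m (lookup p m)) = p"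
  by (rule poly_mapping_eqI)
    (auto simp: lookup_sum lookup_single when_def in_keys_iff sum.delta split: if_splits)

lemma peval_mult:
  assumes "is_ring_hom h"
  shows "peval h x (p * q) = peval h x p * peval h x q"
proof -
  have "p * q = (\<Sum>m\<in>keys p. \<Sum>m'\<in>keys q.
      single (m + m') (lookup p m * lookup q m'))"
    by (subst (1 2) poly_mapping_sum_single[symmetric]) (simp add: sum_product mult_single)
  also have "peval h x \<dots> = (\<Sum>m\<in>keys p. \<Sum>m'\<in>keys q.
      (h (lookup p m) * meval x m) * (h (lookup q m') * meval x m'))"
    using assms by (simp add: peval_sum peval_single meval_add is_ring_hom_def mult_ac)
  also have "\<dots> = peval h x p * peval h x q"
    by (simp add: peval_def sum_product)
  finally show ?thesis .
qed

lemma peval_mconst: "is_ring_hom h \<Longrightarrow> peval h x (mconst c) = h c"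
  by (simp add: mconst_def peval_single)

lemma peval_mvar: "is_ring_hom h \<Longrightarrow> peval h x (mvar v) = x v"
  by (simp add: mvar_def peval_single meval_single is_ring_hom_def)

lemma mconst_1: "mconst 1 = 1"
  by (simp add: mconst_def)

lemma is_ring_hom_mconst: "is_ring_hom mconst"
  by (simp add: is_ring_hom_def mconst_def single_add mult_single)

lemma is_ring_hom_peval: "is_ring_hom h \<Longrightarrow> is_ring_hom (peval h x)"
  unfolding is_ring_hom_def[of "peval h x"]
  using peval_mconst[of h x 1] by (simp add: peval_add peval_mult mconst_1 is_ring_hom_def[of h])

lemma single_eq_mconst_mult:
  fixes m :: "'b \<Rightarrow>\<^sub>0 nat" and c :: "'a::comm_ring_1"
  shows "single m c = mconst c * (\<Prod>v\<in>keys m. mvar v ^ lookup m v)"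
proof -
  have pow: "mvar v ^ k = single (single v k) (1::'a)" for v :: 'b and k
    by (induction k) (auto simp: mvar_def mult_single single_add[symmetric])
  have "(\<Prod>v\<in>S. mvar v ^ e v) = single (\<Sum>v\<in>S. single v (e v)) (1::'a)"
    if "finite S" for S :: "'b set" and e
    using that by (induction S) (auto simp: pow mult_single)
  then show ?thesis
    by (simp add: poly_mapping_sum_single mconst_def mult_single)
qed

text \<open>An automorphism of the polynomial ring is a homomorphism on that ring only, not on
the whole type of polynomials; this induction, which stays inside, shows that its values at the
variables determine it.\<close>

lemma mpoly_ring_induct [consumes 1, case_names const var add mult]:
  assumes "p \<in> mpoly_ring V"
    and "\<And>c. P (mconst c)"
    and "\<And>v. v \<in> V \<Longrightarrow> P (mvar v)"
    and add: "\<And>p q. P p \<Longrightarrow> P q \<Longrightarrow> P (p + q)"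
    and mult: "\<And>p q. P p \<Longrightarrow> P q \<Longrightarrow> P (p * q)"
  shows "P p"
proof -
  have P01: "P 0" "P 1"
    using assms(2)[of 0] assms(2)[of 1] by (simp_all add: mconst_def)
  have pow: "P (r ^ k)" if "P r" for r k
    using that by (induction k) (auto intro: mult P01)
  have pr: "P (\<Prod>v\<in>S. f v)" if "\<And>v. v \<in> S \<Longrightarrow> P (f v)" for S and f :: "'a \<Rightarrow> ('a, 'b) mpoly"
    using that by (induction S rule: infinite_finite_induct) (auto intro: mult P01)
  have sm: "P (sum f S)" if "\<And>v. v \<in> S \<Longrightarrow> P (f v)" for S and f :: "('a \<Rightarrow>\<^sub>0 nat) \<Rightarrow> ('a, 'b) mpoly"
    using that by (induction S rule: infinite_finite_induct) (auto intro: add P01)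
  have "P (single m (lookup p m))" if "m \<in> keys p" for m
    unfolding single_eq_mconst_mult
    by (intro mult assms(2) pr pow assms(3)) (use that assms(1) in \<open>auto simp: mpoly_ring_def\<close>)
  then have "P (\<Sum>m\<in>keys p. single m (lookup p m))"
    by (intro sm) auto
  then show ?thesis
    by (simp add: poly_mapping_sum_single)
qed

lemma mpoly_ring_mconst: "mconst c \<in> mpoly_ring V"
  and mpoly_ring_add: "p \<in> mpoly_ring V \<Longrightarrow> q \<in> mpoly_ring V \<Longrightarrow> p + q \<in> mpoly_ring V"
  and mpoly_ring_mult: "p \<in> mpoly_ring V \<Longrightarrow> q \<in> mpoly_ring V \<Longrightarrow> p * q \<in> mpoly_ring V"
  using is_subalgebra_mpoly_ring[of V] by (auto simp: is_subalgebra_def)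

lemma mpoly_ring_mvar: "v \<in> V \<Longrightarrow> mvar v \<in> mpoly_ring V"
  by (simp add: mvar_def mpoly_ring_def)

lemma mpoly_ring_0: "0 \<in> mpoly_ring V" and mpoly_ring_1: "1 \<in> mpoly_ring V"
  using mpoly_ring_mconst[of 0 V] mpoly_ring_mconst[of 1 V] by (simp_all add: mconst_def)

lemma mpoly_ring_diff: "p \<in> mpoly_ring V \<Longrightarrow> q \<in> mpoly_ring V \<Longrightarrow> p - q \<in> mpoly_ring V"
  unfolding mpoly_ring_def using keys_diff[of p q] by blast

lemma mpoly_ring_power: "p \<in> mpoly_ring V \<Longrightarrow> p ^ k \<in> mpoly_ring V"
  by (induction k) (auto intro: mpoly_ring_1 mpoly_ring_mult)

lemma mpoly_ring_prod: "(\<And>i. i \<in> S \<Longrightarrow> f i \<in> mpoly_ring V) \<Longrightarrow> prod f S \<in> mpoly_ring V"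
  by (induction S rule: infinite_finite_induct) (auto intro: mpoly_ring_1 mpoly_ring_mult)

lemma mpoly_ring_peval:
  assumes "p \<in> mpoly_ring V" "\<And>v. v \<in> V \<Longrightarrow> g v \<in> mpoly_ring W"
  shows "peval mconst g p \<in> mpoly_ring W"
  using assms(1)
  by (induction rule: mpoly_ring_induct)
    (auto simp: peval_mconst[OF is_ring_hom_mconst] peval_mvar[OF is_ring_hom_mconst] assms(2)
      peval_add[OF is_ring_hom_mconst] peval_mult[OF is_ring_hom_mconst]
      intro: mpoly_ring_mconst mpoly_ring_add mpoly_ring_mult)

lemma mpoly_ring_UNIV: "p \<in> mpoly_ring UNIV"
  by (simp add: mpoly_ring_def)

lemma peval_peval:
  assumes "is_ring_hom h"
  shows "peval h x (peval mconst g p) = peval h (\<lambda>v. peval h x (g v)) p"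
  using mpoly_ring_UNIV[of p]
  by (induction rule: mpoly_ring_induct)
    (simp_all add: peval_mconst peval_mvar peval_add peval_mult is_ring_hom_mconst assms)

lemma peval_mvar_ident: "peval mconst mvar p = p"
  using mpoly_ring_UNIV[of p]
  by (induction rule: mpoly_ring_induct)
    (simp_all add: peval_mconst peval_mvar peval_add peval_mult is_ring_hom_mconst)

lemma peval_hom:
  assumes "is_ring_hom h" "is_ring_hom f"
  shows "f (peval h x p) = peval (\<lambda>c. f (h c)) (\<lambda>v. f (x v)) p"
  using assms by (simp add: peval_def meval_def is_ring_hom_sum is_ring_hom_prod is_ring_hom_power
      is_ring_hom_def[of f])

lemma peval_cong:
  assumes "p \<in> mpoly_ring V" "\<And>v. v \<in> V \<Longrightarrow> x v = y v"
  shows "peval h x p = peval h y p"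
  unfolding peval_def
  by (intro sum.cong refl arg_cong2[where f = "(*)"] meval_cong)
     (use assms in \<open>auto simp: mpoly_ring_def\<close>)

lemma poly_ident_univ:
  fixes c :: "'m \<Rightarrow> 'k::idom"
  assumes "finite A" "\<And>m. m \<in> A \<Longrightarrow> infinite S \<or> e m < card S"
    and "\<And>x. x \<in> S \<Longrightarrow> (\<Sum>m\<in>A. c m * x ^ e m) = 0"
  shows "(\<Sum>m\<in>{m\<in>A. e m = k}. c m) = 0"
proof -
  obtain S' where S': "S' \<subseteq> S" "finite S'" "\<And>m. m \<in> A \<Longrightarrow> e m < card S'"
  proof (cases "finite S")
    case True
    then show ?thesis using assms(2) that[of S] by auto
  next
    case False
    obtain T where "T \<subseteq> S" "finite T" "card T = Suc (Max (insert 0 (e ` A)))"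
      using infinite_arbitrarily_large[OF False] by blast
    moreover have "e m < Suc (Max (insert 0 (e ` A)))" if "m \<in> A" for m
      using that assms(1) by (simp add: less_Suc_eq_le)
    ultimately show ?thesis using that[of T] by auto
  qed
  define p where "p = (\<Sum>m\<in>A. monom (c m) (e m))"
  have "p = 0"
  proof (cases "A = {}")
    case True
    then show ?thesis by (simp add: p_def)
  next
    case False
    then have pos: "card S' > 0" using S'(3) by fastforce
    show ?thesis
    proof (rule poly_eqI_degree[of S'])
      show "poly p x = poly 0 x" if "x \<in> S'" for x
        using assms(3)[of x] that S'(1) by (auto simp: p_def poly_sum poly_monom)
      show "degree p < card S'"
        unfolding p_def
        by (rule degree_sum_less) (use S'(3) pos degree_monom_le le_less_trans in \<open>blast+\<close>)
      show "degree (0 :: 'k poly) < card S'" using pos by simp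
    qed
  qed
  then have "coeff p k = 0" by simp
  then have "(\<Sum>m\<in>A. if e m = k then c m else 0) = 0"
    by (simp add: p_def coeff_sum coeff_monom)
  then show ?thesis
    using assms(1) by (simp add: sum.inter_filter)
qed

text \<open>A polynomial function that vanishes on a product of sets, each larger than the
degree in its variable, has no nonzero coefficient. The terms are indexed by an arbitrary set,
and several indices may carry the same monomial; this makes the lemma applicable to sums that
are not sorted by monomials, as for the first-order comparison on the grid.\<close>

lemma poly_ident:
  fixes c :: "'m \<Rightarrow> 'k::idom"
  assumes "finite V" "finite A" "\<And>m v. m \<in> A \<Longrightarrow> v \<in> V \<Longrightarrow> infinite (S v) \<or> e m v < card (S v)"
    and "\<And>x. (\<And>v. v \<in> V \<Longrightarrow> x v \<in> S v) \<Longrightarrow> (\<Sum>m\<in>A. c m * (\<Prod>v\<in>V. x v ^ e m v)) = 0"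
  shows "(\<Sum>m\<in>{m\<in>A. \<forall>v\<in>V. e m v = \<tau> v}. c m) = 0"
  using assms
proof (induction V arbitrary: A rule: finite_induct)
  case empty
  then show ?case by simp
next
  case (insert v V)
  have "(\<Sum>m\<in>{m\<in>A. e m v = \<tau> v}. c m * (\<Prod>w\<in>V. x w ^ e m w)) = 0"
    if x: "\<And>w. w \<in> V \<Longrightarrow> x w \<in> S w" for x
  proof (rule poly_ident_univ[where S = "S v"])
    show "(\<Sum>m\<in>A. (c m * (\<Prod>w\<in>V. x w ^ e m w)) * y ^ e m v) = 0" if "y \<in> S v" for y
    proof -
      have "(\<Sum>m\<in>A. c m * (\<Prod>w\<in>insert v V. (x(v := y)) w ^ e m w)) = 0"
        by (rule insert.prems(3)) (use x that insert.hyps in auto)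
      moreover have "(\<Prod>w\<in>V. (x(v := y)) w ^ e m w) = (\<Prod>w\<in>V. x w ^ e m w)" for m
        by (rule prod.cong) (use insert.hyps in auto)
      ultimately show ?thesis
        using insert.hyps by (simp add: mult_ac)
    qed
  qed (use insert.prems in auto)
  then have "(\<Sum>m\<in>{m \<in> {m\<in>A. e m v = \<tau> v}. \<forall>v\<in>V. e m v = \<tau> v}. c m) = 0"
    using insert.prems by (intro insert.IH) auto
  then show ?case
    by (simp add: conj_ac)
qed

lemma poly_ident_inj:
  fixes c :: "'m \<Rightarrow> 'k::idom"
  assumes "finite V" "finite A" "\<And>m v. m \<in> A \<Longrightarrow> v \<in> V \<Longrightarrow> infinite (S v) \<or> e m v < card (S v)"
    and "\<And>x. (\<And>v. v \<in> V \<Longrightarrow> x v \<in> S v) \<Longrightarrow> (\<Sum>m\<in>A. c m * (\<Prod>v\<in>V. x v ^ e m v)) = 0"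
    and "\<And>m m'. m \<in> A \<Longrightarrow> m' \<in> A \<Longrightarrow> (\<And>v. v \<in> V \<Longrightarrow> e m v = e m' v) \<Longrightarrow> m = m'"
    and "m0 \<in> A"
  shows "c m0 = 0"
proof -
  have "{m\<in>A. \<forall>v\<in>V. e m v = e m0 v} = {m0}"
    using assms(5,6) by auto
  then show ?thesis
    using poly_ident[OF assms(1-4), of "e m0"] by simp
qed

lemma lookup_eqI_on:
  assumes "keys m \<subseteq> V" "keys m' \<subseteq> V"
    "\<And>v. v \<in> V \<Longrightarrow> lookup m v = lookup m' v"
  shows "m = m'"
  by (rule poly_mapping_eqI) (metis assms in_keys_iff subsetD)

lemma mpoly_ext_zero:
  fixes p :: "('v, 'k::idom) mpoly"
  assumes "p \<in> mpoly_ring V" "finite V" "\<And>v. v \<in> V \<Longrightarrow> infinite (S v)"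
    and "\<And>x. (\<And>v. v \<in> V \<Longrightarrow> x v \<in> S v) \<Longrightarrow> peval id x p = 0"
  shows "p = 0"
proof (rule ccontr)
  assume "p \<noteq> 0"
  then obtain m0 where m0: "m0 \<in> keys p" by (metis keys_eq_empty ex_in_conv)
  have "lookup p m0 = 0"
  proof (rule poly_ident_inj[of V "keys p" S "lookup" "lookup p"])
    show "(\<Sum>m\<in>keys p. lookup p m * (\<Prod>v\<in>V. x v ^ lookup m v)) = 0"
      if "\<And>v. v \<in> V \<Longrightarrow> x v \<in> S v" for x
    proof -
      have "peval id x p = (\<Sum>m\<in>keys p. lookup p m * (\<Prod>v\<in>V. x v ^ lookup m v))"
        unfolding peval_def
        by (intro sum.cong refl) (use assms in \<open>auto simp: mpoly_ring_def meval_superset\<close>)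
      then show ?thesis using assms(4)[OF that] by simp
    qed
  qed (use assms m0 in \<open>auto simp: mpoly_ring_def intro: lookup_eqI_on[of _ V]\<close>)
  with m0 show False by (simp add: in_keys_iff)
qed

definition mdeg :: "('v \<Rightarrow>\<^sub>0 nat) \<Rightarrow> nat" where
  "mdeg m = (\<Sum>v\<in>keys m. lookup m v)"

lemma mdeg_superset:
  assumes "finite V" "keys m \<subseteq> V"
  shows "mdeg m = (\<Sum>v\<in>V. lookup m v)"
  unfolding mdeg_def
  by (rule sum.mono_neutral_left) (use assms in \<open>auto simp: in_keys_iff\<close>)

lemma mdeg_add: "mdeg (m + m') = mdeg m + mdeg m'"
proof -
  let ?V = "keys m \<union> keys m'"
  have "mdeg (m + m') = (\<Sum>v\<in>?V. lookup (m + m') v)"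
    by (rule mdeg_superset) (use Poly_Mapping.keys_add[of m m'] in auto)
  then show ?thesis
    by (simp add: lookup_add sum.distrib mdeg_superset[of ?V m] mdeg_superset[of ?V m'])
qed

definition homog :: "'v set \<Rightarrow> nat \<Rightarrow> ('v, 'k::comm_ring_1) mpoly set" where
  "homog V e = {p \<in> mpoly_ring V. \<forall>m\<in>keys p. mdeg m = e}"

lemma homog_mconst: "mconst c \<in> homog V 0"
  by (simp add: homog_def mpoly_ring_mconst) (simp add: mconst_def mdeg_def)

lemma homog_mvar: "v \<in> V \<Longrightarrow> mvar v \<in> homog V 1"
  by (simp add: homog_def mpoly_ring_mvar) (simp add: mvar_def mdeg_def)

lemma homog_add: "p \<in> homog V e \<Longrightarrow> q \<in> homog V e \<Longrightarrow> p + q \<in> homog V e"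
  using Poly_Mapping.keys_add[of p q] by (auto simp: homog_def mpoly_ring_add)

lemma homog_mult:
  assumes "p \<in> homog V e" "q \<in> homog V e'"
  shows "p * q \<in> homog V (e + e')"
  using assms keys_mult[of p q] by (fastforce simp: homog_def mpoly_ring_mult mdeg_add)

lemma homog_0: "0 \<in> homog V e"
  by (simp add: homog_def mpoly_ring_0)

lemma homog_1: "1 \<in> homog V 0"
  using homog_mconst[of 1] by (simp add: mconst_1)

lemma homog_sum: "(\<And>i. i \<in> A \<Longrightarrow> f i \<in> homog V e) \<Longrightarrow> sum f A \<in> homog V e"
  by (induction A rule: infinite_finite_induct) (auto intro: homog_0 homog_add)

lemma homog_prod: "finite A \<Longrightarrow> (\<And>i. i \<in> A \<Longrightarrow> f i \<in> homog V (e i)) \<Longrightarrow> prod f A \<in> homog V (sum e A)"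
  by (induction A rule: finite_induct) (auto intro: homog_1 homog_mult)

lemma homog_power: "p \<in> homog V e \<Longrightarrow> p ^ k \<in> homog V (k * e)"
  by (induction k) (auto intro: homog_1 homog_mult)

lemma homog_peval:
  assumes "p \<in> homog V e" "\<And>v. v \<in> V \<Longrightarrow> g v \<in> homog W 1"
  shows "peval mconst g p \<in> homog W e"
  unfolding peval_def
proof (rule homog_sum)
  fix m assume m: "m \<in> keys p"
  have "meval g m \<in> homog W (\<Sum>v\<in>keys m. lookup m v * 1)"
    unfolding meval_def
    by (rule homog_prod, simp, rule homog_power)
       (use assms m in \<open>auto simp: homog_def mpoly_ring_def\<close>)
  then have "meval g m \<in> homog W e"
    using assms(1) m by (simp add: homog_def mdeg_def)
  then show "mconst (lookup p m) * meval g m \<in> homog W e"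
    using homog_mult[OF homog_mconst] by fastforce
qed

section \<open>Linear systems with polynomial coefficients\<close>

text \<open>Gaussian elimination without division, performed on the matrix over the source ring
\<open>'r\<close>. If a column has an entry that survives under \<open>\<psi>\<close>, this entry also survives under \<open>\<phi>\<close> and
serves as pivot on both sides at once; if there is none, the corresponding unit vector solves
the system under \<open>\<psi>\<close>.\<close>

lemma kernel_transfer:
  fixes \<phi> :: "'r::comm_ring_1 \<Rightarrow> 'a::idom" and \<psi> :: "'r \<Rightarrow> 'b::idom" and M :: "'i \<Rightarrow> 'c \<Rightarrow> 'r"
  assumes hom: "is_ring_hom \<phi>" "is_ring_hom \<psi>"
    and closed: "\<And>p q. p \<in> R \<Longrightarrow> q \<in> R \<Longrightarrow> p * q \<in> R \<and> p - q \<in> R"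
    and ker: "\<And>p. p \<in> R \<Longrightarrow> \<phi> p = 0 \<Longrightarrow> \<psi> p = 0"
    and "finite J"
    and "\<And>i c. i \<in> I \<Longrightarrow> c \<in> J \<Longrightarrow> M i c \<in> R"
    and "\<exists>c\<in>J. x c \<noteq> 0"
    and "\<And>i. i \<in> I \<Longrightarrow> (\<Sum>c\<in>J. \<phi> (M i c) * x c) = 0"
  shows "\<exists>y. (\<exists>c\<in>J. y c \<noteq> 0) \<and> (\<forall>i\<in>I. (\<Sum>c\<in>J. \<psi> (M i c) * y c) = 0)"
  using assms(5-)
proof (induction J arbitrary: M rule: finite_induct)
  case empty
  then show ?case by simp
next
  case (insert c0 J)
  have minus: "f (p - q) = f p - f q" if "is_ring_hom f" for f :: "'r \<Rightarrow> 'z::comm_ring_1" and p q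
    using that unfolding is_ring_hom_def by (metis add_diff_cancel_right' diff_add_cancel)
  show ?case
  proof (cases "\<forall>i\<in>I. \<psi> (M i c0) = 0")
    case True
    then have "\<forall>i\<in>I. (\<Sum>c\<in>insert c0 J. \<psi> (M i c) * (if c = c0 then 1 else 0)) = 0"
      using insert.hyps by (auto intro!: sum.neutral)
    then show ?thesis
      by (intro exI[of _ "\<lambda>c. if c = c0 then 1 else 0"]) auto
  next
    case False
    then obtain i0 where i0: "i0 \<in> I" "\<psi> (M i0 c0) \<noteq> 0" by blast
    define p where "p = M i0 c0"
    have p: "\<psi> p \<noteq> 0" "\<phi> p \<noteq> 0" "p \<in> R"
      using i0 ker insert.prems(1) by (auto simp: p_def)
    define M' where "M' i c = p * M i c - M i c0 * M i0 c" for i c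
    have M': "f (M' i c) = f p * f (M i c) - f (M i c0) * f (M i0 c)"
      if "is_ring_hom f" for f :: "'r \<Rightarrow> 'z::comm_ring_1" and i c
      using that by (simp add: M'_def minus) (simp add: is_ring_hom_def)
    have row: "\<phi> (M i c0) * x c0 + (\<Sum>c\<in>J. \<phi> (M i c) * x c) = 0" if "i \<in> I" for i
      using insert.prems(3)[OF that] insert.hyps by simp
    have "\<exists>c\<in>J. x c \<noteq> 0"
    proof (rule ccontr)
      assume "\<not> ?thesis"
      then have "\<forall>c\<in>J. x c = 0" by blast
      then have "\<phi> p * x c0 = 0"
        using row[OF i0(1)] by (simp add: p_def)
      then have "x c0 = 0" using p by simp
      then show False using insert.prems(2) \<open>\<forall>c\<in>J. x c = 0\<close> by auto
    qed
    moreover have "(\<Sum>c\<in>J. \<phi> (M' i c) * x c) = 0" if i: "i \<in> I" for i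
    proof -
      have "(\<Sum>c\<in>J. \<phi> (M' i c) * x c)
          = \<phi> p * (\<Sum>c\<in>J. \<phi> (M i c) * x c) - \<phi> (M i c0) * (\<Sum>c\<in>J. \<phi> (M i0 c) * x c)"
        by (simp add: M'[OF hom(1)] sum_distrib_left sum_subtractf algebra_simps)
      also have "(\<Sum>c\<in>J. \<phi> (M i c) * x c) = - (\<phi> (M i c0) * x c0)"
        using row[OF i] by (simp add: add_eq_0_iff)
      also have "(\<Sum>c\<in>J. \<phi> (M i0 c) * x c) = - (\<phi> p * x c0)"
        using row[OF i0(1)] by (simp add: add_eq_0_iff p_def)
      finally show ?thesis by (simp add: algebra_simps)
    qed
    moreover have "M' i c \<in> R" if "i \<in> I" "c \<in> J" for i c
      unfolding M'_def using closed insert.prems(1) that i0 p(3) by auto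
    ultimately obtain y where y: "\<exists>c\<in>J. y c \<noteq> 0" "\<forall>i\<in>I. (\<Sum>c\<in>J. \<psi> (M' i c) * y c) = 0"
      using insert.IH[of M'] by blast
    define y' where "y' c = (if c = c0 then - (\<Sum>c\<in>J. \<psi> (M i0 c) * y c) else \<psi> p * y c)" for c
    have "(\<Sum>c\<in>insert c0 J. \<psi> (M i c) * y' c) = 0" if "i \<in> I" for i
    proof -
      have "(\<Sum>c\<in>J. \<psi> (M i c) * y' c) = (\<Sum>c\<in>J. \<psi> (M i c) * (\<psi> p * y c))"
        by (rule sum.cong) (use insert.hyps in \<open>auto simp: y'_def\<close>)
      then have "(\<Sum>c\<in>insert c0 J. \<psi> (M i c) * y' c) = (\<Sum>c\<in>J. \<psi> (M' i c) * y c)"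
        using insert.hyps
        by (simp add: y'_def M'[OF hom(2)] sum_distrib_left sum_subtractf algebra_simps)
      then show ?thesis using y that by simp
    qed
    moreover have "\<exists>c\<in>insert c0 J. y' c \<noteq> 0"
      using y(1) p insert.hyps by (auto simp: y'_def)
    ultimately show ?thesis by blast
  qed
qed

lemma underdetermined_system:
  fixes M :: "'i \<Rightarrow> 'c \<Rightarrow> 'a::idom"
  assumes "finite I" "finite J" "card I < card J"
  shows "\<exists>x. (\<exists>c\<in>J. x c \<noteq> 0) \<and> (\<forall>i\<in>I. (\<Sum>c\<in>J. M i c * x c) = 0)"
  using assms
proof (induction I arbitrary: J M rule: finite_induct)
  case empty
  then show ?case by (intro exI[of _ "\<lambda>_. 1"]) (auto simp: card_gt_0_iff)
next
  case (insert r I)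
  show ?case
  proof (cases "\<forall>c\<in>J. M r c = 0")
    case True
    obtain x where "\<exists>c\<in>J. x c \<noteq> 0" "\<forall>i\<in>I. (\<Sum>c\<in>J. M i c * x c) = 0"
      using insert.IH[of J M] insert.prems insert.hyps by auto
    then show ?thesis using True by (intro exI[of _ x]) auto
  next
    case False
    then obtain c0 where c0: "c0 \<in> J" "M r c0 \<noteq> 0" by blast
    define J' where "J' = J - {c0}"
    have J: "J = insert c0 J'" "c0 \<notin> J'" "finite J'"
      using c0 insert.prems by (auto simp: J'_def)
    have "card I < card J'"
      using insert.prems insert.hyps J by (simp add: J(1) card_insert_if)
    then obtain y where y: "\<exists>c\<in>J'. y c \<noteq> 0"
        "\<forall>i\<in>I. (\<Sum>c\<in>J'. (M r c0 * M i c - M i c0 * M r c) * y c) = 0"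
      using insert.IH[of J' "\<lambda>i c. M r c0 * M i c - M i c0 * M r c"] J(3) by auto
    define x where "x c = (if c = c0 then - (\<Sum>c\<in>J'. M r c * y c) else M r c0 * y c)" for c
    have eq: "(\<Sum>c\<in>J. M i c * x c) = (\<Sum>c\<in>J'. (M r c0 * M i c - M i c0 * M r c) * y c)" for i
    proof -
      have "(\<Sum>c\<in>J'. M i c * x c) = (\<Sum>c\<in>J'. M i c * (M r c0 * y c))"
        by (rule sum.cong) (use J in \<open>auto simp: x_def\<close>)
      then show ?thesis
        using J by (simp add: x_def sum_distrib_left sum_subtractf algebra_simps)
    qed
    moreover have "\<exists>c\<in>J. x c \<noteq> 0"
    proof -
      obtain c where "c \<in> J'" "y c \<noteq> 0" using y(1) by blast
      then have "x c \<noteq> 0" "c \<in> J" using c0(2) J by (auto simp: x_def)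
      then show ?thesis by blast
    qed
    moreover have "(\<Sum>c\<in>J. M r c * x c) = 0" by (simp add: eq[of r])
    ultimately show ?thesis using y(2) by (intro exI[of _ x]) auto
  qed
qed

lemma surjective_of_independent_rows:
  fixes M :: "'i \<Rightarrow> 'c \<Rightarrow> 'a::field"
  assumes "finite I" "finite J"
    and "\<And>c. (\<And>j. j \<in> J \<Longrightarrow> (\<Sum>i\<in>I. c i * M i j) = 0) \<Longrightarrow> \<forall>i\<in>I. c i = 0"
  shows "\<exists>x. \<forall>i\<in>I. (\<Sum>j\<in>J. M i j * x j) = Y i"
  using assms
proof (induction I arbitrary: M Y rule: finite_induct)
  case empty
  then show ?case by simp
next
  case (insert r I)
  have "\<exists>j0\<in>J. M r j0 \<noteq> 0"
  proof (rule ccontr)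
    assume *: "\<not> ?thesis"
    have "(\<Sum>i\<in>insert r I. (if i = r then 1 else 0) * M i j) = 0" if "j \<in> J" for j
      using * that by (intro sum.neutral) auto
    from insert.prems(2)[OF this] show False by simp
  qed
  then obtain j0 where j0: "j0 \<in> J" "M r j0 \<noteq> 0" by blast
  define t where "t i = M i j0 / M r j0" for i
  define M' where "M' i j = M i j - t i * M r j" for i j
  have "\<forall>i\<in>I. c i = 0" if c: "\<And>j. j \<in> J \<Longrightarrow> (\<Sum>i\<in>I. c i * M' i j) = 0" for c
  proof -
    define c' where "c' i = (if i = r then - (\<Sum>i\<in>I. c i * t i) else c i)" for i
    have "(\<Sum>i\<in>insert r I. c' i * M i j) = 0" if "j \<in> J" for j
    proof -
      have "(\<Sum>i\<in>I. c' i * M i j) = (\<Sum>i\<in>I. c i * M i j)"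
        by (rule sum.cong) (use insert.hyps in \<open>auto simp: c'_def\<close>)
      then have "(\<Sum>i\<in>insert r I. c' i * M i j) = (\<Sum>i\<in>I. c i * M' i j)"
        using insert.hyps
        by (simp add: c'_def M'_def sum_distrib_left sum_distrib_right sum_subtractf algebra_simps)
      then show ?thesis using c that by simp
    qed
    from insert.prems(2)[OF this] show ?thesis
      using insert.hyps by (auto simp: c'_def split: if_splits)
  qed
  then obtain x where x: "\<forall>i\<in>I. (\<Sum>j\<in>J. M' i j * x j) = Y i - t i * Y r"
    using insert.IH[of M' "\<lambda>i. Y i - t i * Y r"] insert.prems(1) by blast
  define u where "u = (Y r - (\<Sum>j\<in>J. M r j * x j)) / M r j0"
  define x' where "x' j = x j + (if j = j0 then u else 0)" for j
  have sum': "(\<Sum>j\<in>J. N j * x' j) = (\<Sum>j\<in>J. N j * x j) + N j0 * u" for N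
  proof -
    have "(\<Sum>j\<in>J. N j * (if j = j0 then u else 0)) = (\<Sum>j\<in>J. if j = j0 then N j * u else 0)"
      by (rule sum.cong) auto
    then show ?thesis
      using insert.prems(1) j0(1) by (simp add: x'_def distrib_left sum.distrib)
  qed
  have r: "(\<Sum>j\<in>J. M r j * x' j) = Y r"
    using j0(2) by (simp add: sum' u_def)
  moreover have "(\<Sum>j\<in>J. M i j * x' j) = Y i" if "i \<in> I" for i
  proof -
    have "(\<Sum>j\<in>J. M' i j * x' j) = Y i - t i * Y r"
      using x that j0(2) by (simp add: sum') (simp add: M'_def t_def)
    moreover have "(\<Sum>j\<in>J. M' i j * x' j) = (\<Sum>j\<in>J. M i j * x' j) - t i * (\<Sum>j\<in>J. M r j * x' j)"
      by (simp add: M'_def sum_distrib_left sum_subtractf algebra_simps)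
    ultimately show ?thesis using r by simp
  qed
  ultimately show ?case by blast
qed

text \<open>The contraposition explains the use: to see that a generic linear system has only
the zero solution, it suffices to find one specialization over some domain with only the zero
solution.\<close>

lemma generic_kernel_specializes:
  fixes a :: "'v \<Rightarrow> 'k::field_char_0" and h :: "rat \<Rightarrow> 'b::idom"
  assumes "alg_independent_rat V a" "is_ring_hom h"
    and "finite J" "\<And>i c. i \<in> I \<Longrightarrow> c \<in> J \<Longrightarrow> M i c \<in> mpoly_ring V"
    and "\<exists>c\<in>J. x c \<noteq> 0" "\<And>i. i \<in> I \<Longrightarrow> (\<Sum>c\<in>J. peval of_rat a (M i c) * x c) = 0"
  shows "\<exists>y. (\<exists>c\<in>J. y c \<noteq> 0) \<and> (\<forall>i\<in>I. (\<Sum>c\<in>J. peval h B (M i c) * y c) = 0)"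
proof (rule kernel_transfer[where \<phi> = "peval of_rat a" and R = "mpoly_ring V"])
  show "peval h B p = 0" if "p \<in> mpoly_ring V" "peval of_rat a p = 0" for p
  proof -
    have "mpoly_eval_rat a p = peval of_rat a p"
      by (simp add: mpoly_eval_rat_def peval_def meval_def)
    then have "p = 0" using assms(1) that by (simp add: alg_independent_rat_def)
    then show ?thesis by simp
  qed
qed (use assms in \<open>auto simp: is_ring_hom_peval is_ring_hom_of_rat mpoly_ring_mult mpoly_ring_diff\<close>)

section \<open>Initial forms at a moving grid\<close>

definition grid_nodes :: "nat \<Rightarrow> 'k::field_char_0 set" where
  "grid_nodes s = of_nat ` {..<s}"

lemma card_grid_nodes: "card (grid_nodes s :: 'k::field_char_0 set) = s"
  and finite_grid_nodes: "finite (grid_nodes s :: 'k::field_char_0 set)"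
  by (auto simp: grid_nodes_def card_image inj_on_def)

text \<open>The monomial \<open>w_l(z) = (z_1 \<cdots> z_d) ^ (s - 1) / z_l\<close>: as a function on the grid it is
not congruent to a polynomial of degree at most \<open>s\<close>, and different \<open>l\<close> give independent
functions.\<close>

definition grid_shift :: "nat \<Rightarrow> nat \<Rightarrow> (nat \<Rightarrow> 'k::field_char_0) \<Rightarrow> nat \<Rightarrow> 'k" where
  "grid_shift d s z l = (\<Prod>i\<in>{1..d}. z i ^ (s - 1 - (if i = l then 1 else 0)))"

lemma coeff_1_prod_linear_powers:
  fixes u a :: "'i \<Rightarrow> 'k::field_char_0"
  assumes "finite V"
  shows "coeff (\<Prod>l\<in>V. [:u l, a l:] ^ g l) 1 =
    (\<Sum>l\<in>V. a l * ((\<Prod>i\<in>V - {l}. u i ^ g i) * (of_nat (g l) * u l ^ (g l - 1))))"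
proof -
  have "coeff p 1 = poly (pderiv p) 0" for p :: "'k poly"
    by (simp add: poly_0_coeff_0 coeff_pderiv)
  then show ?thesis
    using assms
    by (simp add: pderiv_prod poly_sum poly_prod pderiv_power pderiv_pCons mult_ac)
qed

lemma poly_eq_off_zero:
  fixes p q :: "'k::field_char_0 poly"
  assumes "\<And>x. x \<noteq> 0 \<Longrightarrow> poly p x = poly q x"
  shows "p = q"
proof -
  have "[:0, 1:] * p = [:0, 1:] * q"
    by (subst poly_eq_poly_eq_iff[symmetric]) (use assms in \<open>force simp: fun_eq_iff\<close>)
  then show ?thesis by (metis mult_cancel_left pCons_eq_0_iff zero_neq_one)
qed

text \<open>In \<open>N l = s * \<gamma> l + \<rho> l\<close> the quotient \<open>\<gamma> l\<close> is the exponent of \<open>U l\<close> and the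
remainder \<open>\<rho> l\<close> the exponent of \<open>z l\<close>. The hypothesis \<open>key\<close> says \<open>H z (w(z) + U) = G U\<close>. In the
part of degree \<open>M - 1\<close> of \<open>H z U = G (U - w(z))\<close>, the left side has degree at most \<open>s\<close> in \<open>z\<close>,
whereas the \<open>w_l(z)\<close> on the right side have degree \<open>d * (s - 1) - 1 > s\<close>; both are reduced with
respect to the grid, so the partial derivatives of \<open>G\<close> vanish.\<close>

lemma initial_form_vanishes:
  fixes e :: "(nat \<Rightarrow> nat) \<Rightarrow> 'k::field_char_0" and s d M :: nat
  defines "hi N \<equiv> (\<Sum>l\<in>{1..d}. N l div s)"
    and "lo z N \<equiv> (\<Prod>l\<in>{1..d}. z l ^ (N l mod s))"
    and "up U N \<equiv> (\<Prod>l\<in>{1..d}. U l ^ (N l div s))"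
  assumes "finite \<N>" "\<N> \<subseteq> {1..d} \<rightarrow>\<^sub>E UNIV" and D: "\<And>N. N \<in> \<N> \<Longrightarrow> (\<Sum>l\<in>{1..d}. N l) \<le> s * M"
    and "M > 0" "s \<ge> 2" "d * (s - 1) > s + 1"
    and key: "\<And>(z :: nat \<Rightarrow> 'k) U. (\<And>l. l \<in> {1..d} \<Longrightarrow> z l \<in> grid_nodes s) \<Longrightarrow>
        (\<Sum>N\<in>\<N>. e N * lo z N * up (\<lambda>l. grid_shift d s z l + U l) N)
        = (\<Sum>N\<in>{N\<in>\<N>. hi N = M}. e N * up U N)"
    and "N0 \<in> \<N>"
  shows "e N0 = 0"
proof -
  let ?V = "{1..d}"
  let ?top = "{N\<in>\<N>. hi N = M}"
  have finS: "infinite (grid_nodes s :: 'k set) \<or> k < card (grid_nodes s :: 'k set) \<longleftrightarrow> k < s" for k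
    by (simp add: card_grid_nodes finite_grid_nodes)
  have split: "(\<Sum>l\<in>?V. N l) = s * hi N + (\<Sum>l\<in>?V. N l mod s)" for N :: "nat \<Rightarrow> nat"
    by (simp add: hi_def sum_distrib_left sum.distrib[symmetric])
  have hi_le: "hi N \<le> M" if "N \<in> \<N>" for N
  proof -
    have "s * hi N \<le> s * M" using D[OF that] split[of N] by linarith
    then show ?thesis using \<open>s \<ge> 2\<close> by simp
  qed
  define Dl where "Dl l U = (\<Sum>N\<in>?top. e N * ((\<Prod>i\<in>?V - {l}. U i ^ (N i div s)) *
      (of_nat (N l div s) * U l ^ (N l div s - 1))))" for l and U :: "nat \<Rightarrow> 'k"
  have first_order: "(\<Sum>N\<in>{N\<in>\<N>. hi N + 1 = M}. e N * lo z N * up U N)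
      + (\<Sum>l\<in>?V. Dl l U * grid_shift d s z l) = 0"
    if z: "\<And>l. l \<in> ?V \<Longrightarrow> z l \<in> grid_nodes s" for z U
  proof -
    (* With U replaced by U / x and multiplied by x ^ M, the identity H z U = G
       (U - w(z)) becomes an equality of polynomials in x, whose coefficient at x is the part
       of degree M - 1 in U. *)
    define p where "p = (\<Sum>N\<in>\<N>. monom (e N * lo z N * up U N) (M - hi N))"
    define q where "q = (\<Sum>N\<in>?top. smult (e N) (\<Prod>l\<in>?V. [:U l, - grid_shift d s z l:] ^ (N l div s)))"
    have "p = q"
    proof (rule poly_eq_off_zero)
      fix x :: 'k assume x: "x \<noteq> 0"
      have up_scale: "up (\<lambda>l. inverse x * f l) N = inverse x ^ hi N * up f N" for f N
        by (simp add: up_def hi_def power_mult_distrib prod.distrib power_sum)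
      have "poly p x = (\<Sum>N\<in>\<N>. e N * lo z N * up U N * x ^ (M - hi N))"
        by (simp add: p_def poly_sum poly_monom)
      also have "\<dots> = x ^ M * (\<Sum>N\<in>\<N>. e N * lo z N * up (\<lambda>l. inverse x * U l) N)"
        unfolding sum_distrib_left
      proof (rule sum.cong[OF refl])
        fix N assume "N \<in> \<N>"
        then have "x ^ (M - hi N) = x ^ M * inverse x ^ hi N"
          using hi_le[of N] x by (simp add: power_diff power_inverse divide_inverse)
        then show "e N * lo z N * up U N * x ^ (M - hi N)
            = x ^ M * (e N * lo z N * up (\<lambda>l. inverse x * U l) N)"
          by (simp add: up_scale)
      qed
      also have "(\<Sum>N\<in>\<N>. e N * lo z N * up (\<lambda>l. inverse x * U l) N)
          = (\<Sum>N\<in>?top. e N * up (\<lambda>l. inverse x * (U l - x * grid_shift d s z l)) N)"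
        using key[where z = z and U = "\<lambda>l. inverse x * (U l - x * grid_shift d s z l)", OF z] x
        by (simp add: right_diff_distrib mult.assoc[symmetric])
      also have "\<dots> = inverse x ^ M * (\<Sum>N\<in>?top. e N * up (\<lambda>l. U l - x * grid_shift d s z l) N)"
        unfolding sum_distrib_left by (rule sum.cong) (simp_all add: up_scale)
      also have "x ^ M * \<dots> = (\<Sum>N\<in>?top. e N * up (\<lambda>l. U l - x * grid_shift d s z l) N)"
        using x by (simp add: power_inverse mult.assoc[symmetric])
      also have "\<dots> = poly q x"
        by (simp add: q_def poly_sum poly_prod up_def)
      finally show "poly p x = poly q x" .
    qed
    moreover have "coeff p 1 = (\<Sum>N\<in>{N\<in>\<N>. hi N + 1 = M}. e N * lo z N * up U N)"
    proof -
      have "coeff p 1 = (\<Sum>N\<in>\<N>. if hi N + 1 = M then e N * lo z N * up U N else 0)"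
        unfolding p_def coeff_sum coeff_monom by (rule sum.cong) auto
      then show ?thesis using \<open>finite \<N>\<close> by (simp add: sum.inter_filter)
    qed
    moreover have "coeff q 1 = - (\<Sum>l\<in>?V. Dl l U * grid_shift d s z l)"
    proof -
      have "coeff q 1 = (\<Sum>N\<in>?top. \<Sum>l\<in>?V. - (e N * ((\<Prod>i\<in>?V - {l}. U i ^ (N i div s)) *
          (of_nat (N l div s) * U l ^ (N l div s - 1)))) * grid_shift d s z l)"
        unfolding q_def coeff_sum coeff_smult coeff_1_prod_linear_powers[OF finite_atLeastAtMost]
            sum_distrib_left
        by (intro sum.cong refl) (simp add: mult_ac)
      also have "\<dots> = (\<Sum>l\<in>?V. - Dl l U * grid_shift d s z l)"
        by (subst sum.swap) (simp add: Dl_def sum_distrib_right sum_negf)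
      finally show ?thesis by (simp add: sum_negf)
    qed
    ultimately show ?thesis by simp
  qed
  have partial_0: "Dl l0 U = 0" if l0: "l0 \<in> ?V" for l0 U
  proof -
    define \<tau> where "\<tau> l i = s - 1 - (if i = l then 1 else 0)" for l i :: nat
    let ?low = "{N\<in>\<N>. hi N + 1 = M}"
    (* Inl: the terms of the part of degree M - 1; Inr l: the monomial w_l(z). *)
    define A where "A = ?low <+> ?V"
    define c where "c = case_sum (\<lambda>N. e N * up U N) (\<lambda>l. Dl l U)"
    define ex where "ex = case_sum (\<lambda>N i. N i mod s) \<tau>"
    have "(\<Sum>m\<in>{m\<in>A. \<forall>i\<in>?V. ex m i = \<tau> l0 i}. c m) = 0"
    proof (rule poly_ident[where S = "\<lambda>_. grid_nodes s"])
      show "finite A" using \<open>finite \<N>\<close> by (simp add: A_def)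
      show "infinite (grid_nodes s :: 'k set) \<or> ex m v < card (grid_nodes s :: 'k set)"
          if "m \<in> A" for m v
        unfolding finS using \<open>s \<ge> 2\<close> by (cases m) (auto simp: ex_def \<tau>_def)
      show "(\<Sum>m\<in>A. c m * (\<Prod>v\<in>?V. z v ^ ex m v)) = 0"
        if "\<And>v. v \<in> ?V \<Longrightarrow> z v \<in> grid_nodes s" for z
        using first_order[where z = z and U = U, OF that] \<open>finite \<N>\<close>
        by (simp add: A_def c_def ex_def sum.Plus lo_def grid_shift_def \<tau>_def mult_ac)
    qed simp
    moreover have "{m\<in>A. \<forall>i\<in>?V. ex m i = \<tau> l0 i} = {Inr l0}"
    proof -
      (* The terms on the left have degree at most s in z, the monomial has
         degree d * (s - 1) - 1. *)
      have "\<forall>N\<in>?low. \<not> (\<forall>i\<in>?V. N i mod s = \<tau> l0 i)"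
      proof (intro ballI notI)
        fix N assume N: "N \<in> ?low"
        assume *: "\<forall>i\<in>?V. N i mod s = \<tau> l0 i"
        have "(\<Sum>i\<in>?V. \<tau> l0 i) + 1 = (\<Sum>i\<in>?V. \<tau> l0 i) + (\<Sum>i\<in>?V. if i = l0 then 1 else 0)"
          using l0 by simp
        also have "\<dots> = (\<Sum>i\<in>?V. s - 1)"
          unfolding sum.distrib[symmetric] by (rule sum.cong) (use \<open>s \<ge> 2\<close> in \<open>auto simp: \<tau>_def\<close>)
        finally have "(\<Sum>i\<in>?V. N i mod s) + 1 = d * (s - 1)" using * by simp
        moreover have "s * hi N + (\<Sum>l\<in>?V. N l mod s) \<le> s * M"
          using D[of N] N split[of N] by simp
        moreover have "s * M = s * hi N + s" using N
            by (metis (mono_tags, lifting) mem_Collect_eq distrib_left mult.right_neutral)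
        ultimately show False using \<open>d * (s - 1) > s + 1\<close> by linarith
      qed
      moreover have "\<forall>l\<in>?V. (\<forall>i\<in>?V. \<tau> l i = \<tau> l0 i) \<longrightarrow> l = l0"
        using l0 \<open>s \<ge> 2\<close> by (auto simp: \<tau>_def split: if_splits)
      ultimately show ?thesis using l0 unfolding A_def ex_def by fastforce
    qed
    ultimately show ?thesis by (simp add: c_def)
  qed
  have top_0: "(\<Sum>N\<in>?top. e N * up U N) = 0" for U
  proof -
    (* Euler's formula for a single monomial *)
    have "(\<Sum>l\<in>?V. U l * ((\<Prod>i\<in>?V - {l}. U i ^ (N i div s)) * (of_nat (N l div s)
        * U l ^ (N l div s - 1))))
        = of_nat (hi N) * up U N" for N
    proof -
      have "U l * ((\<Prod>i\<in>?V - {l}. U i ^ (N i div s)) * (of_nat (N l div s) * U l ^ (N l div s - 1)))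
          = of_nat (N l div s) * up U N" if "l \<in> ?V" for l
      proof -
        have "up U N = U l ^ (N l div s) * (\<Prod>i\<in>?V - {l}. U i ^ (N i div s))"
          unfolding up_def by (rule prod.remove) (use that in auto)
        then show ?thesis by (cases "N l div s") (simp_all add: mult_ac)
      qed
      then show ?thesis unfolding hi_def of_nat_sum sum_distrib_right by (rule sum.cong[OF refl])
    qed
    note euler = this
    have "0 = (\<Sum>l\<in>?V. U l * Dl l U)" by (simp add: partial_0)
    also have "\<dots> = (\<Sum>N\<in>?top. e N * (\<Sum>l\<in>?V. U l * ((\<Prod>i\<in>?V - {l}. U i ^ (N i div s)) *
          (of_nat (N l div s) * U l ^ (N l div s - 1)))))"
      unfolding Dl_def sum_distrib_left by (subst sum.swap) (intro sum.cong refl, simp add: mult_ac)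
    also have "\<dots> = of_nat M * (\<Sum>N\<in>?top. e N * up U N)"
      unfolding euler sum_distrib_left by (intro sum.cong refl) (simp add: mult_ac)
    finally show ?thesis using \<open>M > 0\<close> by simp
  qed
  have z_0: "(\<Sum>N\<in>\<N>. e N * lo z N * up U N) = 0"
    if "\<And>l. l \<in> ?V \<Longrightarrow> z l \<in> grid_nodes s" for z U
    using key[where z = z and U = "\<lambda>l. U l - grid_shift d s z l", OF that] by (simp add: top_0)
  let ?A = "{N\<in>\<N>. \<forall>l\<in>?V. N l div s = N0 l div s}"
  show ?thesis
  proof (rule poly_ident_inj[where V = ?V and A = ?A and S = "\<lambda>_. grid_nodes s"
        and e = "\<lambda>N l. N l mod s" and c = e and ?m0.0 = N0])
    show "(\<Sum>N\<in>?A. e N * (\<Prod>v\<in>?V. z v ^ (N v mod s))) = 0"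
      if z: "\<And>v. v \<in> ?V \<Longrightarrow> z v \<in> grid_nodes s" for z
    proof -
      have "(\<Sum>N\<in>?A. e N * lo z N) = 0"
        by (rule poly_ident[where S = "\<lambda>_. UNIV" and e = "\<lambda>N l. N l div s"])
           (use z_0[OF z] \<open>finite \<N>\<close> in \<open>auto simp: up_def infinite_UNIV_char_0\<close>)
      then show ?thesis by (simp add: lo_def)
    qed
    show "N = N'" if "N \<in> ?A" "N' \<in> ?A" "\<And>v. v \<in> ?V \<Longrightarrow> N v mod s = N' v mod s" for N N'
    proof (rule PiE_ext)
      show "N \<in> ?V \<rightarrow>\<^sub>E UNIV" "N' \<in> ?V \<rightarrow>\<^sub>E UNIV"
        using that \<open>\<N> \<subseteq> ?V \<rightarrow>\<^sub>E UNIV\<close> by auto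
      show "N l = N' l" if "l \<in> ?V" for l
        using \<open>N \<in> ?A\<close> \<open>N' \<in> ?A\<close> \<open>\<And>v. v \<in> ?V \<Longrightarrow> N v mod s = N' v mod s\<close>[OF that] that
        by (metis (mono_tags, lifting) div_mult_mod_eq mem_Collect_eq)
    qed
    show "infinite (grid_nodes s :: 'k set) \<or> N v mod s < card (grid_nodes s :: 'k set)" for N v
      unfolding finS using \<open>s \<ge> 2\<close> by simp
    show "finite ?A" using \<open>finite \<N>\<close> by simp
    show "N0 \<in> ?A" using \<open>N0 \<in> \<N>\<close> by simp
  qed simp
qed

definition node_poly :: "nat \<Rightarrow> 'k::field_char_0 poly" where
  "node_poly s = (\<Prod>c\<in>grid_nodes s. [:- c, 1:])"

text \<open>The monic basis \<open>x ^ \<rho> * g(x) ^ \<gamma>\<close>, \<open>N = s * \<gamma> + \<rho>\<close>, controls the degree \<open>N\<close> and at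
the same time the order \<open>\<gamma>\<close> to which all nodes are zeros.\<close>

definition newton_basis :: "nat \<Rightarrow> nat \<Rightarrow> 'k::field_char_0 poly" where
  "newton_basis s N = monom 1 (N mod s) * node_poly s ^ (N div s)"

lemma lead_coeff_node_poly: "lead_coeff (node_poly s :: 'k::field_char_0 poly) = 1"
  by (simp add: node_poly_def lead_coeff_prod)

lemma degree_node_poly: "degree (node_poly s :: 'k::field_char_0 poly) = s"
  by (simp add: node_poly_def degree_prod_eq_sum_degree card_grid_nodes)

lemma degree_newton_basis: "degree (newton_basis s N :: 'k::field_char_0 poly) = N"
proof -
  have "node_poly s \<noteq> (0 :: 'k poly)"
    using lead_coeff_node_poly[of s] by (metis leading_coeff_0_iff zero_neq_one)
  then show ?thesis
    by (simp add: newton_basis_def degree_mult_eq monom_eq_0_iff degree_monom_eq degree_power_eq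
        degree_node_poly)
qed

lemma lead_coeff_newton_basis: "lead_coeff (newton_basis s N :: 'k::field_char_0 poly) = 1"
  unfolding newton_basis_def lead_coeff_mult lead_coeff_power lead_coeff_node_poly
  by (simp add: degree_monom_eq)

lemma pcompose_power: "pcompose (p ^ n) q = pcompose p q ^ n"
  for p q :: "'a::comm_ring_1 poly"
  by (induction n) (simp_all add: pcompose_1 pcompose_mult)

lemma newton_expansion:
  fixes p :: "'k::field_char_0 poly"
  assumes "degree p \<le> n"
  shows "\<exists>q. p = (\<Sum>N\<le>n. smult (q N) (newton_basis s N))"
  using assms
proof (induction n arbitrary: p)
  case 0
  then obtain c where "p = [:c:]" using degree_eq_zeroE by auto
  moreover have "newton_basis s 0 = (1 :: 'k poly)" by (simp add: newton_basis_def)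
  ultimately show ?case by (intro exI[of _ "\<lambda>_. c"]) simp
next
  case (Suc n)
  let ?c = "coeff p (Suc n)"
  let ?p = "p - smult ?c (newton_basis s (Suc n))"
  have "degree ?p \<le> n"
  proof (rule degree_le, intro allI impI)
    fix i assume "i > n"
    show "coeff ?p i = 0"
    proof (cases "i = Suc n")
      case True
      then show ?thesis
        by (simp add: lead_coeff_newton_basis[of s "Suc n", unfolded degree_newton_basis])
    next
      case False
      then have "i > Suc n" using \<open>i > n\<close> by simp
      then show ?thesis
        using Suc.prems by (simp add: coeff_eq_0 degree_newton_basis)
    qed
  qed
  from Suc.IH[OF this] obtain q where q: "?p = (\<Sum>N\<le>n. smult (q N) (newton_basis s N))" by blast
  have "p = (\<Sum>N\<le>Suc n. smult ((q(Suc n := ?c)) N) (newton_basis s N))"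
    using q by (simp add: algebra_simps)
  then show ?case by blast
qed

lemma newton_coeffs:
  obtains q :: "nat \<Rightarrow> nat \<Rightarrow> 'k::field_char_0"
  where "\<And>n N. N > n \<Longrightarrow> q n N = 0"
    and "\<And>n D (y :: 'k poly). n \<le> D \<Longrightarrow> y ^ n = (\<Sum>N\<le>D. [:q n N:] * pcompose (newton_basis s N) y)"
proof -
  have "\<forall>n::nat. \<exists>q. monom (1::'k) n = (\<Sum>N\<le>n. smult (q N) (newton_basis s N))"
    using newton_expansion[OF degree_monom_le] by blast
  then obtain q0 where q0: "\<And>n::nat. monom (1::'k) n = (\<Sum>N\<le>n. smult (q0 n N) (newton_basis s N))"
    by metis
  define q where "q n N = (if N \<le> n then q0 n N else 0)" for n N
  show ?thesis
  proof (rule that[of q])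
    show "q n N = 0" if "N > n" for n N using that by (simp add: q_def)
    fix n D :: nat and y :: "'k poly" assume "n \<le> D"
    have "monom (1::'k) n = (\<Sum>N\<le>D. smult (q n N) (newton_basis s N))"
      unfolding q0 by (rule sum.mono_neutral_cong_left) (use \<open>n \<le> D\<close> in \<open>auto simp: q_def\<close>)
    then have "pcompose (monom 1 n) y = (\<Sum>N\<le>D. [:q n N:] * pcompose (newton_basis s N) y)"
      by (simp add: pcompose_sum pcompose_smult)
    moreover have "pcompose (monom 1 n) y = y ^ n"
      by (simp add: monom_altdef pcompose_power pcompose_pCons)
    ultimately show "y ^ n = (\<Sum>N\<le>D. [:q n N:] * pcompose (newton_basis s N) y)" by simp
  qed
qed

definition node_deriv :: "nat \<Rightarrow> 'k::field_char_0 \<Rightarrow> 'k" where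
  "node_deriv s x = (\<Prod>c\<in>grid_nodes s - {x}. x - c)"

lemma node_deriv_nonzero: "node_deriv s x \<noteq> 0"
  by (auto simp: node_deriv_def finite_grid_nodes)

text \<open>At distance \<open>t * w\<close> from a node \<open>x\<close> the node polynomial is \<open>t * w\<close> times a factor
with constant term \<open>g'(x)\<close>; this gives the coefficient of \<open>t ^ \<gamma>\<close> in every basis element, whose
lower coefficients vanish.\<close>

lemma newton_basis_near_node:
  fixes x :: "'k::field_char_0"
  assumes "x \<in> grid_nodes s"
  obtains r where "pcompose (newton_basis s N) [:x, w:] = monom 1 (N div s) * r"
    and "coeff r 0 = x ^ (N mod s) * (node_deriv s x * w) ^ (N div s)"
proof
  define r0 where "r0 = (\<Prod>c\<in>grid_nodes s - {x}. [:x - c, w:])"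
  define r where "r = smult (w ^ (N div s)) ([:x, w:] ^ (N mod s) * r0 ^ (N div s))"
  have "pcompose (node_poly s) [:x, w:] = (\<Prod>c\<in>grid_nodes s. [:x - c, w:])"
    by (simp add: node_poly_def pcompose_prod pcompose_pCons)
  also have "\<dots> = [:0, w:] * r0"
    unfolding r0_def by (subst prod.remove[OF finite_grid_nodes assms]) simp
  finally have "pcompose (newton_basis s N) [:x, w:]
      = [:x, w:] ^ (N mod s) * ([:0, w:] ^ (N div s) * r0 ^ (N div s))"
    unfolding newton_basis_def pcompose_mult pcompose_power
    by (simp only: power_mult_distrib) (simp add: monom_altdef pcompose_power pcompose_pCons)
  moreover have "[:0, w:] ^ k = smult (w ^ k) (monom 1 k)" for k
    by (induction k) (auto simp: monom_Suc mult.commute)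
  ultimately show "pcompose (newton_basis s N) [:x, w:] = monom 1 (N div s) * r"
    by (simp add: r_def mult_ac)
  have "coeff (p ^ k) 0 = coeff p 0 ^ k" for p :: "'k poly" and k
    by (simp add: poly_0_coeff_0[symmetric])
  moreover have "coeff r0 0 = node_deriv s x"
    by (simp add: r0_def node_deriv_def poly_0_coeff_0[symmetric] poly_prod)
  ultimately show "coeff r 0 = x ^ (N mod s) * (node_deriv s x * w) ^ (N div s)"
    by (simp add: r_def coeff_mult_0 power_mult_distrib mult_ac)
qed

lemma coeff_prod_linear_powers:
  fixes u a :: "'i \<Rightarrow> 'k::field"
  assumes "finite V"
  shows "degree (\<Prod>l\<in>V. [:a l, u l:] ^ g l) \<le> sum g V"
    and "coeff (\<Prod>l\<in>V. [:a l, u l:] ^ g l) (sum g V) = (\<Prod>l\<in>V. u l ^ g l)"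
proof -
  have aux: "coeff (p * q) (m + n) = coeff p m * coeff q n"
    if "degree p \<le> m" "degree q \<le> n" for p q :: "'k poly" and m n
  proof -
    have "(\<Sum>i\<le>m + n. coeff p i * coeff q (m + n - i)) = (\<Sum>i\<in>{m}. coeff p i * coeff q (m + n - i))"
    proof (rule sum.mono_neutral_right)
      show "\<forall>i\<in>{..m + n} - {m}. coeff p i * coeff q (m + n - i) = 0"
      proof
        fix i assume "i \<in> {..m + n} - {m}"
        then have "i > degree p \<or> m + n - i > degree q" using that by auto
        then show "coeff p i * coeff q (m + n - i) = 0" by (auto simp: coeff_eq_0)
      qed
    qed auto
    then show ?thesis by (simp add: coeff_mult)
  qed
  have lin: "degree ([:a, u:] ^ k) \<le> k \<and> coeff ([:a, u:] ^ k) k = u ^ k" for a u :: 'k and k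
  proof (induction k)
    case (Suc k)
    have d1: "degree [:a, u:] \<le> 1" by simp
    show ?case
      using aux[OF d1, of "[:a, u:] ^ k" k] Suc degree_mult_le[of "[:a, u:]" "[:a, u:] ^ k"] d1
      by simp
  qed simp
  have "degree (\<Prod>l\<in>V. [:a l, u l:] ^ g l) \<le> sum g V
    \<and> coeff (\<Prod>l\<in>V. [:a l, u l:] ^ g l) (sum g V) = (\<Prod>l\<in>V. u l ^ g l)"
    using assms
  proof (induction V rule: finite_induct)
    case (insert v V)
    let ?p = "[:a v, u v:] ^ g v" and ?q = "\<Prod>l\<in>V. [:a l, u l:] ^ g l"
    show ?case
      using insert aux[of ?p "g v" ?q "sum g V"] lin[of "a v" "u v" "g v"] degree_mult_le[of ?p ?q]
      by simp
  qed simp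
  then show "degree (\<Prod>l\<in>V. [:a l, u l:] ^ g l) \<le> sum g V"
    and "coeff (\<Prod>l\<in>V. [:a l, u l:] ^ g l) (sum g V) = (\<Prod>l\<in>V. u l ^ g l)"
    by blast+
qed

text \<open>The homogeneous coordinates of \<open>z + t * w(z) / g'(z)\<close>; division by the derivative of
the node polynomial makes the initial form vanish at \<open>w(z)\<close>.\<close>

definition moved_grid_point :: "nat \<Rightarrow> nat \<Rightarrow> (nat \<Rightarrow> 'k::field_char_0) \<Rightarrow> nat \<Rightarrow> 'k poly" where
  "moved_grid_point d s z l =
    (if l = 0 then 1 else [:z l, grid_shift d s z l / node_deriv s (z l):])"

text \<open>For \<open>S\<close> in two variables, evaluating the outer variable at a constant commutes with
extracting a coefficient with respect to the inner variable \<open>t\<close>.\<close>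

lemma coeff_poly_at_const:
  fixes S :: "'k::comm_ring_1 poly poly"
  shows "coeff (poly S [:x:]) k = poly (map_poly (\<lambda>c. coeff c k) S) x"
  by (induction S) (simp_all add: map_poly_pCons)

text \<open>For a fixed total degree the exponent of the variable with index 0 is determined by
the others, so setting that variable to 1 identifies no two monomials.\<close>

lemma homog_dehomogenize_zero:
  fixes F :: "(nat, 'r::idom) mpoly"
  assumes F: "F \<in> homog {0..d} D" and inf: "infinite (UNIV :: 'r set)"
    and zero: "\<And>y. y 0 = 1 \<Longrightarrow> peval id y F = 0"
  shows "F = 0"
proof (rule ccontr)
  assume "F \<noteq> 0"
  then obtain b0 where b0: "b0 \<in> keys F" by (metis keys_eq_empty ex_in_conv)
  have ksub: "keys b \<subseteq> {0..d}" "mdeg b = D" if "b \<in> keys F" for b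
    using F that by (auto simp: homog_def mpoly_ring_def)
  have dec: "{0..d} = insert 0 {1..d}" by auto
  have "lookup F b0 = 0"
  proof (rule poly_ident_inj[where V = "{1..d}" and A = "keys F" and S = "\<lambda>_. UNIV"
        and e = lookup and c = "lookup F" and ?m0.0 = b0])
    fix x :: "nat \<Rightarrow> 'r"
    have "peval id (x(0 := 1)) F
        = (\<Sum>b\<in>keys F. lookup F b * (\<Prod>v\<in>{1..d}. x v ^ lookup b v))"
      unfolding peval_def
    proof (intro sum.cong refl arg_cong2[where f = "(*)"])
      fix b assume "b \<in> keys F"
      then have "meval (x(0 := 1)) b = (\<Prod>v\<in>{0..d}. (x(0 := 1)) v ^ lookup b v)"
        by (intro meval_superset) (use ksub in auto)
      also have "\<dots> = (\<Prod>v\<in>{1..d}. x v ^ lookup b v)"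
        unfolding dec by simp
      finally show "meval (x(0 := 1)) b = (\<Prod>v\<in>{1..d}. x v ^ lookup b v)" .
    qed simp
    then show "(\<Sum>b\<in>keys F. lookup F b * (\<Prod>v\<in>{1..d}. x v ^ lookup b v)) = 0"
      using zero[of "x(0 := 1)"] by simp
  next
    fix b b' assume b: "b \<in> keys F" "b' \<in> keys F"
      and eq: "\<And>v. v \<in> {1..d} \<Longrightarrow> lookup b v = lookup b' v"
    have "mdeg m = lookup m 0 + (\<Sum>v\<in>{1..d}. lookup m v)"
      if "m \<in> keys F" for m
      using mdeg_superset[of "{0..d}" m] ksub[OF that] unfolding dec by simp
    from this[OF b(1)] this[OF b(2)] have "lookup b 0 = lookup b' 0"
      using eq ksub b by simp
    then show "b = b'"
      using ksub b eq by (intro lookup_eqI_on[of _ "{0..d}"]) (auto simp: dec)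
  qed (use b0 inf in auto)
  with b0 show False by (simp add: in_keys_iff)
qed

text \<open>The initial form with respect to \<open>t\<close> of the dehomogenized \<open>F\<close> near the grid
satisfies the hypotheses of \<open>initial_form_vanishes\<close>, although it is nonzero by its choice.\<close>

lemma no_form_at_moved_grid:
  fixes F :: "(nat, 'k::field_char_0 poly) mpoly"
  assumes F: "F \<in> homog {0..d} D"
    and D: "D \<le> s * M" and "M > 0" "s \<ge> 2" "d * (s - 1) > s + 1"
    and mult: "\<And>z Y. (\<And>l. l \<in> {1..d} \<Longrightarrow> z l \<in> grid_nodes s) \<Longrightarrow>
      monom 1 M dvd peval (\<lambda>c. [:c:]) (\<lambda>l. [:moved_grid_point d s z l, Y l:]) F"
  shows "F = 0"
proof (rule ccontr)
  assume "F \<noteq> 0"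
  let ?V = "{1..d}"
  define hi where "hi N = (\<Sum>l\<in>?V. N l div s)" for N :: "nat \<Rightarrow> nat"
  define lo where "lo z N = (\<Prod>l\<in>?V. z l ^ (N l mod s))" for z :: "nat \<Rightarrow> 'k" and N
  define up where "up U N = (\<Prod>l\<in>?V. U l ^ (N l div s))" for U :: "nat \<Rightarrow> 'k" and N
  define \<N> where "\<N> = {N \<in> ?V \<rightarrow>\<^sub>E {..D}. (\<Sum>l\<in>?V. N l) \<le> D}"
  have fin: "finite \<N>" by (simp add: \<N>_def finite_PiE)
  have ksub: "keys b \<subseteq> {0..d}" "mdeg b = D" if "b \<in> keys F" for b
    using F that by (auto simp: homog_def mpoly_ring_def)
  have dec: "{0..d} = insert 0 {1..d}" by auto
  have bD: "(\<Sum>l\<in>?V. lookup b l) \<le> D" if "b \<in> keys F" for b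
    using mdeg_superset[of "{0..d}" b] ksub[OF that] unfolding dec by simp
  obtain q :: "nat \<Rightarrow> nat \<Rightarrow> 'k" where q0: "\<And>n N. N > n \<Longrightarrow> q n N = 0"
    and q: "\<And>n D' (y :: 'k poly). n \<le> D' \<Longrightarrow> y ^ n
        = (\<Sum>N\<le>D'. [:q n N:] * pcompose (newton_basis s N) y)"
    using newton_coeffs[where s = s ] by blast
  define C where "C N = (\<Sum>b\<in>keys F. lookup F b * (\<Prod>l\<in>?V. [:q (lookup b l) (N l):]))" for N
  have expand: "peval id y F = (\<Sum>N\<in>\<N>. C N * (\<Prod>l\<in>?V. pcompose (newton_basis s (N l)) (y l)))"
    if y0: "y 0 = 1" for y :: "nat \<Rightarrow> 'k poly"
  proof -
    let ?b = "\<lambda>N. \<Prod>l\<in>?V. pcompose (newton_basis s (N l)) (y l)"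
    have "peval id y F = (\<Sum>b\<in>keys F. \<Sum>N\<in>?V \<rightarrow>\<^sub>E {..D}.
        lookup F b * (\<Prod>l\<in>?V. [:q (lookup b l) (N l):]) * ?b N)"
      unfolding peval_def
    proof (rule sum.cong[OF refl])
      fix b assume b: "b \<in> keys F"
      have le: "lookup b l \<le> D" if "l \<in> ?V" for l
        using bD[OF b] member_le_sum[of l ?V "lookup b"] that by simp
      have "meval y b = (\<Prod>l\<in>{0..d}. y l ^ lookup b l)"
        by (intro meval_superset) (use ksub b in auto)
      also have "\<dots> = (\<Prod>l\<in>?V. y l ^ lookup b l)"
        unfolding dec using y0 by simp
      also have "\<dots> = (\<Prod>l\<in>?V. \<Sum>N\<le>D. [:q (lookup b l) N:] * pcompose (newton_basis s N) (y l))"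
        by (rule prod.cong[OF refl], rule q, rule le)
      also have "\<dots> = (\<Sum>N\<in>?V \<rightarrow>\<^sub>E {..D}. \<Prod>l\<in>?V. [:q (lookup b l) (N l):]
          * pcompose (newton_basis s (N l)) (y l))"
        by (rule prod_sum_PiE) auto
      finally show "id (lookup F b) * meval y b = (\<Sum>N\<in>?V \<rightarrow>\<^sub>E {..D}.
        lookup F b * (\<Prod>l\<in>?V. [:q (lookup b l) (N l):]) * ?b N)"
        by (simp only: prod.distrib sum_distrib_left mult.assoc id_apply)
    qed
    also have "\<dots> = (\<Sum>N\<in>?V \<rightarrow>\<^sub>E {..D}. C N * ?b N)"
      by (subst sum.swap) (simp only: C_def sum_distrib_right)
    also have "\<dots> = (\<Sum>N\<in>\<N>. C N * ?b N)"
    proof (rule sum.mono_neutral_right)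
      show "\<forall>N\<in>(?V \<rightarrow>\<^sub>E {..D}) - \<N>. C N * ?b N = 0"
      proof
        fix N assume "N \<in> (?V \<rightarrow>\<^sub>E {..D}) - \<N>"
        then have N: "(\<Sum>l\<in>?V. N l) > D" by (auto simp: \<N>_def)
        have "(\<Prod>l\<in>?V. [:q (lookup b l) (N l):]) = 0" if "b \<in> keys F" for b
        proof -
          have "\<not> (\<forall>l\<in>?V. N l \<le> lookup b l)"
          proof
            assume "\<forall>l\<in>?V. N l \<le> lookup b l"
            then have "(\<Sum>l\<in>?V. N l) \<le> (\<Sum>l\<in>?V. lookup b l)" by (intro sum_mono) blast
            then show False using N bD[OF that] by linarith
          qed
          then obtain l where "l \<in> ?V" "q (lookup b l) (N l) = 0"
            using q0 by (meson not_le)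
          then show ?thesis by (intro prod_zero) auto
        qed
        then have "C N = 0" unfolding C_def by (intro sum.neutral ballI) simp
        then show "C N * ?b N = 0" by simp
      qed
    qed (auto simp: \<N>_def finite_PiE)
    finally show ?thesis .
  qed
  have "\<exists>k. \<exists>N\<in>\<N>. \<exists>i. coeff (C N) i \<noteq> 0 \<and> k = i + hi N"
  proof (rule ccontr)
    assume "\<not> ?thesis"
    then have "C N = 0" if "N \<in> \<N>" for N using that by (auto simp: poly_eq_iff)
    then have "peval id y F = 0" if "y 0 = 1" for y using expand[of y, OF that] by simp
    moreover have "infinite (UNIV :: 'k poly set)"
    proof
      assume "finite (UNIV :: 'k poly set)"
      then have "finite (range (\<lambda>c::'k. [:c:]))" by (rule finite_subset[rotated]) simp
      then show False using finite_imageD[of "\<lambda>c::'k. [:c:]" UNIV] infinite_UNIV_char_0[where 'a =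
          'k]
        by (auto simp: inj_on_def)
    qed
    ultimately have "F = 0" by (intro homog_dehomogenize_zero[OF F]) auto
    with \<open>F \<noteq> 0\<close> show False ..
  qed
  note ex = this
  (* k is the order in t of the initial form: C N contributes its own order, and
     its basis element vanishes at least to order hi N along the grid. *)
  define k where "k = (LEAST k. \<exists>N\<in>\<N>. \<exists>i. coeff (C N) i \<noteq> 0 \<and> k = i + hi N)"
  obtain N0 i0 where k: "N0 \<in> \<N>" "coeff (C N0) i0 \<noteq> 0" "k = i0 + hi N0"
    using LeastI_ex[OF ex] unfolding k_def[symmetric] by blast
  have least: "k \<le> i + hi N" if "N \<in> \<N>" "coeff (C N) i \<noteq> 0" for N i
    unfolding k_def by (rule Least_le) (use that in blast)
  define e where "e N = (if hi N \<le> k then coeff (C N) (k - hi N) else 0)" for N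
  have initial: "coeff (peval id (\<lambda>l. if l = 0 then 1 else [:z l, W l:]) F) k
      = (\<Sum>N\<in>\<N>. e N * lo z N * up (\<lambda>l. node_deriv s (z l) * W l) N)"
    if z: "\<And>l. l \<in> ?V \<Longrightarrow> z l \<in> grid_nodes s" for z W
  proof -
    have "coeff (C N * (\<Prod>l\<in>?V. pcompose (newton_basis s (N l)) [:z l, W l:])) k
        = e N * lo z N * up (\<lambda>l. node_deriv s (z l) * W l) N" if N: "N \<in> \<N>" for N
    proof -
      have "\<forall>l\<in>?V. \<exists>r. pcompose (newton_basis s (N l)) [:z l, W l:] = monom 1 (N l div s) * r
          \<and> coeff r 0 = z l ^ (N l mod s) * (node_deriv s (z l) * W l) ^ (N l div s)"
        using newton_basis_near_node[OF z] by metis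
      then obtain r where r: "\<And>l. l \<in> ?V \<Longrightarrow> pcompose (newton_basis s (N l)) [:z l, W l:]
          = monom 1 (N l div s) * r l"
        "\<And>l. l \<in> ?V \<Longrightarrow> coeff (r l) 0 = z l ^ (N l mod s) * (node_deriv s (z l) * W l) ^ (N l div s)"
        by metis
      let ?R = "\<Prod>l\<in>?V. r l"
      have mon: "(\<Prod>l\<in>?V. monom 1 (N l div s)) = monom (1::'k) (hi N)"
        unfolding hi_def by (simp add: monom_altdef power_sum)
      have R0: "coeff ?R 0 = lo z N * up (\<lambda>l. node_deriv s (z l) * W l) N"
        unfolding poly_0_coeff_0[symmetric] poly_prod
        by (simp add: poly_0_coeff_0 r(2) lo_def up_def prod.distrib)
      have "C N * (\<Prod>l\<in>?V. pcompose (newton_basis s (N l)) [:z l, W l:])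
          = monom 1 (hi N) * (C N * ?R)"
      proof -
        have "(\<Prod>l\<in>?V. pcompose (newton_basis s (N l)) [:z l, W l:]) = monom 1 (hi N) * ?R"
          unfolding mon[symmetric] prod.distrib[symmetric] by (rule prod.cong[OF refl], rule r(1))
        then show ?thesis by (simp only: mult.left_commute)
      qed
      moreover have "coeff (monom 1 (hi N) * (C N * ?R)) k = e N * coeff ?R 0"
      proof (cases "hi N \<le> k")
        case True
        have "coeff (C N * ?R) (k - hi N) = (\<Sum>i\<in>{k - hi N}. coeff (C N) i
            * coeff ?R (k - hi N - i))"
          unfolding coeff_mult
        proof (rule sum.mono_neutral_right)
          show "\<forall>i\<in>{..k - hi N} - {k - hi N}. coeff (C N) i * coeff ?R (k - hi N - i) = 0"
          proof
            fix i assume "i \<in> {..k - hi N} - {k - hi N}"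
            then have "\<not> k \<le> i + hi N" by auto
            then have "coeff (C N) i = 0" using least[OF N] by blast
            then show "coeff (C N) i * coeff ?R (k - hi N - i) = 0" by simp
          qed
        qed auto
        then show ?thesis using True by (simp add: coeff_monom_mult e_def)
      next
        case False
        then show ?thesis by (simp add: coeff_monom_mult e_def)
      qed
      ultimately show ?thesis using R0 by (simp only: mult.assoc)
    qed
    moreover have "peval id (\<lambda>l. if l = 0 then 1 else [:z l, W l:]) F
      = (\<Sum>N\<in>\<N>. C N * (\<Prod>l\<in>?V. pcompose (newton_basis s (N l)) [:z l, W l:]))"
      by (subst expand) (auto intro!: sum.cong prod.cong)
    ultimately show ?thesis by (simp add: coeff_sum)
  qed
  have split: "(\<Sum>l\<in>?V. N l) = s * hi N + (\<Sum>l\<in>?V. N l mod s)" for N :: "nat \<Rightarrow> nat"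
    by (simp add: hi_def sum_distrib_left sum.distrib[symmetric])
  have ND: "(\<Sum>l\<in>?V. N l) \<le> s * M" if "N \<in> \<N>" for N
    using that D by (auto simp: \<N>_def)
  have hi_le: "hi N \<le> M" if "N \<in> \<N>" for N
  proof -
    have "s * hi N \<le> s * M" using ND[OF that] split[of N] by linarith
    then show ?thesis using \<open>s \<ge> 2\<close> by simp
  qed
  have lo_top: "lo z N = 1" if "N \<in> \<N>" "hi N = M" for z N
  proof -
    have "(\<Sum>l\<in>?V. N l mod s) = 0" using ND[OF that(1)] split[of N] that(2) by simp
    then show ?thesis by (simp add: lo_def)
  qed
  have key: "(\<Sum>N\<in>\<N>. e N * lo z N * up (\<lambda>l. grid_shift d s z l + U l) N)
        = (\<Sum>N\<in>{N\<in>\<N>. hi N = M}. e N * up U N)"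
    if z: "\<And>l. l \<in> ?V \<Longrightarrow> z l \<in> grid_nodes s" for z U
  proof -
    define v where "v l = grid_shift d s z l / node_deriv s (z l)" for l
    define X where "X l = U l / node_deriv s (z l)" for l
    (* F along the direction t * X through the moved point, with the outer
       variable as line parameter. The factor t in the direction makes the point on the line
       equal to z + t * (v + x * X). *)
    define T where "T = peval (\<lambda>c. [:c:]) (\<lambda>l. [:moved_grid_point d s z l, if l = 0 then 0 else [:0,
        X l:]:]) F"
    have "monom 1 M dvd T" unfolding T_def by (rule mult[OF z])
    then obtain S where S: "T = monom 1 M * S" by (elim dvdE)
    define S' where "S' = map_poly (\<lambda>c. coeff c k) S"
    (* L is H z along the line w(z) + x * U. It is divisible by x ^ M and has
       degree at most M, hence equals its top coefficient times x ^ M; evaluate at x = 1. *)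
    define L where "L = (\<Sum>N\<in>\<N>. smult (e N * lo z N) (\<Prod>l\<in>?V. [:grid_shift d s z l, U l:] ^
        (N l div s)))"
    have "poly L x = poly (monom 1 M * S') x" for x
    proof -
      have eqf: "(\<lambda>l. poly [:moved_grid_point d s z l, if l = 0 then 0 else [:0, X l:]:] [:x:])
          = (\<lambda>l. if l = 0 then 1 else [:z l, v l + x * X l:])"
        by (auto simp: moved_grid_point_def v_def)
      have "poly T [:x:] = peval id (\<lambda>l. if l = 0 then 1 else [:z l, v l + x * X l:]) F"
        unfolding T_def peval_hom[OF is_ring_hom_const_poly is_ring_hom_poly] eqf
            by (simp add: id_def)
      then have "coeff (poly T [:x:]) k
          = (\<Sum>N\<in>\<N>. e N * lo z N * up (\<lambda>l. node_deriv s (z l) * (v l + x * X l)) N)"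
        using initial[OF z] by simp
      also have "\<dots> = poly L x"
      proof -
        have "node_deriv s (z l) * (v l + x * X l) = grid_shift d s z l + x * U l" for l
          using node_deriv_nonzero[of s "z l"] by (simp add: v_def X_def distrib_left)
        then show ?thesis by (simp add: L_def poly_sum poly_prod up_def mult.assoc)
      qed
      finally have "coeff (poly T [:x:]) k = poly L x" .
      moreover have "coeff (poly T [:x:]) k = x ^ M * poly S' x"
        by (simp add: S poly_monom poly_const_pow S'_def coeff_poly_at_const)
      ultimately show ?thesis by (simp add: poly_monom)
    qed
    then have L: "L = monom 1 M * S'" by (simp add: poly_eq_poly_eq_iff[symmetric] fun_eq_iff)
    have degL: "degree L \<le> M"
      unfolding L_def
    proof (rule degree_sum_le[OF fin])
      fix N assume "N \<in> \<N>"
      have "degree (\<Prod>l\<in>?V. [:grid_shift d s z l, U l:] ^ (N l div s)) \<le> hi N"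
        unfolding hi_def by (rule coeff_prod_linear_powers) simp
      then show "degree (smult (e N * lo z N) (\<Prod>l\<in>?V. [:grid_shift d s z l, U l:] ^ (N l div s)))
          \<le> M"
        using hi_le[OF \<open>N \<in> \<N>\<close>] degree_smult_le le_trans by blast
    qed
    have "L = monom (coeff L M) M"
    proof (rule poly_eqI)
      fix i
      have "coeff L i = 0" if "i < M" using that by (simp add: L coeff_monom_mult)
      moreover have "coeff L i = 0" if "i > M" using that degL by (simp add: coeff_eq_0)
      ultimately show "coeff L i = coeff (monom (coeff L M) M) i"
        by (cases i M rule: linorder_cases) auto
    qed
    then have "poly L 1 = coeff L M" by (metis poly_monom power_one mult.right_neutral)
    also have "coeff L M = (\<Sum>N\<in>\<N>. if hi N = M then e N * up U N else 0)"
      unfolding L_def coeff_sum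
    proof (rule sum.cong[OF refl])
      fix N assume N: "N \<in> \<N>"
      let ?p = "\<Prod>l\<in>?V. [:grid_shift d s z l, U l:] ^ (N l div s)"
      have "degree ?p \<le> hi N" "coeff ?p (hi N) = up U N"
        unfolding hi_def up_def by (rule coeff_prod_linear_powers; simp)+
      then show "coeff (smult (e N * lo z N) ?p) M = (if hi N = M then e N * up U N else 0)"
        using hi_le[OF N] lo_top[OF N] by (auto simp: coeff_eq_0)
    qed
    also have "\<dots> = (\<Sum>N\<in>{N\<in>\<N>. hi N = M}. e N * up U N)"
      using fin by (simp add: sum.inter_filter)
    finally show ?thesis
      by (simp add: L_def poly_sum poly_prod up_def)
  qed
  have "e N0 = 0"
    by (rule initial_form_vanishes[of \<N> d s M e])
       (use fin ND assms(3-5) k(1) key in \<open>auto simp: \<N>_def hi_def lo_def up_def\<close>)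
  then show False using k by (simp add: e_def)
qed

section \<open>Forms vanishing at generic points\<close>

text \<open>Taylor coefficients, that is, partial derivatives divided by factorials. Their
coefficients are integers, so the condition on \<open>F\<close> to vanish to some order at \<open>A\<close> is a linear
system over \<open>\<int>[A]\<close>.\<close>

definition hasse_deriv ::
  "('k::comm_ring_1 \<Rightarrow> 'r::comm_ring_1) \<Rightarrow> 'v set \<Rightarrow> ('v, 'k) mpoly \<Rightarrow> ('v \<Rightarrow> nat) \<Rightarrow>
      ('v \<Rightarrow> 'r) \<Rightarrow> 'r" where
  "hasse_deriv h V F \<eta> A = (\<Sum>m\<in>keys F. h (lookup F m) *
    (\<Prod>l\<in>V. of_nat (lookup m l choose \<eta> l) * A l ^ (lookup m l - \<eta> l)))"

definition vanishes_to_order :: "'v set \<Rightarrow> nat \<Rightarrow> ('v, 'k::comm_ring_1) mpoly \<Rightarrow>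
    ('v \<Rightarrow> 'k) \<Rightarrow> bool" where
  "vanishes_to_order V M F A \<longleftrightarrow> (\<forall>\<eta>. sum \<eta> V < M \<longrightarrow> hasse_deriv id V F \<eta> A = 0)"

text \<open>Homogeneity allows the base point to be rescaled by \<open>\<kappa>\<close>; this is used for directions
that are not transverse to the base point.\<close>

lemma taylor_homog:
  fixes F :: "('v, 'k::comm_ring_1) mpoly" and h :: "'k \<Rightarrow> 'r::comm_ring_1"
  assumes F: "F \<in> homog V e" and V: "finite V"
  shows "peval h (\<lambda>l. \<kappa> * A l + \<epsilon> * Y l) F = (\<Sum>\<eta>\<in>V \<rightarrow>\<^sub>E {..e}.
    \<kappa> ^ (e - sum \<eta> V) * \<epsilon> ^ sum \<eta> V * (\<Prod>l\<in>V. Y l ^ \<eta> l) * hasse_deriv h V F \<eta> A)"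
proof -
  have "meval (\<lambda>l. \<kappa> * A l + \<epsilon> * Y l) m = (\<Sum>\<eta>\<in>V \<rightarrow>\<^sub>E {..e}.
      \<kappa> ^ (e - sum \<eta> V) * \<epsilon> ^ sum \<eta> V * (\<Prod>l\<in>V. Y l ^ \<eta> l) *
      (\<Prod>l\<in>V. of_nat (lookup m l choose \<eta> l) * A l ^ (lookup m l - \<eta> l)))"
    if m: "m \<in> keys F" for m
  proof -
    have sub: "keys m \<subseteq> V" and deg: "sum (lookup m) V = e"
      using F m mdeg_superset[OF V, of m] by (auto simp: homog_def mpoly_ring_def)
    have le: "lookup m l \<le> e" if "l \<in> V" for l
      using member_le_sum[of l V "lookup m"] that V deg by simp
    have "meval (\<lambda>l. \<kappa> * A l + \<epsilon> * Y l) m = (\<Prod>l\<in>V. (\<epsilon> * Y l + \<kappa> * A l) ^ lookup m l)"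
      by (simp add: meval_superset[OF V sub] add.commute)
    also have "\<dots> = (\<Prod>l\<in>V. \<Sum>k\<le>e. of_nat (lookup m l choose k) *
        (\<epsilon> * Y l) ^ k * (\<kappa> * A l) ^ (lookup m l - k))"
    proof (rule prod.cong[OF refl], unfold binomial_ring, rule sum.mono_neutral_left)
      fix l assume "l \<in> V"
      then show "{..lookup m l} \<subseteq> {..e}" using le by auto
    qed (auto simp: binomial_eq_0)
    also have "\<dots> = (\<Sum>\<eta>\<in>V \<rightarrow>\<^sub>E {..e}. \<Prod>l\<in>V. of_nat (lookup m l choose \<eta> l) *
        (\<epsilon> * Y l) ^ \<eta> l * (\<kappa> * A l) ^ (lookup m l - \<eta> l))"
      by (rule prod_sum_PiE) (use V in auto)
    also have "\<dots> = (\<Sum>\<eta>\<in>V \<rightarrow>\<^sub>E {..e}.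
      \<kappa> ^ (e - sum \<eta> V) * \<epsilon> ^ sum \<eta> V * (\<Prod>l\<in>V. Y l ^ \<eta> l) *
      (\<Prod>l\<in>V. of_nat (lookup m l choose \<eta> l) * A l ^ (lookup m l - \<eta> l)))"
    proof (rule sum.cong[OF refl])
      fix \<eta>
      show "(\<Prod>l\<in>V. of_nat (lookup m l choose \<eta> l) *
          (\<epsilon> * Y l) ^ \<eta> l * (\<kappa> * A l) ^ (lookup m l - \<eta> l))
        = \<kappa> ^ (e - sum \<eta> V) * \<epsilon> ^ sum \<eta> V * (\<Prod>l\<in>V. Y l ^ \<eta> l) *
          (\<Prod>l\<in>V. of_nat (lookup m l choose \<eta> l) * A l ^ (lookup m l - \<eta> l))"
      proof (cases "\<forall>l\<in>V. \<eta> l \<le> lookup m l")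
        case True
        then have "(\<Sum>l\<in>V. lookup m l - \<eta> l) = e - sum \<eta> V"
          using deg by (simp add: sum_subtractf_nat)
        then show ?thesis
          by (simp add: power_mult_distrib prod.distrib power_sum[symmetric] mult_ac)
      next
        case False
        then obtain l where l: "l \<in> V" "lookup m l choose \<eta> l = 0"
          by (meson binomial_eq_0 not_le)
        have "(\<Prod>l\<in>V. of_nat (lookup m l choose \<eta> l) * f l) = 0" for f :: "'v \<Rightarrow> 'r"
          by (rule prod_zero[OF V], rule bexI[OF _ l(1)]) (simp only: l(2) of_nat_0 mult_zero_left)
        then show ?thesis by (simp add: mult.assoc)
      qed
    qed
    finally show ?thesis .
  qed
  then have "peval h (\<lambda>l. \<kappa> * A l + \<epsilon> * Y l) F = (\<Sum>m\<in>keys F. \<Sum>\<eta>\<in>V \<rightarrow>\<^sub>E {..e}.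
      \<kappa> ^ (e - sum \<eta> V) * \<epsilon> ^ sum \<eta> V * (\<Prod>l\<in>V. Y l ^ \<eta> l) *
      (h (lookup F m) * (\<Prod>l\<in>V. of_nat (lookup m l choose \<eta> l) * A l ^ (lookup m l - \<eta> l))))"
    unfolding peval_def by (intro sum.cong refl) (simp add: sum_distrib_left mult_ac)
  also have "\<dots> = (\<Sum>\<eta>\<in>V \<rightarrow>\<^sub>E {..e}. \<kappa> ^ (e - sum \<eta> V) * \<epsilon> ^ sum \<eta> V * (\<Prod>l\<in>V. Y l ^ \<eta> l)
      * hasse_deriv h V F \<eta> A)"
    by (subst sum.swap) (simp add: hasse_deriv_def sum_distrib_left)
  finally show ?thesis .
qed

lemma hasse_deriv_hom:
  assumes "is_ring_hom f"
  shows "f (hasse_deriv id V F \<eta> A) = hasse_deriv f V F \<eta> (\<lambda>l. f (A l))"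
proof -
  have "f (x * y) = f x * f y" for x y using assms by (simp add: is_ring_hom_def)
  then show ?thesis
    using assms by (simp add: hasse_deriv_def is_ring_hom_sum is_ring_hom_prod is_ring_hom_power
        is_ring_hom_of_nat)
qed

lemma taylor_line:
  fixes F :: "('v, 'k::comm_ring_1) mpoly"
  assumes "F \<in> homog V e" "finite V"
  shows "peval (\<lambda>c. [:c:]) (\<lambda>l. [:A l, Y l:]) F = (\<Sum>\<eta>\<in>V \<rightarrow>\<^sub>E {..e}.
    monom ((\<Prod>l\<in>V. Y l ^ \<eta> l) * hasse_deriv id V F \<eta> A) (sum \<eta> V))"
proof -
  have "peval (\<lambda>c. [:c:]) (\<lambda>l. [:A l, Y l:]) F
      = peval (\<lambda>c. [:c:]) (\<lambda>l. 1 * [:A l:] + [:0, 1:] * [:Y l:]) F"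
    by simp
  also have "\<dots> = (\<Sum>\<eta>\<in>V \<rightarrow>\<^sub>E {..e}.
    monom ((\<Prod>l\<in>V. Y l ^ \<eta> l) * hasse_deriv id V F \<eta> A) (sum \<eta> V))"
    unfolding taylor_homog[OF assms] hasse_deriv_hom[OF is_ring_hom_const_poly, symmetric]
  proof (rule sum.cong[OF refl])
    fix \<eta>
    have "(\<Prod>l\<in>V. [:Y l:] ^ \<eta> l) = [:\<Prod>l\<in>V. Y l ^ \<eta> l:]"
      by (simp add: is_ring_hom_prod[OF is_ring_hom_const_poly] is_ring_hom_power[OF
          is_ring_hom_const_poly])
    then show "1 ^ (e - sum \<eta> V) * [:0, 1:] ^ sum \<eta> V * (\<Prod>l\<in>V. [:Y l:] ^ \<eta> l)
        * [:hasse_deriv id V F \<eta> A:]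
      = monom ((\<Prod>l\<in>V. Y l ^ \<eta> l) * hasse_deriv id V F \<eta> A) (sum \<eta> V)"
      by (simp add: monom_altdef mult_ac)
  qed
  finally show ?thesis .
qed

lemma vanishes_to_order_imp_dvd_line:
  fixes F :: "('v, 'k::comm_ring_1) mpoly"
  assumes "F \<in> homog V e" "finite V" and "vanishes_to_order V M F A"
  shows "monom 1 M dvd peval (\<lambda>c. [:c:]) (\<lambda>l. [:A l, Y l:]) F"
  unfolding monom_1_dvd_iff'
proof (intro allI impI)
  fix k assume "k < M"
  then show "coeff (peval (\<lambda>c. [:c:]) (\<lambda>l. [:A l, Y l:]) F) k = 0"
    unfolding taylor_line[OF assms(1,2)] coeff_sum coeff_monom
    by (intro sum.neutral) (use assms(3) in \<open>auto simp: vanishes_to_order_def\<close>)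
qed

lemma vanishes_to_order_if_dvd_lines:
  fixes F :: "('v, 'k::field_char_0) mpoly"
  assumes F: "F \<in> homog V e" and V: "finite V"
    and line: "\<And>Y. monom 1 M dvd peval (\<lambda>c. [:c:]) (\<lambda>l. [:A l, Y l:]) F"
  shows "vanishes_to_order V M F A"
  unfolding vanishes_to_order_def
proof (intro allI impI)
  fix \<zeta> :: "'v \<Rightarrow> nat" assume \<zeta>: "sum \<zeta> V < M"
  define \<eta> where "\<eta> = restrict \<zeta> V"
  have "hasse_deriv id V F \<zeta> A = hasse_deriv id V F \<eta> A"
    unfolding hasse_deriv_def
    by (intro sum.cong refl arg_cong2[where f = "(*)"] prod.cong) (simp_all add: \<eta>_def)
  moreover have "hasse_deriv id V F \<eta> A = 0"
  proof (cases "\<forall>l\<in>V. \<zeta> l \<le> e")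
    case False
    then obtain l where l: "l \<in> V" "e < \<eta> l" by (auto simp: \<eta>_def not_le)
    have "(\<Prod>l\<in>V. of_nat (lookup m l choose \<eta> l) * A l ^ (lookup m l - \<eta> l)) = 0"
      if m: "m \<in> keys F" for m
    proof (rule prod_zero[OF V], rule bexI[OF _ l(1)])
      have "sum (lookup m) V = e"
        using F m mdeg_superset[OF V, of m] by (auto simp: homog_def mpoly_ring_def)
      then have "lookup m l < \<eta> l"
        using member_le_sum[of l V "lookup m"] V l by simp
      then show "of_nat (lookup m l choose \<eta> l) * A l ^ (lookup m l - \<eta> l) = 0"
        by (simp add: binomial_eq_0)
    qed
    then show ?thesis unfolding hasse_deriv_def by (intro sum.neutral) simp
  next
    case True
    then have \<eta>: "\<eta> \<in> V \<rightarrow>\<^sub>E {..e}" "sum \<eta> V < M" using \<zeta> by (auto simp: \<eta>_def)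
    let ?A = "{\<eta>' \<in> V \<rightarrow>\<^sub>E {..e}. sum \<eta>' V = sum \<eta> V}"
    show ?thesis
    proof (rule poly_ident_inj[where V = V and A = ?A and S = "\<lambda>_. UNIV"
          and e = "\<lambda>\<eta>. \<eta>" and c = "\<lambda>\<eta>. hasse_deriv id V F \<eta> A" and ?m0.0 = \<eta>])
      fix Y :: "'v \<Rightarrow> 'k"
      have "0 = coeff (peval (\<lambda>c. [:c:]) (\<lambda>l. [:A l, Y l:]) F) (sum \<eta> V)"
        using line[of Y] \<eta>(2) by (simp add: monom_1_dvd_iff')
      also have "\<dots> = (\<Sum>\<eta>'\<in>V \<rightarrow>\<^sub>E {..e}.
          if sum \<eta>' V = sum \<eta> V then hasse_deriv id V F \<eta>' A * (\<Prod>l\<in>V. Y l ^ \<eta>' l) else 0)"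
        unfolding taylor_line[OF F V] coeff_sum coeff_monom
            by (intro sum.cong) (auto simp: mult.commute)
      also have "\<dots> = (\<Sum>\<eta>'\<in>?A. hasse_deriv id V F \<eta>' A * (\<Prod>l\<in>V. Y l ^ \<eta>' l))"
        by (rule sum.inter_filter[symmetric]) (simp add: V finite_PiE)
      finally show "\<dots> = 0" by simp
    next
      show "\<eta>1 = \<eta>2" if "\<eta>1 \<in> ?A" "\<eta>2 \<in> ?A" "\<And>v. v \<in> V \<Longrightarrow> \<eta>1 v = \<eta>2 v" for \<eta>1 \<eta>2
        using that by (intro PiE_ext[of _ V "\<lambda>_. {..e}"]) auto
    qed (use V \<eta> in \<open>auto simp: finite_PiE infinite_UNIV_char_0\<close>)
  qed
  ultimately show "hasse_deriv id V F \<zeta> A = 0" by simp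
qed

lemma lookup_sum_single:
  "finite J \<Longrightarrow> lookup (\<Sum>b\<in>J. single b (y b)) b0 = (if b0 \<in> J then y b0 else 0)"
  by (simp add: lookup_sum lookup_single when_def)

text \<open>The vanishing conditions at points with coordinates \<open>a\<close> are a linear system for the
coefficients of the form, and the entries of its matrix are polynomials in \<open>a\<close> with rational
coefficients. The monomials that occur in \<open>F\<close> serve as unknowns.\<close>

lemma generic_form_specializes:
  fixes a :: "nat \<Rightarrow> nat \<Rightarrow> 'k::field_char_0" and B :: "nat \<Rightarrow> nat \<Rightarrow> 'b::idom"
  assumes gen: "alg_independent_rat ({0..d} \<times> {1..n}) (\<lambda>(i, j). a i j)"
      and h: "is_ring_hom (h :: rat \<Rightarrow> 'b)"
    and F: "F \<in> homog {0..d} e" "F \<noteq> 0"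
    and van: "\<And>j. j \<in> {1..n} \<Longrightarrow> vanishes_to_order {0..d} (m j) F (\<lambda>i. a i j)"
  shows "\<exists>G. G \<in> homog {0..d} e \<and> G \<noteq> 0 \<and>
    (\<forall>j\<in>{1..n}. vanishes_to_order {0..d} (m j) G (\<lambda>i. B i j))"
proof -
  let ?V = "{0..d}" and ?J = "keys F"
  define I where "I = {(j, \<eta>). j \<in> {1..n} \<and> sum \<eta> ?V < m j}"
  define M :: "nat \<times> (nat \<Rightarrow> nat) \<Rightarrow> (nat \<Rightarrow>\<^sub>0 nat) \<Rightarrow> (nat \<times> nat, rat) mpoly"
    where "M r b = (case r of (j, \<eta>) \<Rightarrow> \<Prod>l\<in>?V. mconst (of_nat (lookup b l choose \<eta> l)) *
      mvar (l, j) ^ (lookup b l - \<eta> l))"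
    for r :: "nat \<times> (nat \<Rightarrow> nat)" and b :: "nat \<Rightarrow>\<^sub>0 nat"
  have M: "peval g x (M (j, \<eta>) b) = (\<Prod>l\<in>?V. of_nat (lookup b l choose \<eta> l) *
      x (l, j) ^ (lookup b l - \<eta> l))"
    if g: "is_ring_hom g" for g :: "rat \<Rightarrow> 'z::comm_ring_1" and x j \<eta> b
    using is_ring_hom_peval[OF g, of x] g
    by (simp add: M_def is_ring_hom_prod is_ring_hom_power peval_mult peval_mconst peval_mvar
        is_ring_hom_of_nat)
  have "\<exists>y. (\<exists>b\<in>?J. y b \<noteq> 0) \<and> (\<forall>r\<in>I. (\<Sum>b\<in>?J. peval h (\<lambda>(i, j). B i j) (M r b) * y b) = 0)"
  proof (rule generic_kernel_specializes[OF gen h])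
    show "M r b \<in> mpoly_ring (?V \<times> {1..n})" if "r \<in> I" for r b
      using that by (auto simp: M_def I_def intro!: mpoly_ring_prod mpoly_ring_mult
          mpoly_ring_mconst mpoly_ring_power mpoly_ring_mvar)
    show "\<exists>b\<in>?J. lookup F b \<noteq> 0"
      using F(2) by (metis keys_eq_empty ex_in_conv in_keys_iff)
    show "(\<Sum>b\<in>?J. peval of_rat (\<lambda>(i, j). a i j) (M r b) * lookup F b) = 0" if "r \<in> I" for r
      using that van by (auto simp: I_def M[OF is_ring_hom_of_rat] vanishes_to_order_def
          hasse_deriv_def mult.commute)
  qed simp
  then obtain y where y: "\<exists>b\<in>?J. y b \<noteq> 0" "\<And>r. r \<in> I \<Longrightarrow>
      (\<Sum>b\<in>?J. peval h (\<lambda>(i, j). B i j) (M r b) * y b) = 0"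
    by blast
  define G where "G = (\<Sum>b\<in>?J. single b (y b))"
  have lookG: "lookup G b = (if b \<in> ?J then y b else 0)" for b
    by (simp add: G_def lookup_sum_single)
  have keysG: "keys G \<subseteq> ?J"
    by (auto simp: in_keys_iff lookG split: if_splits)
  show ?thesis
    unfolding vanishes_to_order_def
  proof (intro exI[of _ G] conjI ballI allI impI)
    show "G \<in> homog ?V e" using F(1) keysG by (auto simp: homog_def mpoly_ring_def)
    show "G \<noteq> 0" using y(1) lookG by (metis lookup_zero)
    fix j \<eta> assume *: "j \<in> {1..n}" "sum \<eta> ?V < m j"
    have "hasse_deriv id ?V G \<eta> (\<lambda>i. B i j) = (\<Sum>b\<in>?J. lookup G b *
      (\<Prod>l\<in>?V. of_nat (lookup b l choose \<eta> l) * B l j ^ (lookup b l - \<eta> l)))"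
      unfolding hasse_deriv_def id_apply
      by (rule sum.mono_neutral_left) (use keysG in \<open>auto simp: in_keys_iff\<close>)
    also have "\<dots> = (\<Sum>b\<in>?J. peval h (\<lambda>(i, j). B i j) (M (j, \<eta>) b) * y b)"
      by (rule sum.cong) (auto simp: M[OF h] lookG mult.commute)
    also have "\<dots> = 0" by (rule y(2)) (use * in \<open>auto simp: I_def\<close>)
    finally show "hasse_deriv id ?V G \<eta> (\<lambda>i. B i j) = 0" .
  qed
qed

lemma inj_on_cyclic_shift:
  "inj_on (\<lambda>j. (i + n - j) mod n) {1..n}" if "i < n" for i n :: nat
proof (rule inj_onI)
  fix x y assume x: "x \<in> {1..n}" and y: "y \<in> {1..n}" and eq: "(i + n - x) mod n = (i + n - y) mod n"
  have "int (i + n - x) mod int n = int (i + n - y) mod int n"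
    using eq by (metis of_nat_mod)
  then have "int n dvd int (i + n - x) - int (i + n - y)"
    by (simp add: mod_eq_dvd_iff)
  then have "int n dvd int y - int x"
    using x y by (simp add: of_nat_diff algebra_simps)
  then show "x = y"
    using x y zdvd_not_zless[of "int y - int x" "int n"] zdvd_not_zless[of "int x - int y" "int n"]
    by (cases x y rule: linorder_cases) (auto simp: dvd_diff_commute)
qed

text \<open>The points are specialized to the moving grid in \<open>n\<close> cyclically shifted orders. In
the product of the resulting \<open>n\<close> forms each grid point collects every \<open>m j\<close> once, so that the
product vanishes to the same order \<open>\<Sum>j. m j\<close> at all of them and its degree is \<open>n * e\<close>.\<close>

lemma no_form_at_generic_points:
  fixes a :: "nat \<Rightarrow> nat \<Rightarrow> 'k::field_char_0"
  assumes gen: "alg_independent_rat ({0..d} \<times> {1..n}) (\<lambda>(i, j). a i j)"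
    and n: "n = s ^ d" and s: "s \<ge> 2" "d * (s - 1) > s + 1"
    and F: "F \<in> homog {0..d} e" "F \<noteq> 0"
    and van: "\<And>j. j \<in> {1..n} \<Longrightarrow> vanishes_to_order {0..d} (m j) F (\<lambda>i. a i j)"
    and "e > 0"
  shows "s * (\<Sum>j\<in>{1..n}. m j) < n * e"
proof (rule ccontr)
  assume "\<not> ?thesis"
  then have le: "n * e \<le> s * (\<Sum>j\<in>{1..n}. m j)" by simp
  have npos: "n > 0" using n s by simp
  let ?G = "{1..d} \<rightarrow>\<^sub>E (grid_nodes s :: 'k set)"
  have "finite ?G" "card ?G = n"
    by (simp_all add: finite_PiE finite_grid_nodes card_PiE card_grid_nodes n)
  then obtain \<theta> where \<theta>: "bij_betw \<theta> {0..<n} ?G"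
    using ex_bij_betw_nat_finite by blast
  have "\<exists>P. P \<in> homog {0..d} e \<and> P \<noteq> (0 :: (nat, 'k poly) mpoly) \<and>
      (\<forall>j\<in>{1..n}. vanishes_to_order {0..d} (m j) P (moved_grid_point d s (\<theta> ((j
          + r) mod n))))" for r
    by (rule generic_form_specializes[OF gen is_ring_hom_const_of_rat[where 'k = 'k] F van,
          where B = "\<lambda>i j. moved_grid_point d s (\<theta> ((j + r) mod n)) i"])
  then obtain P where P: "\<And>r. P r \<in> homog {0..d} e" "\<And>r. P r \<noteq> (0 :: (nat, 'k poly) mpoly)"
    "\<And>r j. j \<in> {1..n} \<Longrightarrow>
      vanishes_to_order {0..d} (m j) (P r) (moved_grid_point d s (\<theta> ((j + r) mod n)))"
    by metis
  have "(\<Prod>r\<in>{0..<n}. P r) = 0"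
  proof (rule no_form_at_moved_grid)
    show "(\<Prod>r\<in>{0..<n}. P r) \<in> homog {0..d} (n * e)"
      using homog_prod[of "{0..<n}" P "{0..d}" "\<lambda>_. e"] P(1) by simp
    show "n * e \<le> s * (\<Sum>j\<in>{1..n}. m j)" by (rule le)
    show "(\<Sum>j\<in>{1..n}. m j) > 0"
    proof (rule gr0I)
      assume "(\<Sum>j\<in>{1..n}. m j) = 0"
      then have "n * e \<le> 0" using le by simp
      then show False using npos \<open>e > 0\<close> by simp
    qed
    show "s \<ge> 2" "d * (s - 1) > s + 1" by (rule s)+
    fix z :: "nat \<Rightarrow> 'k" and Y :: "nat \<Rightarrow> 'k poly"
    assume z: "\<And>l. l \<in> {1..d} \<Longrightarrow> z l \<in> grid_nodes s"
    have "restrict z {1..d} \<in> \<theta> ` {0..<n}"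
      unfolding bij_betw_imp_surj_on[OF \<theta>] using z by simp
    then obtain i where i: "i < n" "restrict z {1..d} = \<theta> i" by auto
    let ?E = "peval (\<lambda>c. [:c:]) (\<lambda>l. [:moved_grid_point d s z l, Y l:])"
    have dvd: "monom 1 (m j) dvd ?E (P ((i + n - j) mod n))" if j: "j \<in> {1..n}" for j
    proof (rule vanishes_to_order_imp_dvd_line[OF P(1)])
      have "(j + (i + n - j) mod n) mod n = (j + (i + n - j)) mod n" by (simp add: mod_add_right_eq)
      also have "\<dots> = i" using j i by simp
      finally have idx: "(j + (i + n - j) mod n) mod n = i" .
      have z_eq: "\<theta> i l = z l" if "l \<in> {1..d}" for l
        using that by (simp add: i(2)[symmetric])
      have "grid_shift d s (\<theta> i) l = grid_shift d s z l" for l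
        unfolding grid_shift_def by (rule prod.cong) (simp_all add: z_eq)
      then have "moved_grid_point d s z l = moved_grid_point d s (\<theta> i) l" if "l \<in> {0..d}" for l
        using that by (simp add: moved_grid_point_def z_eq)
      then have "hasse_deriv id {0..d} G \<eta> (moved_grid_point d s z)
          = hasse_deriv id {0..d} G \<eta> (moved_grid_point d s (\<theta> i))" for G \<eta>
        unfolding hasse_deriv_def by (intro sum.cong refl arg_cong2[where f = "(*)"] prod.cong) auto
      then show "vanishes_to_order {0..d} (m j) (P ((i + n - j) mod n)) (moved_grid_point d s z)"
        using P(3)[OF j, of "(i + n - j) mod n"] unfolding idx vanishes_to_order_def by simp
    qed simp
    (* For each j there is exactly one shift that places the j-th point at the
       grid point z. *)
    have bij: "bij_betw (\<lambda>j. (i + n - j) mod n) {1..n} {0..<n}"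
    proof -
      have "inj_on (\<lambda>j. (i + n - j) mod n) {1..n}" by (rule inj_on_cyclic_shift[OF i(1)])
      moreover from this have "(\<lambda>j. (i + n - j) mod n) ` {1..n} = {0..<n}"
        by (intro card_subset_eq) (use npos in \<open>auto simp: card_image\<close>)
      ultimately show ?thesis by (simp add: bij_betw_def)
    qed
    have "monom 1 (\<Sum>j\<in>{1..n}. m j) = (\<Prod>j\<in>{1..n}. monom (1 :: 'k poly) (m j))"
      by (simp add: monom_altdef power_sum)
    also have "\<dots> dvd (\<Prod>j\<in>{1..n}. ?E (P ((i + n - j) mod n)))"
      by (rule prod_dvd_prod) (rule dvd)
    also have "\<dots> = (\<Prod>r\<in>{0..<n}. ?E (P r))"
      by (rule prod.reindex_bij_betw[OF bij])
    also have "\<dots> = ?E (\<Prod>r\<in>{0..<n}. P r)"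
      by (rule is_ring_hom_prod[symmetric]) (intro is_ring_hom_peval is_ring_hom_const_poly)
    finally show "monom 1 (\<Sum>j\<in>{1..n}. m j) dvd ?E (\<Prod>r\<in>{0..<n}. P r)" .
  qed
  then show False using P(2) by simp
qed

section \<open>From invariants to forms\<close>

definition translate_vars :: "(nat \<Rightarrow> 'k::comm_ring_1) \<Rightarrow> xt_var \<Rightarrow> (xt_var, 'k) mpoly" where
  "translate_vars b v = (case v of
      X_var j \<Rightarrow> mvar (X_var j) + mconst (b j) * mvar (T_var j)
    | T_var j \<Rightarrow> mvar (T_var j))"

definition translate_point :: "(nat \<Rightarrow> 'k::comm_ring_1) \<Rightarrow> (xt_var \<Rightarrow> 'k) \<Rightarrow> xt_var \<Rightarrow> 'k" where
  "translate_point b x v = (case v of X_var j \<Rightarrow> x (X_var j)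
      + b j * x (T_var j) | T_var j \<Rightarrow> x (T_var j))"

lemma peval_translate:
  "peval id x (peval mconst (translate_vars b) f) = peval id (translate_point b x) f"
proof -
  have "(\<lambda>v. peval id x (translate_vars b v)) = translate_point b x"
    by (rule ext) (simp add: translate_vars_def translate_point_def peval_add peval_mult
        peval_mconst peval_mvar is_ring_hom_id split: xt_var.split)
  then show ?thesis by (simp add: peval_peval is_ring_hom_id)
qed

lemma translate_inverse:
  "peval mconst (translate_vars (\<lambda>j. - b j)) (peval mconst (translate_vars b) f) = f"
proof -
  have "mconst (- c) + mconst c = (0 :: (xt_var, 'a) mpoly)" for c
    by (simp add: mconst_def single_add[symmetric])
  then have 0: "mconst (- c) * p + mconst c * p = (0 :: (xt_var, 'a) mpoly)" for c p
    by (simp add: distrib_right[symmetric])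
  have "(\<lambda>v. peval mconst (translate_vars (\<lambda>j. - b j)) (translate_vars b v)) = mvar"
    by (rule ext) (simp add: translate_vars_def peval_add peval_mult
        peval_mconst peval_mvar is_ring_hom_mconst 0 add.assoc split: xt_var.split)
  then show ?thesis by (simp add: peval_peval is_ring_hom_mconst peval_mvar_ident)
qed

lemma translate_vars_in_ring: "v \<in> xt_vars n \<Longrightarrow> translate_vars b v \<in> mpoly_ring (xt_vars n)"
  by (auto simp: translate_vars_def xt_vars_def intro!: mpoly_ring_add mpoly_ring_mult
      mpoly_ring_mconst mpoly_ring_mvar)

text \<open>Every \<open>b\<close> occurs in the group; the inverse of its translation is the one for \<open>- b\<close>.\<close>

lemma translation_in_group:
  assumes "b \<in> B"
  shows "restrict (peval mconst (translate_vars b)) (mpoly_ring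
      (xt_vars n)) \<in> translation_group n B"
proof -
  let ?A = "mpoly_ring (xt_vars n) :: (xt_var, 'a::field) mpoly set"
  let ?s = "\<lambda>b. peval mconst (translate_vars b)"
  have maps: "?s b p \<in> ?A" if "p \<in> ?A" for b p
    using that by (rule mpoly_ring_peval) (rule translate_vars_in_ring)
  have "bij_betw (?s b) ?A ?A"
  proof (rule bij_betw_byWitness[where f' = "?s (\<lambda>j. - b j)"])
    show "\<forall>p\<in>?A. ?s b (?s (\<lambda>j. - b j) p) = p"
      using translate_inverse[of "\<lambda>j. - b j"] by simp
  qed (use maps in \<open>auto simp: translate_inverse\<close>)
  then have "bij_betw (restrict (?s b) ?A) ?A ?A"
    by (subst bij_betw_cong[of ?A _ "?s b"]) auto
  moreover have "?s b (mvar (X_var j)) = mvar (X_var j) + mconst (b j) * mvar (T_var j)"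
    "?s b (mvar (T_var j)) = mvar (T_var j)" for j
    by (simp_all add: peval_mvar is_ring_hom_mconst translate_vars_def)
  moreover have "mvar (X_var j) \<in> ?A" "mvar (T_var j) \<in> ?A" if "j \<in> {1..n}" for j
    using that by (auto simp: xt_vars_def intro!: mpoly_ring_mvar)
  ultimately show ?thesis
    using assms
    by (auto simp: translation_group_def algebra_automorphisms_def mpoly_ring_add mpoly_ring_mult
        mpoly_ring_mconst peval_add peval_mult peval_mconst is_ring_hom_mconst intro!: bexI[of _ b])
qed

lemma group_element_is_translation:
  assumes "\<sigma> \<in> translation_group n B"
  obtains b where "b \<in> B" "\<And>p. p \<in> mpoly_ring (xt_vars n) \<Longrightarrow> \<sigma> p = peval mconst (translate_vars b) p"
proof -
  let ?A = "mpoly_ring (xt_vars n) :: (xt_var, 'a::field) mpoly set"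
  obtain b where b: "b \<in> B" "\<And>j. j \<in> {1..n} \<Longrightarrow> \<sigma> (mvar (T_var j)) = mvar (T_var j)"
     "\<And>j. j \<in> {1..n} \<Longrightarrow> \<sigma> (mvar (X_var j)) = mvar (X_var j) + mconst (b j) * mvar (T_var j)"
    using assms by (auto simp: translation_group_def)
  have hom: "\<sigma> (p + q) = \<sigma> p + \<sigma> q" "\<sigma> (p * q) = \<sigma> p * \<sigma> q" if "p \<in> ?A" "q \<in> ?A" for p q
    using assms that by (auto simp: translation_group_def algebra_automorphisms_def)
  have const: "\<sigma> (mconst c) = mconst c" for c
    using assms by (auto simp: translation_group_def algebra_automorphisms_def)
  have "p \<in> ?A \<and> \<sigma> p = peval mconst (translate_vars b) p" if "p \<in> ?A" for p
    using that
  proof (induction rule: mpoly_ring_induct)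
    case (var v)
    then show ?case
      by (auto simp: xt_vars_def b peval_mvar is_ring_hom_mconst translate_vars_def intro!:
          mpoly_ring_mvar)
  qed (auto simp: hom const peval_add peval_mult peval_mconst is_ring_hom_mconst
        mpoly_ring_add mpoly_ring_mult mpoly_ring_mconst)
  then show ?thesis using that b(1) by blast
qed

lemma prod_xt_vars: "(\<Prod>v\<in>xt_vars n. g v) = (\<Prod>j\<in>{1..n}. g (X_var j) * g (T_var j))"
  unfolding xt_vars_def
  by (subst prod.union_disjoint) (auto simp: prod.reindex inj_on_def prod.distrib)

lemma finite_xt_vars: "finite (xt_vars n)"
  by (simp add: xt_vars_def)

text \<open>Translations preserve the degree in each pair \<open>x j, t j\<close>, while they only lower the
degree in the \<open>x\<close>. The latter grading still acts on the invariants because the translation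
vectors can be rescaled.\<close>

definition x_degree :: "nat \<Rightarrow> (xt_var \<Rightarrow>\<^sub>0 nat) \<Rightarrow> nat" where
  "x_degree n m = (\<Sum>j\<in>{1..n}. lookup m (X_var j))"

definition pair_degree :: "(xt_var \<Rightarrow>\<^sub>0 nat) \<Rightarrow> nat \<Rightarrow> nat" where
  "pair_degree m j = lookup m (X_var j) + lookup m (T_var j)"

text \<open>Rescale the variables of the pair \<open>j\<close> by \<open>\<lambda> j\<close>, the \<open>x\<close> in addition by \<open>\<kappa>\<close>, and the
translation vector by \<open>\<kappa>\<close>. The invariance of \<open>f\<close> becomes an identity of polynomials in \<open>\<kappa>\<close> and
the \<open>\<lambda> j\<close>, whose coefficients are the multihomogeneous components. The component of \<open>m0\<close> is
taken at \<open>t = 1\<close>, which loses no information as its degree in each pair is fixed.\<close>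

lemma invariant_component_translation:
  fixes f :: "(xt_var, 'k::field_char_0) mpoly"
  assumes f: "f \<in> mpoly_ring (xt_vars n)"
    and inv: "\<And>c x. peval id (translate_point (\<lambda>j. c * b j) x) f = peval id x f"
    and K: "K = {m \<in> keys f. x_degree n m = x_degree n m0 \<and>
        (\<forall>j\<in>{1..n}. pair_degree m j = pair_degree m0 j)}"
  shows "(\<Sum>m\<in>K. lookup f m * (\<Prod>j\<in>{1..n}. (x j + b j) ^ lookup m (X_var j)))
      = (\<Sum>m\<in>K. lookup f m * (\<Prod>j\<in>{1..n}. x j ^ lookup m (X_var j)))"
proof -
  define ex where "ex m v = (if v = 0 then x_degree n m else pair_degree m v)" for m :: "xt_var \<Rightarrow>\<^sub>0
      nat" and v
  let ?mon = "\<lambda>x m. \<Prod>j\<in>{1..n}. x j ^ lookup m (X_var j)"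
  let ?c = "\<lambda>m. lookup f m * (?mon (\<lambda>j. x j + b j) m - ?mon x m)"
  have dec: "{0..n} = insert 0 {1..n}" by auto
  have "(\<Sum>m\<in>{m \<in> keys f. \<forall>v\<in>{0..n}. ex m v = ex m0 v}. ?c m) = 0"
  proof (rule poly_ident[where S = "\<lambda>_. UNIV"])
    fix y :: "nat \<Rightarrow> 'k"
    define pt where "pt w v = (case v of X_var j \<Rightarrow> y 0 * y j * w j | T_var j \<Rightarrow> y j)" for w v
    have shift: "translate_point (\<lambda>j. y 0 * b j) (pt x) = pt (\<lambda>j. x j + b j)"
      by (rule ext) (simp add: translate_point_def pt_def algebra_simps split: xt_var.split)
    have ev: "peval id (pt w) f = (\<Sum>m\<in>keys f. lookup f m * ?mon w m
        * (\<Prod>v\<in>{0..n}. y v ^ ex m v))" for w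
      unfolding peval_def
    proof (rule sum.cong[OF refl])
      fix m assume m: "m \<in> keys f"
      have "meval (pt w) m = (\<Prod>v\<in>xt_vars n. pt w v ^ lookup m v)"
        by (rule meval_superset[OF finite_xt_vars]) (use f m in \<open>auto simp: mpoly_ring_def\<close>)
      also have "\<dots> = (\<Prod>j\<in>{1..n}. y 0 ^ lookup m (X_var j)) *
          (\<Prod>j\<in>{1..n}. y j ^ pair_degree m j) * ?mon w m"
        unfolding prod_xt_vars prod.distrib[symmetric]
        by (rule prod.cong) (simp_all add: pt_def pair_degree_def power_mult_distrib power_add
            mult_ac)
      also have "(\<Prod>j\<in>{1..n}. y 0 ^ lookup m (X_var j)) = y 0 ^ x_degree n m"
        by (simp add: x_degree_def power_sum)
      also have "(\<Prod>j\<in>{1..n}. y j ^ pair_degree m j) = (\<Prod>j\<in>{1..n}. y j ^ ex m j)"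
        by (rule prod.cong) (auto simp: ex_def)
      also have "y 0 ^ x_degree n m * (\<Prod>j\<in>{1..n}. y j ^ ex m j) = (\<Prod>v\<in>{0..n}. y v ^ ex m v)"
        unfolding dec by (subst prod.insert) (auto simp: ex_def)
      finally show "id (lookup f m) * meval (pt w) m
          = lookup f m * ?mon w m * (\<Prod>v\<in>{0..n}. y v ^ ex m v)"
        by (simp add: mult_ac)
    qed
    have "peval id (pt (\<lambda>j. x j + b j)) f = peval id (pt x) f"
      using inv[of "y 0" "pt x"] by (simp add: shift)
    then show "(\<Sum>m\<in>keys f. ?c m * (\<Prod>v\<in>{0..n}. y v ^ ex m v)) = 0"
      by (simp add: ev algebra_simps sum_subtractf)
  qed (auto simp: infinite_UNIV_char_0)
  moreover have "{m \<in> keys f. \<forall>v\<in>{0..n}. ex m v = ex m0 v} = K"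
    unfolding K dec by (auto simp: ex_def)
  ultimately show ?thesis by (simp add: algebra_simps sum_subtractf)
qed

text \<open>Specializing the first \<open>d + 1\<close> points to the unit vectors shows that the rows of \<open>a\<close>
are independent. The right inverse \<open>R\<close> is a linear section of the map from the \<open>x\<close> to the \<open>y\<close>.\<close>

lemma generic_points_span:
  fixes a :: "nat \<Rightarrow> nat \<Rightarrow> 'k::field_char_0"
  assumes gen: "alg_independent_rat ({0..d} \<times> {1..n}) (\<lambda>(i, j). a i j)" and "d < n"
  obtains R where "\<And>i l. i \<in> {0..d} \<Longrightarrow> l \<in> {0..d} \<Longrightarrow> (\<Sum>j\<in>{1..n}. a i j * R j l)
      = (if i = l then 1 else 0)"
proof -
  have ind: "\<forall>i\<in>{0..d}. c i = 0" if c: "\<And>j. j \<in> {1..n} \<Longrightarrow> (\<Sum>i\<in>{0..d}. c i * a i j) = 0" for c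
  proof (rule ccontr)
    assume nz: "\<not> ?thesis"
    have "\<exists>y. (\<exists>i\<in>{0..d}. y i \<noteq> 0) \<and> (\<forall>j\<in>{1..n}. (\<Sum>i\<in>{0..d}.
        peval of_rat (\<lambda>(i, j). if j = Suc i then 1 else 0 :: 'k) (mvar (i, j)) * y i) = 0)"
    proof (rule generic_kernel_specializes[OF gen is_ring_hom_of_rat])
      show "(\<Sum>i\<in>{0..d}. peval of_rat (\<lambda>(i, j). a i j) (mvar (i, j)) * c i) = 0"
          if "j \<in> {1..n}" for j
        using c[OF that] by (simp add: peval_mvar is_ring_hom_of_rat mult.commute)
    qed (use nz in \<open>auto intro: mpoly_ring_mvar\<close>)
    then obtain y i where y: "i \<in> {0..d}" "y i \<noteq> 0"
      "\<And>j. j \<in> {1..n} \<Longrightarrow> (\<Sum>i\<in>{0..d}. (if j = Suc i then 1 else 0) * y i) = (0 :: 'k)"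
      by (auto simp: peval_mvar is_ring_hom_of_rat)
    have "(\<Sum>i'\<in>{0..d}. (if Suc i = Suc i' then 1 else 0) * y i') = (\<Sum>i'\<in>{0..d}. if i
        = i' then y i' else 0)"
      by (rule sum.cong) auto
    then have "y i = 0" using y(3)[of "Suc i"] y(1) \<open>d < n\<close> by simp
    with y(2) show False ..
  qed
  have "\<forall>l. \<exists>x. \<forall>i\<in>{0..d}. (\<Sum>j\<in>{1..n}. a i j * x j) = (if i = l then 1 else 0)"
    by (intro allI surjective_of_independent_rows[OF _ _ ind]) auto
  then obtain R where "\<And>l i. i \<in> {0..d} \<Longrightarrow> (\<Sum>j\<in>{1..n}. a i j * R l j) = (if i = l then 1 else 0)"
    by metis
  then show ?thesis by (intro that[of "\<lambda>j l. R l j"]) auto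
qed

text \<open>At \<open>t = 1\<close> the component \<open>\<phi>\<close> of \<open>m0\<close> is invariant under translation by all \<open>b\<close>
orthogonal to the rows of \<open>a\<close>, so it factors through the linear forms \<open>y\<close>, and \<open>F\<close> is its
composition with a section of \<open>y\<close>. The \<open>j\<close>-th unit vector lies over the \<open>j\<close>-th point. Near it
each monomial of \<open>\<phi>\<close> is small in all variables but \<open>x j\<close>, whose exponent is at most
\<open>\<mu> j = pair_degree m0 j\<close>; hence \<open>F\<close> vanishes to order \<open>e - \<mu> j\<close> there.\<close>

lemma invariant_gives_form:
  fixes a :: "nat \<Rightarrow> nat \<Rightarrow> 'k::field_char_0"
  assumes R: "\<And>i l. i \<in> {0..d} \<Longrightarrow> l \<in> {0..d} \<Longrightarrow> (\<Sum>j\<in>{1..n}. a i j * R j l) = (if i = l then 1 else 0)"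
    and f: "f \<in> mpoly_ring (xt_vars n)"
    and inv: "\<And>b x. b \<in> orthogonal_vectors d n a \<Longrightarrow> peval id (translate_point b x) f = peval id x f"
    and m0: "m0 \<in> keys f"
  obtains F where "F \<in> homog {0..d} (x_degree n m0)" "F \<noteq> 0"
    "\<And>j. j \<in> {1..n} \<Longrightarrow> vanishes_to_order {0..d} (x_degree n m0 - pair_degree m0 j) F (\<lambda>i. a i j)"
proof -
  define e where "e = x_degree n m0"
  define K where "K = {m \<in> keys f. x_degree n m = x_degree n m0 \<and>
        (\<forall>j\<in>{1..n}. pair_degree m j = pair_degree m0 j)}"
  have finK: "finite K" by (simp add: K_def)
  define \<phi> :: "(nat, 'k) mpoly" where
    "\<phi> = (\<Sum>m\<in>K. mconst (lookup f m) * (\<Prod>j\<in>{1..n}. mvar j ^ lookup m (X_var j)))"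
  have ev: "peval h x \<phi> = (\<Sum>m\<in>K. h (lookup f m) * (\<Prod>j\<in>{1..n}. x j ^ lookup m (X_var j)))"
    if h: "is_ring_hom h" for h :: "'k \<Rightarrow> 'z::comm_ring_1" and x
    using is_ring_hom_peval[OF h, of x]
    by (simp add: \<phi>_def is_ring_hom_sum is_ring_hom_prod is_ring_hom_power peval_mult[OF h]
        peval_mconst[OF h] peval_mvar[OF h])
  have \<phi>_homog: "\<phi> \<in> homog {1..n} e"
    unfolding \<phi>_def
  proof (rule homog_sum)
    fix m assume "m \<in> K"
    have "(\<Prod>j\<in>{1..n}. mvar j ^ lookup m (X_var j)) \<in> (homog {1..n} (\<Sum>j\<in>{1..n}. lookup m (X_var j)
        * 1) :: (nat, 'k) mpoly set)"
      by (intro homog_prod homog_power homog_mvar) auto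
    moreover have "(\<Sum>j\<in>{1..n}. lookup m (X_var j) * 1) = e"
      using \<open>m \<in> K\<close> by (simp add: K_def e_def x_degree_def)
    ultimately show "mconst (lookup f m) * (\<Prod>j\<in>{1..n}. mvar j ^ lookup m
        (X_var j)) \<in> homog {1..n} e"
      using homog_mult[OF homog_mconst] by fastforce
  qed
  have trans: "peval id (\<lambda>j. x j + b j) \<phi> = peval id x \<phi>"
    if b: "\<And>i. i \<in> {0..d} \<Longrightarrow> (\<Sum>j\<in>{1..n}. a i j * b j) = 0" for x b
    unfolding ev[OF is_ring_hom_id] id_apply
  proof (rule invariant_component_translation[OF f _ K_def])
    fix c y
    let ?b = "restrict (\<lambda>j. c * b j) {1..n}"
    have "(\<Sum>j\<in>{1..n}. a i j * ?b j) = c * (\<Sum>j\<in>{1..n}. a i j * b j)" for i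
      unfolding sum_distrib_left by (rule sum.cong) (auto simp: mult_ac)
    then have "?b \<in> orthogonal_vectors d n a"
      using b by (auto simp: orthogonal_vectors_def)
    from inv[OF this] have "peval id (translate_point ?b y) f = peval id y f" .
    moreover have "peval id (translate_point ?b y) f = peval id (translate_point (\<lambda>j. c * b j) y) f"
      by (rule peval_cong[OF f]) (auto simp: xt_vars_def translate_point_def)
    ultimately show "peval id (translate_point (\<lambda>j. c * b j) y) f = peval id y f" by simp
  qed
  have \<phi>_nz: "\<exists>x. peval id x \<phi> \<noteq> 0"
  proof (rule ccontr)
    assume *: "\<not> ?thesis"
    have "lookup f m0 = 0"
    proof (rule poly_ident_inj[where V = "{1..n}" and A = K and S = "\<lambda>_. UNIV"
          and e = "\<lambda>m j. lookup m (X_var j)" and c = "lookup f" and ?m0.0 = m0])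
      show "(\<Sum>m\<in>K. lookup f m * (\<Prod>j\<in>{1..n}. x j ^ lookup m (X_var j))) = 0" for x
        using * by (simp add: ev[OF is_ring_hom_id])
      fix m m' assume m: "m \<in> K" "m' \<in> K"
        and eq: "\<And>v. v \<in> {1..n} \<Longrightarrow> lookup m (X_var v) = lookup m' (X_var v)"
      show "m = m'"
      proof (rule lookup_eqI_on[of _ "xt_vars n"])
        show "keys m \<subseteq> xt_vars n" "keys m' \<subseteq> xt_vars n"
          using m f by (auto simp: K_def mpoly_ring_def)
        have "pair_degree m j = pair_degree m' j" if "j \<in> {1..n}" for j
          using m that by (simp add: K_def)
        then show "lookup m v = lookup m' v" if "v \<in> xt_vars n" for v
          using that eq by (auto simp: xt_vars_def pair_degree_def)
      qed
    qed (use m0 in \<open>auto simp: infinite_UNIV_char_0 K_def\<close>)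
    with m0 show False by (simp add: in_keys_iff)
  qed
  define F where "F = peval mconst (\<lambda>j. \<Sum>l\<in>{0..d}. mconst (R j l) * mvar l) \<phi>"
  have evF: "peval h y F = peval h (\<lambda>j. \<Sum>l\<in>{0..d}. h (R j l) * y l) \<phi>"
    if h: "is_ring_hom h" for h :: "'k \<Rightarrow> 'z::comm_ring_1" and y
    unfolding F_def peval_peval[OF h]
    by (simp add: peval_sum[OF h] peval_mult[OF h] peval_mconst[OF h] peval_mvar[OF h])
  have lift_eq: "(\<Sum>j\<in>{1..n}. a i j * (\<Sum>l\<in>{0..d}. R j l * y l)) = y i" if "i \<in> {0..d}" for i y
  proof -
    have "(\<Sum>j\<in>{1..n}. a i j * (\<Sum>l\<in>{0..d}. R j l * y l))
        = (\<Sum>l\<in>{0..d}. (\<Sum>j\<in>{1..n}. a i j * R j l) * y l)"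
      by (simp only: sum_distrib_left sum_distrib_right mult.assoc) (rule sum.swap)
    also have "\<dots> = (\<Sum>l\<in>{0..d}. if i = l then y l else 0)"
      by (rule sum.cong) (use R that in auto)
    also have "\<dots> = y i" using that by simp
    finally show ?thesis .
  qed
  have \<phi>F: "peval id (\<lambda>i. \<Sum>j\<in>{1..n}. a i j * x j) F = peval id x \<phi>" for x
  proof -
    let ?y = "\<lambda>i. \<Sum>j\<in>{1..n}. a i j * x j"
    define b where "b j = (\<Sum>l\<in>{0..d}. R j l * ?y l) - x j" for j
    have "(\<Sum>j\<in>{1..n}. a i j * b j) = 0" if "i \<in> {0..d}" for i
      using lift_eq[OF that, of ?y] by (simp add: b_def right_diff_distrib sum_subtractf)
    from trans[OF this, of x] show ?thesis by (simp add: evF[OF is_ring_hom_id] b_def)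
  qed
  show ?thesis
  proof (rule that[of F])
    show "F \<in> homog {0..d} (x_degree n m0)"
      unfolding F_def e_def[symmetric]
    proof (rule homog_peval[OF \<phi>_homog])
      show "(\<Sum>l\<in>{0..d}. mconst (R j l) * mvar l) \<in> homog {0..d} 1" for j
      proof (rule homog_sum)
        fix l assume "l \<in> {0..d}"
        then show "mconst (R j l) * mvar l \<in> homog {0..d} 1"
          using homog_mult[OF homog_mconst[of "R j l"] homog_mvar[of l "{0..d}"]] by simp
      qed
    qed
    show "F \<noteq> 0" using \<phi>_nz \<phi>F by auto
    fix j assume j: "j \<in> {1..n}"
    show "vanishes_to_order {0..d} (x_degree n m0 - pair_degree m0 j) F (\<lambda>i. a i j)"
    proof (rule vanishes_to_order_if_dvd_lines[OF \<open>F \<in> homog {0..d} (x_degree n m0)\<close>])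
      fix Y :: "nat \<Rightarrow> 'k"
      define X where "X k = (\<Sum>l\<in>{0..d}. R k l * Y l)" for k
      define Q where "Q = peval (\<lambda>c. [:c:]) (\<lambda>k. [:if k = j then 1 else 0, X k:]) \<phi>"
      have "poly (peval (\<lambda>c. [:c:]) (\<lambda>l. [:a l j, Y l:]) F) x = poly Q x" for x
      proof -
        let ?u = "\<lambda>k. if k = j then 1 else (0 :: 'k)"
        define b where "b k = (\<Sum>l\<in>{0..d}. R k l * a l j) - ?u k" for k
        have "(\<Sum>k\<in>{1..n}. a i k * b k) = 0" if "i \<in> {0..d}" for i
        proof -
          have "(\<Sum>k\<in>{1..n}. a i k * ?u k) = (\<Sum>k\<in>{1..n}. if k = j then a i k else 0)"
            by (rule sum.cong) auto
          also have "\<dots> = a i j" using j by simp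
          finally show ?thesis
            using lift_eq[OF that, of "\<lambda>l. a l j"]
                by (simp only: b_def right_diff_distrib sum_subtractf) simp
        qed
        from trans[OF this, of "\<lambda>k. ?u k + x * X k"]
        have "peval id (\<lambda>k. (\<Sum>l\<in>{0..d}. R k l * a l j) + x * X k) \<phi>
            = peval id (\<lambda>k. ?u k + x * X k) \<phi>"
          by (simp add: b_def algebra_simps)
        moreover have "(\<lambda>k. (\<Sum>l\<in>{0..d}. R k l * a l j) + x * X k)
            = (\<lambda>k. \<Sum>l\<in>{0..d}. R k l * (a l j + x * Y l))"
          by (rule ext) (simp add: X_def sum_distrib_left distrib_left sum.distrib mult_ac)
        ultimately have "peval id (\<lambda>l. a l j + x * Y l) F = peval id (\<lambda>k. ?u k + x * X k) \<phi>"
          by (simp add: evF[OF is_ring_hom_id])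
        then show ?thesis
          unfolding Q_def peval_hom[OF is_ring_hom_const_poly is_ring_hom_poly]
              by (simp add: id_def)
      qed
      then have "peval (\<lambda>c. [:c:]) (\<lambda>l. [:a l j, Y l:]) F = Q"
        by (simp add: poly_eq_poly_eq_iff[symmetric] fun_eq_iff)
      moreover have "monom 1 (x_degree n m0 - pair_degree m0 j) dvd Q"
        unfolding Q_def ev[OF is_ring_hom_const_poly]
      proof (intro dvd_sum dvd_mult)
        fix m assume m: "m \<in> K"
        let ?g = "\<lambda>k. [:if k = j then 1 else 0, X k:] ^ lookup m (X_var k)"
        have split: "x_degree n m = lookup m (X_var j) + (\<Sum>k\<in>{1..n} - {j}. lookup m (X_var k))"
          unfolding x_degree_def by (rule sum.remove) (use j in auto)
        then have le: "x_degree n m0 - pair_degree m0 j \<le> (\<Sum>k\<in>{1..n} - {j}. lookup m (X_var k))"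
        proof -
          have "pair_degree m j = pair_degree m0 j" "x_degree n m = x_degree n m0"
            using m j by (auto simp: K_def)
          then show ?thesis
            using split by (simp add: pair_degree_def)
        qed
        have "monom 1 (x_degree n m0 - pair_degree m0 j)
            dvd (\<Prod>k\<in>{1..n} - {j}. [:0, 1:] ^ lookup m (X_var k) :: 'k poly)"
          using le_imp_power_dvd[OF le, of "[:0, 1:] :: 'k poly"]
              by (simp add: power_sum monom_altdef)
        also have "\<dots> dvd (\<Prod>k\<in>{1..n} - {j}. ?g k)"
        proof (rule prod_dvd_prod)
          fix k assume "k \<in> {1..n} - {j}"
          have "[:0, X k:] = [:0, 1:] * [:X k:]" by simp
          then have "[:0, 1:] dvd [:0, X k:]" by (rule dvdI)
          then show "[:0, 1:] ^ lookup m (X_var k) dvd ?g k"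
            using \<open>k \<in> {1..n} - {j}\<close> by (simp add: dvd_power_same)
        qed
        also have "\<dots> dvd (\<Prod>k\<in>{1..n}. ?g k)"
          by (rule prod_dvd_prod_subset) auto
        finally show "monom 1 (x_degree n m0 - pair_degree m0 j) dvd (\<Prod>k\<in>{1..n}. ?g k)" .
      qed
      ultimately show "monom 1 (x_degree n m0 - pair_degree m0 j)
          dvd peval (\<lambda>c. [:c:]) (\<lambda>l. [:a l j, Y l:]) F"
        by simp
    qed simp
  qed
qed

section \<open>From forms to invariants\<close>

text \<open>Only derivatives with \<open>\<eta> 0 = 0\<close> are imposed, for which there is one condition per
point and per \<open>\<gamma>\<close> of weight less than \<open>M\<close> in \<open>d\<close> variables. Since \<open>n = s ^ d\<close>, points may be
replaced by \<open>\<rho> \<in> {0,...,s-1}^d\<close> for counting, and \<open>(\<rho>, \<gamma>) \<mapsto> \<rho> + s * \<gamma>\<close> injects the conditions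
into the monomials of degree less than \<open>e\<close>.\<close>

lemma exists_form_transverse:
  fixes a :: "nat \<Rightarrow> nat \<Rightarrow> 'k::field_char_0"
  assumes n: "n = s ^ d" and "d \<ge> 1" "s \<ge> 1" "M \<ge> 1" and e: "e = s * (M + d - 1)"
  obtains F where "F \<in> homog {0..d} e" "F \<noteq> 0"
    "\<And>j \<eta>. j \<in> {1..n} \<Longrightarrow> \<eta> 0 = 0 \<Longrightarrow> sum \<eta> {0..d} < M \<Longrightarrow>
      hasse_deriv id {0..d} F \<eta> (\<lambda>i. a i j) = 0"
proof -
  let ?V = "{1..d}"
  define \<N> where "\<N> = {N \<in> ?V \<rightarrow>\<^sub>E {..e}. sum N ?V \<le> e}"
  define \<Gamma> where "\<Gamma> = {\<gamma> \<in> ?V \<rightarrow>\<^sub>E {..<M}. sum \<gamma> ?V < M}"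
  define mono where "mono N = single 0 (e - sum N ?V)
      + (\<Sum>l\<in>?V. single l (N l))" for N :: "nat \<Rightarrow> nat"
  define J where "J = mono ` \<N>"
  have fin: "finite \<N>" "finite \<Gamma>" by (simp_all add: \<N>_def \<Gamma>_def finite_PiE)
  have dec: "{0..d} = insert 0 {1..d}" by auto
  have look: "lookup (mono N) l = (if l = 0 then e - sum N ?V else if l \<in> ?V then N l else 0)" for N
      l
    by (auto simp: mono_def lookup_add lookup_sum lookup_single when_def)
  have keys: "keys (mono N) \<subseteq> {0..d}" for N
    by (auto simp: in_keys_iff look split: if_splits)
  have deg: "mdeg (mono N) = e" if "N \<in> \<N>" for N
  proof -
    have "mdeg (mono N) = (\<Sum>l\<in>{0..d}. lookup (mono N) l)"
      by (rule mdeg_superset) (use keys in auto)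
    also have "\<dots> = (e - sum N ?V) + sum N ?V" unfolding dec by (simp add: look)
    finally show ?thesis using that by (simp add: \<N>_def)
  qed
  have "inj_on mono \<N>"
  proof (rule inj_onI)
    fix N N' assume N: "N \<in> \<N>" "N' \<in> \<N>" and eq: "mono N = mono N'"
    show "N = N'"
    proof (rule PiE_ext)
      show "N \<in> ?V \<rightarrow>\<^sub>E {..e}" "N' \<in> ?V \<rightarrow>\<^sub>E {..e}" using N by (auto simp: \<N>_def)
      show "N l = N' l" if "l \<in> ?V" for l
        using arg_cong[OF eq, of "\<lambda>m. lookup m l"] that by (simp add: look)
    qed
  qed
  then have cardJ: "card J = card \<N>" by (simp add: J_def card_image)
  have "card ({1..n} \<times> \<Gamma>) < card \<N>"
  proof -
    let ?D = "(?V \<rightarrow>\<^sub>E {..<s}) \<times> \<Gamma>"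
    define \<iota> where "\<iota> = (\<lambda>(\<rho>, \<gamma>). restrict (\<lambda>l. \<rho> l + s * \<gamma> l) ?V)"
    have sumd: "sum (\<iota> (\<rho>, \<gamma>)) ?V < e" if "\<rho> \<in> ?V \<rightarrow>\<^sub>E {..<s}" "\<gamma> \<in> \<Gamma>" for \<rho> \<gamma>
    proof -
      have "sum (\<iota> (\<rho>, \<gamma>)) ?V = sum \<rho> ?V + s * sum \<gamma> ?V"
        by (simp add: \<iota>_def sum.distrib sum_distrib_left)
      also have "\<dots> \<le> d * (s - 1) + s * (M - 1)"
      proof (intro add_mono mult_left_mono)
        have "sum \<rho> ?V \<le> (\<Sum>l\<in>?V. s - 1)"
        proof (rule sum_mono)
          fix l assume "l \<in> ?V"
          then have "\<rho> l < s" using PiE_mem[OF that(1)] by blast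
          then show "\<rho> l \<le> s - 1" by simp
        qed
        then show "sum \<rho> ?V \<le> d * (s - 1)" by simp
        show "sum \<gamma> ?V \<le> M - 1" using that(2) by (auto simp: \<Gamma>_def)
      qed simp
      also have "\<dots> < e"
      proof -
        obtain s' where s': "s = Suc s'" using \<open>s \<ge> 1\<close> by (cases s) auto
        obtain d' where d': "d = Suc d'" using \<open>d \<ge> 1\<close> by (cases d) auto
        obtain M' where M': "M = Suc M'" using \<open>M \<ge> 1\<close> by (cases M) auto
        show ?thesis by (simp add: e s' d' M' algebra_simps)
      qed
      finally show ?thesis .
    qed
    have into: "\<iota> ` ?D \<subseteq> \<N>"
    proof
      fix N assume "N \<in> \<iota> ` ?D"
      then obtain \<rho> \<gamma> where N: "N = \<iota> (\<rho>, \<gamma>)" "\<rho> \<in> ?V \<rightarrow>\<^sub>E {..<s}" "\<gamma> \<in> \<Gamma>" by auto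
      have s: "sum N ?V \<le> e" using sumd[OF N(2,3)] N(1) by simp
      moreover have "N l \<le> e" if "l \<in> ?V" for l
        using member_le_sum[of l ?V N] that s by simp
      moreover have "N \<in> extensional ?V" by (simp add: N(1) \<iota>_def)
      ultimately show "N \<in> \<N>" by (auto simp: \<N>_def PiE_def)
    qed
    have inj: "inj_on \<iota> ?D"
    proof (rule inj_onI)
      fix x y assume x: "x \<in> ?D" and y: "y \<in> ?D" and eq: "\<iota> x = \<iota> y"
      obtain \<rho> \<gamma> \<rho>' \<gamma>' where xy: "x = (\<rho>, \<gamma>)" "y = (\<rho>', \<gamma>')" by fastforce
      have l: "\<rho> l = \<rho>' l \<and> \<gamma> l = \<gamma>' l" if "l \<in> ?V" for l
      proof -
        have "\<rho> l < s" "\<rho>' l < s" using x y xy that by (auto simp: PiE_iff)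
        moreover have "\<rho> l + s * \<gamma> l = \<rho>' l + s * \<gamma>' l"
          using fun_cong[OF eq, of l] that by (simp add: \<iota>_def xy)
        ultimately show ?thesis
          by (metis add.commute add_right_cancel div_mult_self4 div_less add.left_neutral
              less_nat_zero_code)
      qed
      have "\<rho> = \<rho>'"
        by (rule PiE_ext[of _ ?V "\<lambda>_. {..<s}"]) (use x y xy l in auto)
      moreover have "\<gamma> = \<gamma>'"
        by (rule PiE_ext[of _ ?V "\<lambda>_. {..<M}"]) (use x y xy l in \<open>auto simp: \<Gamma>_def\<close>)
      ultimately show "x = y" by (simp add: xy)
    qed
    (* The weights in the image are less than e, so the monomial x_1 ^ e is not
       hit, and there is at least one more unknown than conditions. *)
    define N1 where "N1 = restrict (\<lambda>l. if l = 1 then e else 0) ?V"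
    have sum1: "sum N1 ?V = e" using \<open>d \<ge> 1\<close> by (simp add: N1_def)
    then have "N1 \<in> \<N>" by (auto simp: \<N>_def N1_def)
    moreover have "N1 \<notin> \<iota> ` ?D"
    proof
      assume "N1 \<in> \<iota> ` ?D"
      then obtain \<rho> \<gamma> where "N1 = \<iota> (\<rho>, \<gamma>)" "\<rho> \<in> ?V \<rightarrow>\<^sub>E {..<s}" "\<gamma> \<in> \<Gamma>" by auto
      then show False using sumd sum1 by auto
    qed
    ultimately have "\<iota> ` ?D \<subset> \<N>" using into by blast
    then have "card (\<iota> ` ?D) < card \<N>" using fin(1) by (rule psubset_card_mono[rotated])
    then show ?thesis
      using card_image[OF inj] by (simp add: card_cartesian_product card_PiE n)
  qed
  then have "card ({1..n} \<times> \<Gamma>) < card J" by (simp add: cardJ)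
  define row where "row r b = (case r of (j, \<gamma>) \<Rightarrow> \<Prod>l\<in>{0..d}.
      of_nat (lookup b l choose (\<gamma>(0 := 0)) l) * a l j ^ (lookup b l - (\<gamma>(0 := 0)) l))"
    for r :: "nat \<times> (nat \<Rightarrow> nat)" and b :: "nat \<Rightarrow>\<^sub>0 nat"
  have "finite J" using fin by (simp add: J_def)
  obtain y where y: "\<exists>b\<in>J. y b \<noteq> 0" "\<And>r. r \<in> {1..n} \<times> \<Gamma> \<Longrightarrow> (\<Sum>b\<in>J. row r b * y b) = 0"
    using underdetermined_system[OF _ \<open>finite J\<close> \<open>card
        ({1..n} \<times> \<Gamma>) < card J\<close>, of row] fin(2) by auto
  define F where "F = (\<Sum>b\<in>J. single b (y b))"
  have lookF: "lookup F b = (if b \<in> J then y b else 0)" for b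
    using \<open>finite J\<close> by (simp add: F_def lookup_sum_single)
  have keysF: "keys F \<subseteq> J"
    by (auto simp: in_keys_iff lookF split: if_splits)
  show ?thesis
  proof (rule that[of F])
    show "F \<in> homog {0..d} e"
      using keysF keys deg by (auto simp: homog_def mpoly_ring_def J_def)
    show "F \<noteq> 0" using y(1) lookF by (metis lookup_zero)
    fix j \<eta> assume j: "j \<in> {1..n}" and \<eta>: "\<eta> 0 = 0" "sum \<eta> {0..d} < M"
    define \<gamma> where "\<gamma> = restrict \<eta> ?V"
    have eq: "(\<gamma>(0 := 0)) l = \<eta> l" if "l \<in> {0..d}" for l
      using that \<eta>(1) by (auto simp: \<gamma>_def)
    have s: "sum \<eta> ?V < M" using \<eta> unfolding dec by simp
    then have "\<eta> l < M" if "l \<in> ?V" for l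
      using member_le_sum[of l ?V \<eta>] that by simp
    then have "\<gamma> \<in> \<Gamma>" using s by (auto simp: \<Gamma>_def \<gamma>_def)
    have "hasse_deriv id {0..d} F \<eta> (\<lambda>i. a i j) = (\<Sum>b\<in>J. lookup F b *
      (\<Prod>l\<in>{0..d}. of_nat (lookup b l choose \<eta> l) * a l j ^ (lookup b l - \<eta> l)))"
      unfolding hasse_deriv_def id_apply
      by (rule sum.mono_neutral_left) (use keysF \<open>finite J\<close> in \<open>auto simp: in_keys_iff\<close>)
    also have "\<dots> = (\<Sum>b\<in>J. row (j, \<gamma>) b * y b)"
    proof (rule sum.cong[OF refl])
      fix b assume "b \<in> J"
      have "row (j, \<gamma>) b = (\<Prod>l\<in>{0..d}. of_nat (lookup b l choose \<eta> l) * a l j ^ (lookup b l - \<eta> l))"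
        unfolding row_def prod.case by (rule prod.cong[OF refl]) (simp only: eq)
      then show "lookup F b *
        (\<Prod>l\<in>{0..d}. of_nat (lookup b l choose \<eta> l) * a l j ^ (lookup b l - \<eta> l))
            = row (j, \<gamma>) b * y b"
        using \<open>b \<in> J\<close> by (simp add: lookF mult.commute)
    qed
    also have "\<dots> = 0" by (rule y(2)) (use j \<open>\<gamma> \<in> \<Gamma>\<close> in auto)
    finally show "hasse_deriv id {0..d} F \<eta> (\<lambda>i. a i j) = 0" .
  qed
qed

text \<open>Adding a multiple of \<open>A\<close> to the direction \<open>Y\<close> only rescales the base point along the
line, which does not affect the vanishing of a form. So the directions with \<open>Y 0 = 0\<close> decide.\<close>

lemma transverse_vanishing_line:
  fixes F :: "(nat, 'k::field_char_0) mpoly"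
  assumes F: "F \<in> homog {0..d} e" and A0: "A 0 \<noteq> 0"
    and van: "\<And>\<eta>. \<eta> 0 = 0 \<Longrightarrow> sum \<eta> {0..d} < M \<Longrightarrow> hasse_deriv id {0..d} F \<eta> A = 0"
  shows "monom 1 M dvd peval (\<lambda>c. [:c:]) (\<lambda>l. [:A l, Y l:]) F"
proof -
  (* Y = Y' + \<tau> * A, hence A + \<epsilon> * Y = (1 + \<epsilon> * \<tau>) * A + \<epsilon> * Y'. *)
  define \<tau> where "\<tau> = Y 0 / A 0"
  define Y' where "Y' l = Y l - \<tau> * A l" for l
  have Y'0: "Y' 0 = 0" using A0 by (simp add: Y'_def \<tau>_def)
  have "(\<lambda>l. [:A l, Y l:]) = (\<lambda>l. [:1, \<tau>:] * [:A l:] + [:0, 1:] * [:Y' l:])"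
    by (rule ext) (simp add: Y'_def)
  then have "peval (\<lambda>c. [:c:]) (\<lambda>l. [:A l, Y l:]) F = (\<Sum>\<eta>\<in>{0..d} \<rightarrow>\<^sub>E {..e}.
      [:1, \<tau>:] ^ (e - sum \<eta> {0..d}) * [:0, 1:] ^ sum \<eta> {0..d} * (\<Prod>l\<in>{0..d}. [:Y' l:] ^ \<eta> l)
          * [:hasse_deriv id {0..d} F \<eta> A:])"
    by (simp only: taylor_homog[OF F finite_atLeastAtMost] hasse_deriv_hom[OF
        is_ring_hom_const_poly])
  moreover have "monom 1 M dvd [:1, \<tau>:] ^ (e - sum \<eta> {0..d}) * [:0, 1:] ^ sum \<eta> {0..d} *
      (\<Prod>l\<in>{0..d}. [:Y' l:] ^ \<eta> l) * [:hasse_deriv id {0..d} F \<eta> A:]" for \<eta>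
  proof (cases "sum \<eta> {0..d} < M")
    case True
    show ?thesis
    proof (cases "\<eta> 0 = 0")
      case True
      then show ?thesis using van \<open>sum \<eta> {0..d} < M\<close> by simp
    next
      case False
      have "(\<Prod>l\<in>{0..d}. [:Y' l:] ^ \<eta> l) = 0"
        by (rule prod_zero) (use False Y'0 in \<open>auto intro!: bexI[of _ 0] simp: zero_power\<close>)
      then show ?thesis by (simp only: mult_zero_left mult_zero_right dvd_0_right)
    qed
  next
    case False
    then have "monom 1 M dvd ([:0, 1:] :: 'k poly) ^ sum \<eta> {0..d}"
      by (simp add: monom_altdef le_imp_power_dvd)
    then show ?thesis by (simp only: dvd_mult dvd_mult2)
  qed
  ultimately show ?thesis by (simp add: dvd_sum)
qed

text \<open>At the \<open>j\<close>-th unit vector the Taylor coefficient for the exponents of \<open>\<alpha>\<close> outside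
\<open>j\<close> is just the coefficient of \<open>\<alpha>\<close> in \<open>p\<close>.\<close>

lemma exponent_bound_of_vanishing:
  fixes p :: "(nat, 'k::field_char_0) mpoly"
  assumes p: "p \<in> homog {1..n} e" and j: "j \<in> {1..n}"
    and line: "\<And>X. monom 1 M dvd peval (\<lambda>c. [:c:]) (\<lambda>k. [:if k = j then 1 else 0, X k:]) p"
    and \<alpha>: "\<alpha> \<in> keys p"
  shows "lookup \<alpha> j + M \<le> e"
proof (rule ccontr)
  assume "\<not> ?thesis"
  then have large: "e < lookup \<alpha> j + M" by simp
  let ?V = "{1..n}"
  have keys: "keys m \<subseteq> ?V" and deg: "sum (lookup m) ?V = e"
    if "m \<in> keys p" for m
    using p that mdeg_superset[of ?V m] by (auto simp: homog_def mpoly_ring_def)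
  define \<eta> where "\<eta> = restrict (\<lambda>l. if l = j then 0 else lookup \<alpha> l) ?V"
  have "sum (lookup m) ?V = lookup m j + sum (lookup m) (?V - {j})" for m
    by (rule sum.remove) (use j in auto)
  note remove = this
  have "sum \<eta> ?V = \<eta> j + sum \<eta> (?V - {j})"
    by (rule sum.remove) (use j in auto)
  also have "\<dots> = sum (lookup \<alpha>) (?V - {j})"
    using j by (simp add: \<eta>_def)
  finally have sum\<eta>: "sum \<eta> ?V < M" using deg[OF \<alpha>] remove[of \<alpha>] large by simp
  have "hasse_deriv id ?V p \<eta> (\<lambda>k. if k = j then 1 else 0) = 0"
    using vanishes_to_order_if_dvd_lines[OF p _ line] sum\<eta> by (simp add: vanishes_to_order_def)
  moreover have "hasse_deriv id ?V p \<eta> (\<lambda>k. if k = j then 1 else 0)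
      = (\<Sum>m\<in>keys p. if m = \<alpha> then lookup p m else 0)"
    unfolding hasse_deriv_def
  proof (rule sum.cong[OF refl])
    fix m assume m: "m \<in> keys p"
    let ?f = "\<lambda>l. of_nat (lookup m l choose \<eta> l)
        * (if l = j then 1 else 0 :: 'k) ^ (lookup m l - \<eta> l)"
    have fl: "?f l = (if l = j \<or> lookup m l = lookup \<alpha> l then 1 else 0)" if "l \<in> ?V" for l
      using that by (auto simp: \<eta>_def zero_power_eq not_less binomial_eq_0)
    have "(\<Prod>l\<in>?V. ?f l) = (if m = \<alpha> then 1 else 0)"
    proof (cases "m = \<alpha>")
      case True
      have "(\<Prod>l\<in>?V. ?f l) = (\<Prod>l\<in>?V. 1)"
        by (rule prod.cong[OF refl], subst fl) (auto simp: True)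
      then show ?thesis using True by simp
    next
      case False
      have "\<not> (\<forall>l\<in>?V - {j}. lookup m l = lookup \<alpha> l)"
      proof
        assume *: "\<forall>l\<in>?V - {j}. lookup m l = lookup \<alpha> l"
        then have "sum (lookup m) (?V - {j}) = sum (lookup \<alpha>) (?V - {j})"
          by (intro sum.cong) auto
        then have "lookup m j = lookup \<alpha> j"
          using remove[of m] remove[of \<alpha>] deg[OF m] deg[OF \<alpha>] by simp
        then have "m = \<alpha>"
          by (intro lookup_eqI_on[OF keys[OF m] keys[OF \<alpha>]]) (use * in auto)
        with False show False ..
      qed
      then obtain l where l: "l \<in> ?V" "l \<noteq> j" "lookup m l \<noteq> lookup \<alpha> l" by blast
      have "?f l = 0" using fl[OF l(1)] l by simp
      then have "(\<Prod>l\<in>?V. ?f l) = 0"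
        by (intro prod_zero bexI[OF _ l(1)]) auto
      then show ?thesis using False by simp
    qed
    then show "id (lookup p m) * (\<Prod>l\<in>?V. ?f l) = (if m = \<alpha> then lookup p m else 0)"
      by simp
  qed
  ultimately have "lookup p \<alpha> = 0" using \<alpha> by simp
  with \<alpha> show False by (simp add: in_keys_iff)
qed

text \<open>With \<open>p(x) = F(y(x))\<close> at \<open>t = 1\<close> and \<open>E = e - M\<close>, the invariant is the product of
the \<open>t j ^ E\<close> and \<open>p(x / t)\<close>. It is a polynomial because the vanishing of \<open>F\<close> at the \<open>j\<close>-th
point bounds the exponent of \<open>x j\<close> in \<open>p\<close> by \<open>E\<close>.\<close>

lemma exists_invariant:
  fixes a :: "nat \<Rightarrow> nat \<Rightarrow> 'k::field_char_0"
  assumes n: "n = s ^ d" and "d \<ge> 1" "s \<ge> 1" "M \<ge> 1" and e: "e = s * (M + d - 1)"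
    and a0: "\<And>j. j \<in> {1..n} \<Longrightarrow> a 0 j \<noteq> 0"
    and R: "\<And>i l. i \<in> {0..d} \<Longrightarrow> l \<in> {0..d} \<Longrightarrow> (\<Sum>j\<in>{1..n}. a i j * R j l) = (if i = l then 1 else 0)"
  obtains f m where "f \<in> invariants (mpoly_ring (xt_vars n)) (translation_group n
      (orthogonal_vectors d n a))"
    "m \<in> keys f" "x_degree n m = e" "(\<Sum>j\<in>{1..n}. pair_degree m j) = n * (e - M)"
proof -
  let ?A = "mpoly_ring (xt_vars n) :: (xt_var, 'k) mpoly set"
  obtain F where F: "F \<in> homog {0..d} e" "F \<noteq> 0"
    and van: "\<And>j \<eta>. j \<in> {1..n} \<Longrightarrow> \<eta> 0 = 0 \<Longrightarrow> sum \<eta> {0..d} < M \<Longrightarrow>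
      hasse_deriv id {0..d} F \<eta> (\<lambda>i. a i j) = 0"
    using exists_form_transverse[OF n \<open>d \<ge> 1\<close> \<open>s \<ge> 1\<close> \<open>M \<ge> 1\<close> e, where a = a] by metis
  define p where "p = peval mconst (\<lambda>i. \<Sum>k\<in>{1..n}. mconst (a i k) * mvar k) F"
  have evp: "peval h x p = peval h (\<lambda>i. \<Sum>k\<in>{1..n}. h (a i k) * x k) F"
    if h: "is_ring_hom h" for h :: "'k \<Rightarrow> 'z::comm_ring_1" and x
    unfolding p_def peval_peval[OF h]
    by (simp add: peval_sum[OF h] peval_mult[OF h] peval_mconst[OF h] peval_mvar[OF h])
  have p_homog: "p \<in> homog {1..n} e"
    unfolding p_def
  proof (rule homog_peval[OF F(1)], rule homog_sum)
    fix i k assume "k \<in> {1..n}"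
    then show "mconst (a i k) * mvar k \<in> homog {1..n} 1"
      using homog_mult[OF homog_mconst[of "a i k"] homog_mvar[of k "{1..n}"]] by simp
  qed
  have "p \<noteq> 0"
  proof
    assume "p = 0"
    have "F = 0"
    proof (rule mpoly_ext_zero[where V = "{0..d}" and S = "\<lambda>_. UNIV"])
      show "F \<in> mpoly_ring {0..d}" using F(1) by (simp add: homog_def)
      fix y :: "nat \<Rightarrow> 'k"
      have "(\<Sum>k\<in>{1..n}. a i k * (\<Sum>l\<in>{0..d}. R k l * y l)) = y i" if "i \<in> {0..d}" for i
      proof -
        have "(\<Sum>j\<in>{1..n}. a i j * (\<Sum>l\<in>{0..d}. R j l * y l))
            = (\<Sum>l\<in>{0..d}. (\<Sum>j\<in>{1..n}. a i j * R j l) * y l)"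
          by (simp only: sum_distrib_left sum_distrib_right mult.assoc) (rule sum.swap)
        also have "\<dots> = (\<Sum>l\<in>{0..d}. if i = l then y l else 0)"
          by (rule sum.cong) (use R that in auto)
        also have "\<dots> = y i" using that by simp
        finally show ?thesis .
      qed
      then have "peval id y F = peval id (\<lambda>k. \<Sum>l\<in>{0..d}. R k l * y l) p"
        unfolding evp[OF is_ring_hom_id] id_apply
        by (intro peval_cong[of F "{0..d}"]) (use F(1) in \<open>auto simp: homog_def\<close>)
      then show "peval id y F = 0" using \<open>p = 0\<close> by simp
    qed (auto simp: infinite_UNIV_char_0)
    with F(2) show False ..
  qed
  have bound: "lookup \<alpha> j + M \<le> e" if "\<alpha> \<in> keys p" "j \<in> {1..n}" for \<alpha> j
  proof (rule exponent_bound_of_vanishing[OF p_homog that(2) _ that(1)])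
    fix X :: "nat \<Rightarrow> 'k"
    have "(\<Sum>k\<in>{1..n}. [:a i k:] * [:if k = j then 1 else 0, X k:])
        = [:a i j, \<Sum>k\<in>{1..n}. a i k * X k:]" for i
    proof -
      have "(\<Sum>k\<in>{1..n}. [:a i k:] * [:if k = j then 1 else 0, X k:])
          = (\<Sum>k\<in>{1..n}. [:if k = j then a i k else 0:]) + (\<Sum>k\<in>{1..n}. [:0, 1:] * [:a i k * X k:])"
        unfolding sum.distrib[symmetric] by (rule sum.cong) auto
      also have "(\<Sum>k\<in>{1..n}. [:if k = j then a i k else 0:])
          = [:\<Sum>k\<in>{1..n}. if k = j then a i k else 0:]"
        by (rule is_ring_hom_sum[OF is_ring_hom_const_poly, symmetric])
      also have "(\<Sum>k\<in>{1..n}. if k = j then a i k else 0) = a i j" using that(2) by simp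
      also have "(\<Sum>k\<in>{1..n}. [:0, 1:] * [:a i k * X k:]) = [:0, 1:] * [:\<Sum>k\<in>{1..n}. a i k * X k:]"
        unfolding sum_distrib_left[symmetric] is_ring_hom_sum[OF is_ring_hom_const_poly] ..
      finally show ?thesis by simp
    qed
    then have "peval (\<lambda>c. [:c:]) (\<lambda>k. [:if k = j then 1 else 0, X k:]) p
        = peval (\<lambda>c. [:c:]) (\<lambda>i. [:a i j, \<Sum>k\<in>{1..n}. a i k * X k:]) F"
      by (simp only: evp[OF is_ring_hom_const_poly])
    then show "monom 1 M dvd peval (\<lambda>c. [:c:]) (\<lambda>k. [:if k = j then 1 else 0, X k:]) p"
      using transverse_vanishing_line[OF F(1), where A = "\<lambda>i. a i j"
          and M = M] a0 van that(2) by simp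
  qed
  define E where "E = e - M"
  define mon where "mon \<alpha> = (\<Sum>j\<in>{1..n}. single (X_var j) (lookup \<alpha> j)
      + single (T_var j) (E - lookup \<alpha> j))" for \<alpha> :: "nat \<Rightarrow>\<^sub>0 nat"
  have lookX: "lookup (mon \<alpha>) (X_var i) = (if i \<in> {1..n} then lookup \<alpha> i else 0)"
    and lookT: "lookup (mon \<alpha>) (T_var i) = (if i \<in> {1..n} then E - lookup \<alpha> i else 0)" for \<alpha> i
    by (auto simp: mon_def lookup_sum lookup_add lookup_single when_def)
  have keys_mon: "keys (mon \<alpha>) \<subseteq> xt_vars n" for \<alpha>
  proof
    fix v assume "v \<in> keys (mon \<alpha>)"
    then show "v \<in> xt_vars n"
      by (cases v) (auto simp: in_keys_iff lookX lookT xt_vars_def split: if_splits)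
  qed
  define f where "f = (\<Sum>\<alpha>\<in>keys p. single (mon \<alpha>) (lookup p \<alpha>))"
  have keysf: "keys f \<subseteq> mon ` keys p"
    using keys_sum[of "\<lambda>\<alpha>. single (mon \<alpha>) (lookup p \<alpha>)" "keys p"]
    unfolding f_def by (force split: if_splits)
  have f_ring: "f \<in> ?A" using keysf keys_mon by (fastforce simp: mpoly_ring_def)
  have p_keys: "keys \<alpha> \<subseteq> {1..n}" if "\<alpha> \<in> keys p" for \<alpha>
    using p_homog that by (auto simp: homog_def mpoly_ring_def)
  have evf: "peval id x f = (\<Prod>j\<in>{1..n}. x (T_var j) ^ E)
      * peval id (\<lambda>j. x (X_var j) / x (T_var j)) p"
    if x: "\<And>j. j \<in> {1..n} \<Longrightarrow> x (T_var j) \<noteq> 0" for x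
  proof -
    have "meval x (mon \<alpha>) = (\<Prod>j\<in>{1..n}. x (T_var j) ^ E) * meval (\<lambda>j. x (X_var j) / x (T_var j)) \<alpha>"
      if \<alpha>: "\<alpha> \<in> keys p" for \<alpha>
    proof -
      have "meval x (mon \<alpha>) = (\<Prod>j\<in>{1..n}. x (X_var j) ^ lookup \<alpha> j
          * x (T_var j) ^ (E - lookup \<alpha> j))"
        unfolding meval_superset[OF finite_xt_vars keys_mon] prod_xt_vars
        by (rule prod.cong) (simp_all add: lookX lookT)
      also have "\<dots> = (\<Prod>j\<in>{1..n}. x (T_var j) ^ E * (x (X_var j) / x (T_var j)) ^ lookup \<alpha> j)"
      proof (rule prod.cong[OF refl])
        fix j assume j: "j \<in> {1..n}"
        have "lookup \<alpha> j \<le> E" using bound[OF \<alpha> j] by (simp add: E_def)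
        then show "x (X_var j) ^ lookup \<alpha> j * x (T_var j) ^ (E - lookup \<alpha> j)
            = x (T_var j) ^ E * (x (X_var j) / x (T_var j)) ^ lookup \<alpha> j"
          using x[OF j] by (simp add: power_diff power_divide)
      qed
      finally show ?thesis
        by (simp add: prod.distrib meval_superset[OF finite_atLeastAtMost p_keys[OF \<alpha>]])
    qed
    then show ?thesis
      unfolding f_def peval_sum[OF is_ring_hom_id] peval_single[OF is_ring_hom_id]
      by (simp add: peval_def sum_distrib_left mult_ac)
  qed
  have f_inv: "f \<in> invariants ?A (translation_group n (orthogonal_vectors d n a))"
  proof -
    have "\<sigma> f = f" if \<sigma>G: "\<sigma> \<in> translation_group n (orthogonal_vectors d n a)" for \<sigma>
    proof -
      obtain b where b: "b \<in> orthogonal_vectors d n a"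
          and \<sigma>: "\<sigma> f = peval mconst (translate_vars b) f"
        using group_element_is_translation[OF \<sigma>G] f_ring by metis
      have "peval mconst (translate_vars b) f - f = 0"
      (* It suffices to compare values where no t j vanishes, so that x / t makes
         sense. *)
      proof (rule mpoly_ext_zero[where V = "xt_vars n" and S = "\<lambda>_. UNIV - {0}"])
        show "peval mconst (translate_vars b) f - f \<in> ?A"
          by (intro mpoly_ring_diff f_ring mpoly_ring_peval[OF f_ring] translate_vars_in_ring)
        fix x :: "xt_var \<Rightarrow> 'k" assume x: "\<And>v. v \<in> xt_vars n \<Longrightarrow> x v \<in> UNIV - {0}"
        then have T: "x (T_var j) \<noteq> 0" if "j \<in> {1..n}" for j using that by (auto simp: xt_vars_def)
        have "peval id (translate_point b x) f = peval id x f"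
        proof -
          have "(\<Sum>k\<in>{1..n}. a i k * (translate_point b x (X_var k) / translate_point b x (T_var k)))
              = (\<Sum>k\<in>{1..n}. a i k * (x (X_var k) / x (T_var k)))" if "i \<in> {0..d}" for i
          proof -
            have "(\<Sum>k\<in>{1..n}. a i k * (translate_point b x (X_var k) / translate_point b x
                (T_var k)))
              = (\<Sum>k\<in>{1..n}. a i k * (x (X_var k) / x (T_var k))) + (\<Sum>k\<in>{1..n}. a i k * b k)"
              unfolding sum.distrib[symmetric]
              by (rule sum.cong) (use T in \<open>auto simp: translate_point_def add_divide_distrib
                  distrib_left\<close>)
            then show ?thesis using b that by (simp add: orthogonal_vectors_def)
          qed
          then have "peval id (\<lambda>j. translate_point b x (X_var j) / translate_point b x (T_var j)) p
              = peval id (\<lambda>j. x (X_var j) / x (T_var j)) p"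
            unfolding evp[OF is_ring_hom_id] id_apply
            by (intro peval_cong[of F "{0..d}"]) (use F(1) in \<open>auto simp: homog_def\<close>)
          then show ?thesis
            using evf[of x, OF T] evf[of "translate_point b x"] T by (simp add: translate_point_def)
        qed
        moreover have "peval id x (g - f) = peval id x g - peval id x f" for g
          using peval_add[OF is_ring_hom_id, of x "g - f" f] by simp
        ultimately show "peval id x (peval mconst (translate_vars b) f - f) = 0"
          by (simp add: peval_translate)
      qed (auto simp: finite_xt_vars infinite_UNIV_char_0)
      then show ?thesis by (simp add: \<sigma>)
    qed
    then show ?thesis using f_ring by (simp add: invariants_def)
  qed
  have "f \<noteq> 0"
  proof
    assume "f = 0"
    have "p = 0"
    proof (rule mpoly_ext_zero[where V = "{1..n}" and S = "\<lambda>_. UNIV"])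
      show "p \<in> mpoly_ring {1..n}" using p_homog by (simp add: homog_def)
      fix x :: "nat \<Rightarrow> 'k"
      show "peval id x p = 0"
        using evf[of "\<lambda>v. case v of X_var j \<Rightarrow> x j | T_var j \<Rightarrow> 1"] \<open>f = 0\<close> by simp
    qed (auto simp: infinite_UNIV_char_0)
    with \<open>p \<noteq> 0\<close> show False ..
  qed
  then obtain m where m: "m \<in> keys f" by (metis keys_eq_empty ex_in_conv)
  then obtain \<alpha> where \<alpha>: "\<alpha> \<in> keys p" "m = mon \<alpha>" using keysf by auto
  have "x_degree n m = mdeg \<alpha>"
    unfolding mdeg_superset[OF finite_atLeastAtMost p_keys[OF \<alpha>(1)]] x_degree_def \<alpha>(2)
    by (rule sum.cong) (simp_all add: lookX)
  then have "x_degree n m = e" using p_homog \<alpha>(1) by (simp add: homog_def)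
  moreover have "(\<Sum>j\<in>{1..n}. pair_degree m j) = (\<Sum>j\<in>{1..n}. e - M)"
  proof (rule sum.cong[OF refl])
    fix j assume j: "j \<in> {1..n}"
    then show "pair_degree m j = e - M"
      using bound[OF \<alpha>(1) j] by (simp add: pair_degree_def \<alpha>(2) lookX lookT E_def)
  qed
  ultimately show ?thesis using that[OF f_inv m] by simp
qed

lemma x_degree_add: "x_degree n (m + m') = x_degree n m + x_degree n m'"
  by (simp add: x_degree_def lookup_add sum.distrib)

lemma pair_degree_add: "pair_degree (m + m') j = pair_degree m j + pair_degree m' j"
  by (simp add: pair_degree_def lookup_add)

text \<open>A linear inequality between degrees that holds for all generators of an algebra
holds in the whole algebra.\<close>

lemma is_subalgebra_degree_cone:
  fixes u v :: "('v \<Rightarrow>\<^sub>0 nat) \<Rightarrow> nat"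
  assumes "u 0 = 0" "\<And>m m'. u (m + m') = u m + u m'" "\<And>m m'. v (m + m') = v m + v m'"
  shows "is_subalgebra {f :: ('v, 'k::comm_ring_1) mpoly. \<forall>m\<in>keys f. u m \<le> v m}"
  unfolding is_subalgebra_def
proof (intro conjI ballI subsetI)
  fix f :: "('v, 'k) mpoly" assume "f \<in> range mconst"
  then show "f \<in> {f. \<forall>m\<in>keys f. u m \<le> v m}"
    using assms(1) by (auto simp: mconst_def split: if_splits)
next
  fix f g :: "('v, 'k) mpoly"
  assume f: "f \<in> {f. \<forall>m\<in>keys f. u m \<le> v m}" and g: "g \<in> {f. \<forall>m\<in>keys f. u m \<le> v m}"
  show "f + g \<in> {f. \<forall>m\<in>keys f. u m \<le> v m}"
    using f g Poly_Mapping.keys_add[of f g] by auto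
  show "f * g \<in> {f. \<forall>m\<in>keys f. u m \<le> v m}"
    using f g keys_mult[of f g] assms(2,3) by (force intro: add_mono)
qed

theorem theorem4:
  fixes a :: "nat \<Rightarrow> nat \<Rightarrow> 'k::{alg_closed_field, field_char_0}"
    and d s n :: nat
  assumes "d \<ge> 2" and "s \<ge> 2"
    and "(s, d) \<notin> {(2, 2), (3, 2), (2, 3)}"
    and "n = s ^ d"
    and "alg_independent_rat ({0..d} \<times> {1..n}) (\<lambda>(i, j). a i j)"
  shows "\<not> finitely_generated_algebra
    (invariants (mpoly_ring (xt_vars n)) (translation_group n (orthogonal_vectors d n a)))"
proof
  let ?A = "mpoly_ring (xt_vars n) :: (xt_var, 'k) mpoly set"
  let ?Inv = "invariants ?A (translation_group n (orthogonal_vectors d n a))"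
  let ?N = "\<lambda>m. \<Sum>j\<in>{1..n}. pair_degree m j"
  assume "finitely_generated_algebra ?Inv"
  then obtain S where S: "finite S" "is_subalgebra hull S = ?Inv"
    by (auto simp: finitely_generated_algebra_def)
  (* Among the s, d \<ge> 2 this fails exactly for the excluded pairs. *)
  have room: "d * (s - 1) > s + 1"
  proof -
    consider "s = 2" "d \<ge> 4" | "s = 3" "d \<ge> 3" | "s \<ge> 4"
      using assms(1-3) by fastforce
    then show ?thesis
    proof cases
      case 3
      have "2 * (s - 1) \<le> d * (s - 1)" using assms(1) by simp
      with 3 show ?thesis by linarith
    qed auto
  qed
  have "d < n"
    using less_le_trans[OF less_exp[of d] power_mono[of 2 s d]] assms(2,4) by simp
  obtain R where R: "\<And>i l. i \<in> {0..d} \<Longrightarrow> l \<in> {0..d} \<Longrightarrow> (\<Sum>j\<in>{1..n}. a i j * R j l)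
      = (if i = l then 1 else 0)"
    using generic_points_span[OF assms(5) \<open>d < n\<close>] by metis
  have a0: "a 0 j \<noteq> 0" if "j \<in> {1..n}" for j
  proof
    assume "a 0 j = 0"
    then have "mpoly_eval_rat (\<lambda>(i, j). a i j) (mvar (0, j)) = 0"
      by (simp add: mpoly_eval_rat_def mvar_def)
    then have "mvar (0, j) = (0 :: (nat \<times> nat, rat) mpoly)"
      using assms(5) that mpoly_ring_mvar[of "(0, j)" "{0..d} \<times> {1..n}"]
          by (auto simp: alg_independent_rat_def)
    then have "lookup (mvar (0, j) :: (nat \<times> nat, rat) mpoly) (single (0, j) 1) = 0"
      by simp
    then show False by (simp add: mvar_def)
  qed
  have strict: "n * s * x_degree n m < s * ?N m + n * x_degree n m"
    if f: "f \<in> ?Inv" and m: "m \<in> keys f" and pos: "x_degree n m > 0" for f m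
  proof -
    have f_ring: "f \<in> ?A" using f by (simp add: invariants_def)
    have inv: "peval id (translate_point b x) f = peval id x f"
        if "b \<in> orthogonal_vectors d n a" for b x
    proof -
      have "peval mconst (translate_vars b) f = f"
        using f translation_in_group[OF that, of n] f_ring by (force simp: invariants_def)
      then show ?thesis using peval_translate[of x b f] by simp
    qed
    obtain F where F: "F \<in> homog {0..d} (x_degree n m)" "F \<noteq> 0"
      "\<And>j. j \<in> {1..n} \<Longrightarrow> vanishes_to_order {0..d} (x_degree n m - pair_degree m j) F (\<lambda>i. a i j)"
      using invariant_gives_form[OF R f_ring inv m] by blast
    have "s * (\<Sum>j\<in>{1..n}. x_degree n m - pair_degree m j) < n * x_degree n m"
      by (rule no_form_at_generic_points[OF assms(5,4,2) room F(1,2,3) pos])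
    moreover have "n * x_degree n m \<le> (\<Sum>j\<in>{1..n}. x_degree n m - pair_degree m j) + ?N m"
    proof -
      have "(\<Sum>j\<in>{1..n}. x_degree n m) \<le> (\<Sum>j\<in>{1..n}. (x_degree n m - pair_degree m j)
          + pair_degree m j)"
        by (rule sum_mono) simp
      then show ?thesis by (simp add: sum.distrib)
    qed
    then have "s * (n * x_degree n m) \<le> s * ((\<Sum>j\<in>{1..n}. x_degree n m - pair_degree m j) + ?N m)"
      by (rule mult_left_mono) simp
    ultimately show ?thesis by (simp add: distrib_left mult_ac)
  qed
  (* The strict inequality for the generators leaves a gap of at least 1, hence
     of at least 1 / q of any positive degree in x that occurs. *)
  define q where "q = Max (insert 0 (x_degree n ` (\<Union>f\<in>S. keys f)))"
  have q: "x_degree n m \<le> q" if "f \<in> S" "m \<in> keys f" for f m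
    unfolding q_def by (rule Max_ge) (use S(1) that in auto)
  define C where "C = {f :: (xt_var, 'k) mpoly. \<forall>m\<in>keys f.
      q * (n * s * x_degree n m) + x_degree n m \<le> q * (s * ?N m + n * x_degree n m)}"
  have "is_subalgebra C"
    unfolding C_def
    by (rule is_subalgebra_degree_cone)
       (simp_all add: x_degree_add pair_degree_add sum.distrib algebra_simps, simp add:
           x_degree_def)
  moreover have "S \<subseteq> C"
  proof
    fix f assume f: "f \<in> S"
    then have fInv: "f \<in> ?Inv" using S(2) hull_subset[of S is_subalgebra] by auto
    have "q * (n * s * x_degree n m) + x_degree n m \<le> q * (s * ?N m + n * x_degree n m)"
      if m: "m \<in> keys f" for m
    proof (cases "x_degree n m = 0")
      case False
      then have "n * s * x_degree n m + 1 \<le> s * ?N m + n * x_degree n m"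
        using strict[OF fInv m] by simp
      then have "q * (n * s * x_degree n m + 1) \<le> q * (s * ?N m + n * x_degree n m)"
        by (rule mult_left_mono) simp
      then show ?thesis using q[OF f m] by (simp only: distrib_left mult_1_right)
    qed simp
    then show "f \<in> C" by (simp add: C_def)
  qed
  ultimately have InvC: "?Inv \<subseteq> C" using S(2) hull_minimal[of S C is_subalgebra] by simp
  (* The invariant of order M has the gap n * s * (d - 1), independently of M,
     while its degree in x grows with M. *)
  define M where "M = q * n * (d - 1) + 1"
  define e where "e = s * (M + d - 1)"
  obtain f m where f: "f \<in> ?Inv" and m: "m \<in> keys f" "x_degree n m = e" "?N m = n * (e - M)"
  proof (rule exists_invariant[OF assms(4) _ _ _ e_def a0 R])
    show "1 \<le> d" "1 \<le> s" "1 \<le> M" using assms(1,2) by (simp_all add: M_def)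
  qed
  have "q * (n * s * e) + e \<le> q * (s * (n * (e - M)) + n * e)"
  proof -
    have "f \<in> C" using InvC f by (rule subsetD)
    then have "q * (n * s * x_degree n m) + x_degree n m \<le> q * (s * ?N m + n * x_degree n m)"
      using m(1) unfolding C_def by blast
    then show ?thesis unfolding m(2,3) .
  qed
  moreover have "s * (n * (e - M)) + n * e = n * s * e + n * s * (d - 1)"
  proof -
    have "1 * (M + d - 1) \<le> s * (M + d - 1)"
      using assms(2) by (intro mult_le_mono1) simp
    then have "M \<le> e" unfolding e_def using assms(1) by linarith
    then obtain r where r: "e = M + r" using le_Suc_ex by blast
    obtain d' where d': "d = Suc d'" using assms(1) by (cases d) auto
    have "s * (n * (e - M)) + n * s * M = n * s * e" by (simp add: r algebra_simps)
    moreover have "n * e = n * s * M + n * s * (d - 1)" by (simp add: e_def d' algebra_simps)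
    ultimately show ?thesis by linarith
  qed
  ultimately have "q * (n * s * e) + e \<le> q * (n * s * e + n * s * (d - 1))"
    by simp
  then have "e \<le> s * (q * n * (d - 1))" by (simp add: distrib_left mult_ac)
  then have "M + d - 1 \<le> q * n * (d - 1)" unfolding e_def using assms(2) by simp
  then show False using assms(1) by (simp add: M_def)
qed

end
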